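(* Consider a network of $N$ parallel roads with mixed human-driven and autonomous traffic, flow demand $(\bar{x},\bar{y})$ and altruism profile $\varphi$ with finite set $K$ of altruism levels. Finding a solution to the problem $$\operatorname*{arg\,min}_{m_{\mathrm{EQ}}\in[N],\ \ \hat{\ell}_0\in[a_{m_{\mathrm{EQ}}},\,a_{m_{\mathrm{EQ}}+1}),\ \ (\boldsymbol{x},\boldsymbol{y},\boldsymbol{s})\in \mathrm{ANE}(\bar{x},\bar{y},\hat{\ell}_0,\varphi)} C(\boldsymbol{x},\boldsymbol{y},\boldsymbol{s})$$ is equivalent to finding a routing in the set BANE of Best-case Altruistic Nash Equilibria, if any exist. Further, this problem can be solved in $O(|K|N^5)$ time, where $|K|$ is the number of altruism levels of autonomous vehicle users.
   Context: Network model. There are $N$ parallel roads (same origin and destination), indexed by $[N]=\{1,\dots,N\}$. Road $i$ has length $d_i>0$, free-flow speed $v^f_i>0$, maximum density $\rho^{\max}_i$, and nominal headways $\bar{h}_i\le h_i$ for autonomous and human-driven vehicles respectively; all vehicles have length $L>0$. Let $x_i,y_i\ge 0$ be the human-driven and autonomous flow on road $i$. The critical density is $$\rho^{\mathrm{crit}}_i(x_i,y_i)=\left(\frac{y_i}{x_i+y_i}\bar{h}_i+\frac{x_i}{x_i+y_i}h_i+L\right)^{-1},$$ with $\rho^{\mathrm{crit}}_i<\rho^{\max}_i$ always, and the maximum flow is $z^{\max}_i(x_i,y_i)=v^f_i\,\rho^{\mathrm{crit}}_i(x_i,y_i)$. The state $s_i\in\{0,1\}$ says whether road $i$ is in free-flow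 ($s_i=0$) or congested ($s_i=1$). The latency is $$\ell_i(x_i,y_i,s_i)=\begin{cases} d_i/v^f_i, & s_i=0,\\ d_i\left(\dfrac{\rho^{\max}_i}{x_i+y_i}+\dfrac{\rho^{\mathrm{crit}}_i(x_i,y_i)-\rho^{\max}_i}{z^{\max}_i(x_i,y_i)}\right), & s_i=1.\end{cases}$$ The free-flow latency is $a_i=d_i/v^f_i$; no two roads have equal free-flow latencies and roads are ordered so that $a_1<a_2<\dots<a_N$, with the convention $a_{N+1}=\infty$. A road with zero flow is in free-flow (latency $a_i$), and a road carrying exactly its maximum flow (where both formulas give $a_i$) is regarded as in free-flow. Routings. The demand $(\bar{x},\bar{y})$, $\bar{x},\bar{y}\ge 0$, is inelastic. A feasible routing of the demand is a triple $(\boldsymbol{x},\boldsymbol{y},\boldsymbol{s})\in\mathbb{R}^N_{\ge0}\times\mathbb{R}^N_{\ge0}\times\{0,1\}^N$ with $\sum_i x_i=\bar{x}$, $\sum_i y_i=\bar{y}$ and $x_i+y_i\le z^{\max}_i(x_i,y_i)$ on every road (trivially satisfied if $x_i+y_i=0$). Its total latency is $C(\boldsymbol{x},\boldsymbol{y},\boldsymbol{s})=\sum_{i\in[N]}(x_i+y_i)\ell_i(x_i,y_i,s_i)$. Altruism. Human drivers are selfish. The altruism profile of autonomous users is a nondecreasing function $\varphi:\mathbb{R}_{\ge0}\to[0,1]$: a volume $\varphi(\kappa)\bar{y}$ of autonomous flow rejects any route whose delay is $\kappa$ times the minimum available route delay. It has a finite set of altruism levels $K=\{\kappa_0<\kappa_1<\dots<\kappa_{|K|-1}\}$,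 meaning that $\varphi(\kappa)=0$ for $0\le\kappa\le\kappa_0$, $\varphi(\kappa)=\varphi_j$ for $\kappa_j<\kappa\le\kappa_{j+1}$ ($0\le j\le |K|-2$, constants $\varphi_j\in[0,1]$ nondecreasing in $j$), and $\varphi(\kappa)=1$ for $\kappa>\kappa_{|K|-1}$. For an equilibrium latency $\hat{\ell}_0$, the set $\mathrm{ANE}(\bar{x},\bar{y},\hat{\ell}_0,\varphi)$ of Altruistic Nash Equilibria consists of the feasible routings such that (i) all roads with human-driven flow have latency $\hat{\ell}_0$, and $\hat{\ell}_0\le\ell_i(x_i,y_i,s_i)$ for all $i\in[N]$; and (ii) for every $\ell\ge0$, a volume of at least $\varphi(\ell/\hat{\ell}_0)\,\bar{y}$ of autonomous traffic experiences a delay less than or equal to $\ell$. BANE is the set of routings that minimize $C$ among all Altruistic Nash Equilibria (over all $\hat{\ell}_0$) for the given $\bar{x},\bar{y},\varphi$. Complexity. Running time is measured as a function of $N$ and $|K|$, using that a linear program with $O(N)$ variables and constraints is solved in $O(N^3)$ time. *)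

theory Defs
  imports Complex_Main "HOL-Library.FuncSet" "HOL-Library.Extended_Real"
begin

section \<open>Parallel roads with mixed traffic\<close>

text \<open>Roads are numbered \<open>1, \<dots>, roads net\<close>; values of the fields at other indices are irrelevant.\<close>

record network =
  roads :: nat
  dist_of :: "nat \<Rightarrow> real"        \<comment> \<open>length $d_i$\<close>
  vfree :: "nat \<Rightarrow> real"          \<comment> \<open>free-flow speed $v^f_i$\<close>
  rho_max :: "nat \<Rightarrow> real"
  hw_aut :: "nat \<Rightarrow> real"         \<comment> \<open>autonomous headway $\bar h_i$\<close>
  hw_hum :: "nat \<Rightarrow> real"         \<comment> \<open>human-driven headway $h_i$\<close>
  veh_len :: real

text \<open>Arguments \<open>x\<close>, \<open>y\<close> are the human-driven and the autonomous flow.\<close>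

definition rho_crit :: "network \<Rightarrow> nat \<Rightarrow> real \<Rightarrow> real \<Rightarrow> real" where
  "rho_crit net i x y =
     inverse (y / (x + y) * hw_aut net i + x / (x + y) * hw_hum net i + veh_len net)"

definition z_max :: "network \<Rightarrow> nat \<Rightarrow> real \<Rightarrow> real \<Rightarrow> real" where
  "z_max net i x y = vfree net i * rho_crit net i x y"

definition latency :: "network \<Rightarrow> nat \<Rightarrow> real \<Rightarrow> real \<Rightarrow> nat \<Rightarrow> real" where
  "latency net i x y s =
     (if s = 0 then dist_of net i / vfree net i
      else dist_of net i *
        (rho_max net i / (x + y) + (rho_crit net i x y - rho_max net i) / z_max net i x y))"

definition ff_latency :: "network \<Rightarrow> nat \<Rightarrow> real" where
  "ff_latency net i = dist_of net i / vfree net i"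

definition ff_latency_ext :: "network \<Rightarrow> nat \<Rightarrow> ereal" where
  "ff_latency_ext net i = (if i \<le> roads net then ereal (ff_latency net i) else \<infinity>)"

text \<open>
  The bound on the critical density is only required for positive flow: at zero flow
  \<^const>\<open>rho_crit\<close> takes the meaningless value \<open>1 / veh_len net\<close> because \<open>0 / 0 = 0\<close>.
\<close>

definition valid_network :: "network \<Rightarrow> bool" where
  "valid_network net \<longleftrightarrow>
     1 \<le> roads net \<and> 0 < veh_len net \<and>
     (\<forall>i\<in>{1..roads net}.
        0 < dist_of net i \<and> 0 < vfree net i \<and> 0 < rho_max net i \<and>
        0 \<le> hw_aut net i \<and> hw_aut net i \<le> hw_hum net i \<and>
        (\<forall>x\<ge>0. \<forall>y\<ge>0. 0 < x + y \<longrightarrow> rho_crit net i x y < rho_max net i)) \<and>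
     strict_mono_on {1..roads net} (ff_latency net)"

section \<open>Routings and altruistic equilibria\<close>

text \<open>A routing is \<open>(x, y, s)\<close>, with \<open>s i = 0\<close> for free-flow and \<open>s i = 1\<close> for congestion.\<close>

type_synonym routing = "(nat \<Rightarrow> real) \<times> (nat \<Rightarrow> real) \<times> (nat \<Rightarrow> nat)"

text \<open>
  The last condition is the convention that a road without flow, or carrying exactly its
  maximum flow, is in free-flow. The capacity condition holds trivially at zero flow.
\<close>

definition feasible_routings :: "network \<Rightarrow> real \<Rightarrow> real \<Rightarrow> routing set" where
  "feasible_routings net xbar ybar =
     {(x, y, s).
        x \<in> {1..roads net} \<rightarrow>\<^sub>E {0..} \<and>
        y \<in> {1..roads net} \<rightarrow>\<^sub>E {0..} \<and>
        s \<in> {1..roads net} \<rightarrow>\<^sub>E {0, 1} \<and>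
        (\<Sum>i\<in>{1..roads net}. x i) = xbar \<and>
        (\<Sum>i\<in>{1..roads net}. y i) = ybar \<and>
        (\<forall>i\<in>{1..roads net}. x i + y i \<le> z_max net i (x i) (y i)) \<and>
        (\<forall>i\<in>{1..roads net}. x i + y i = 0 \<or> x i + y i = z_max net i (x i) (y i) \<longrightarrow> s i = 0)}"

definition total_latency :: "network \<Rightarrow> routing \<Rightarrow> real" where
  "total_latency net = (\<lambda>(x, y, s).
     \<Sum>i\<in>{1..roads net}. (x i + y i) * latency net i (x i) (y i) (s i))"

text \<open>
  The profile \<open>\<phi>\<close> has the altruism levels \<open>ks\<close>, listed increasingly, and takes the
  value \<open>ps ! j\<close> between the levels \<open>ks ! j\<close> and \<open>ks ! Suc j\<close>.
\<close>

definition altruism_profile :: "(real \<Rightarrow> real) \<Rightarrow> real list \<Rightarrow> real list \<Rightarrow> bool" where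
  "altruism_profile \<phi> ks ps \<longleftrightarrow>
     mono_on {0..} \<phi> \<and> \<phi> ` {0..} \<subseteq> {0..1} \<and>
     ks \<noteq> [] \<and> sorted_wrt (<) ks \<and> set ks \<subseteq> {0..} \<and>
     length ks = Suc (length ps) \<and> sorted ps \<and> set ps \<subseteq> {0..1} \<and>
     (\<forall>\<kappa>. 0 \<le> \<kappa> \<and> \<kappa> \<le> hd ks \<longrightarrow> \<phi> \<kappa> = 0) \<and>
     (\<forall>j < length ps. \<forall>\<kappa>. ks ! j < \<kappa> \<and> \<kappa> \<le> ks ! Suc j \<longrightarrow> \<phi> \<kappa> = ps ! j) \<and>
     (\<forall>\<kappa> > last ks. \<phi> \<kappa> = 1)"

text \<open>
  Positivity of the equilibrium latency \<open>l0\<close> is required explicitly: the ratio \<open>l / l0\<close>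
  has no meaning for \<open>l0 = 0\<close> and leaves the domain of \<open>\<phi>\<close> for \<open>l0 < 0\<close>.
\<close>

definition ANE :: "network \<Rightarrow> real \<Rightarrow> real \<Rightarrow> real \<Rightarrow> (real \<Rightarrow> real) \<Rightarrow> routing set" where
  "ANE net xbar ybar l0 \<phi> =
     {(x, y, s). (x, y, s) \<in> feasible_routings net xbar ybar \<and> 0 < l0 \<and>
        (\<forall>i\<in>{1..roads net}. 0 < x i \<longrightarrow> latency net i (x i) (y i) (s i) = l0) \<and>
        (\<forall>i\<in>{1..roads net}. l0 \<le> latency net i (x i) (y i) (s i)) \<and>
        (\<forall>l\<ge>0. \<phi> (l / l0) * ybar
           \<le> (\<Sum>i | i \<in> {1..roads net} \<and> latency net i (x i) (y i) (s i) \<le> l. y i))}"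

definition BANE :: "network \<Rightarrow> real \<Rightarrow> real \<Rightarrow> (real \<Rightarrow> real) \<Rightarrow> routing set" where
  "BANE net xbar ybar \<phi> =
     {r. is_arg_min (total_latency net) (\<lambda>r. \<exists>l0. r \<in> ANE net xbar ybar l0 \<phi>) r}"

definition opt_solutions ::
    "network \<Rightarrow> real \<Rightarrow> real \<Rightarrow> (real \<Rightarrow> real) \<Rightarrow> (nat \<times> real \<times> routing) set" where
  "opt_solutions net xbar ybar \<phi> =
     {p. is_arg_min (\<lambda>(m, l0, r). total_latency net r)
           (\<lambda>(m, l0, r). m \<in> {1..roads net} \<and>
              ereal l0 \<in> {ff_latency_ext net m ..< ff_latency_ext net (Suc m)} \<and>
              r \<in> ANE net xbar ybar l0 \<phi>) p}"

section \<open>Linear programs\<close>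

text \<open>
  Minimise \<open>\<Sum>j<n. c j * z j\<close> subject to \<open>(\<Sum>j<n. A i j * z j) \<le> b i\<close> for \<open>i < k\<close>;
  the \<open>n\<close> variables are not restricted in sign.
\<close>

definition lp_optimal ::
    "nat \<Rightarrow> nat \<Rightarrow> (nat \<Rightarrow> nat \<Rightarrow> real) \<Rightarrow> (nat \<Rightarrow> real) \<Rightarrow> (nat \<Rightarrow> real) \<Rightarrow> (nat \<Rightarrow> real) \<Rightarrow> bool"
  where
  "lp_optimal n k A b c =
     is_arg_min (\<lambda>z. \<Sum>j<n. c j * z j) (\<lambda>z. \<forall>i<k. (\<Sum>j<n. A i j * z j) \<le> b i)"

type_synonym lp_solver =
  "nat \<Rightarrow> nat \<Rightarrow> (nat \<Rightarrow> nat \<Rightarrow> real) \<Rightarrow> (nat \<Rightarrow> real) \<Rightarrow> (nat \<Rightarrow> real) \<Rightarrow> (nat \<Rightarrow> real) option"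

definition lp_solver_correct :: "lp_solver \<Rightarrow> bool" where
  "lp_solver_correct S \<longleftrightarrow>
     (\<forall>n k A b c. case S n k A b c of
        Some z \<Rightarrow> lp_optimal n k A b c z
      | None \<Rightarrow> \<not> (\<exists>z. lp_optimal n k A b c z))"

lemma lp_solver_correct_exists: "\<exists>S. lp_solver_correct S"
proof
  show "lp_solver_correct (\<lambda>n k A b c. if \<exists>z. lp_optimal n k A b c z
      then Some (SOME z. lp_optimal n k A b c z) else None)"
    by (simp add: lp_solver_correct_def some_eq_ex)
qed

section \<open>Real-number random access machine with linear programming\<close>

text \<open>
  Memory consists of named two-dimensional arrays of naturals (for counters, indices and
  flags) and of reals; scalars are kept at index \<open>(0, 0)\<close>. Real arithmetic is exact and there
  is no conversion between reals and naturals. Naturals can only be added and subtracted.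
\<close>

type_synonym name = string

record state =
  nats :: "name \<Rightarrow> nat \<Rightarrow> nat \<Rightarrow> nat"
  reals :: "name \<Rightarrow> nat \<Rightarrow> nat \<Rightarrow> real"

datatype nexp = NNum nat | NCell name nexp nexp | NAdd nexp nexp | NSub nexp nexp

datatype rexp = RNum int | RCell name nexp nexp
  | RAdd rexp rexp | RSub rexp rexp | RMul rexp rexp | RDiv rexp rexp

datatype bexp = NLess nexp nexp | RLess rexp rexp | BNot bexp | BAnd bexp bexp

primrec nval :: "nexp \<Rightarrow> state \<Rightarrow> nat" where
  "nval (NNum n) \<sigma> = n"
| "nval (NCell a i j) \<sigma> = nats \<sigma> a (nval i \<sigma>) (nval j \<sigma>)"
| "nval (NAdd e f) \<sigma> = nval e \<sigma> + nval f \<sigma>"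
| "nval (NSub e f) \<sigma> = nval e \<sigma> - nval f \<sigma>"

primrec rval :: "rexp \<Rightarrow> state \<Rightarrow> real" where
  "rval (RNum n) \<sigma> = of_int n"
| "rval (RCell a i j) \<sigma> = reals \<sigma> a (nval i \<sigma>) (nval j \<sigma>)"
| "rval (RAdd e f) \<sigma> = rval e \<sigma> + rval f \<sigma>"
| "rval (RSub e f) \<sigma> = rval e \<sigma> - rval f \<sigma>"
| "rval (RMul e f) \<sigma> = rval e \<sigma> * rval f \<sigma>"
| "rval (RDiv e f) \<sigma> = rval e \<sigma> / rval f \<sigma>"

primrec bval :: "bexp \<Rightarrow> state \<Rightarrow> bool" where
  "bval (NLess e f) \<sigma> \<longleftrightarrow> nval e \<sigma> < nval f \<sigma>"
| "bval (RLess e f) \<sigma> \<longleftrightarrow> rval e \<sigma> < rval f \<sigma>"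
| "bval (BNot b) \<sigma> \<longleftrightarrow> \<not> bval b \<sigma>"
| "bval (BAnd b c) \<sigma> \<longleftrightarrow> bval b \<sigma> \<and> bval c \<sigma>"

text \<open>
  \<open>Solve_LP n k A b c z ok\<close> solves the program with \<open>n\<close> variables and \<open>k\<close> constraints whose
  data are stored in the arrays \<open>A\<close> (row \<open>i\<close>, column \<open>j\<close>), \<open>b\<close> and \<open>c\<close>. It writes an
  optimal point to \<open>z\<close> and sets the flag \<open>ok\<close> to 1, or sets \<open>ok\<close> to 0 if there is none.
\<close>

datatype com =
    Skip
  | NAssign name nexp nexp nexp
  | RAssign name nexp nexp rexp
  | Solve_LP nexp nexp name name name name name
  | Seq com com
  | Cond bexp com com
  | Loop bexp com

definition upd :: "(name \<Rightarrow> nat \<Rightarrow> nat \<Rightarrow> 'a) \<Rightarrow> name \<Rightarrow> nat \<Rightarrow> nat \<Rightarrow> 'a \<Rightarrow> name \<Rightarrow> nat \<Rightarrow> nat \<Rightarrow> 'a"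
  where "upd M a i j v = M(a := (M a)(i := (M a i)(j := v)))"

definition store_lp_result :: "name \<Rightarrow> name \<Rightarrow> nat \<Rightarrow> (nat \<Rightarrow> real) option \<Rightarrow> state \<Rightarrow> state" where
  "store_lp_result z ok n res \<sigma> =
     (case res of
        None \<Rightarrow> \<sigma>\<lparr>nats := upd (nats \<sigma>) ok 0 0 0\<rparr>
      | Some v \<Rightarrow> \<sigma>\<lparr>nats := upd (nats \<sigma>) ok 0 0 1,
          reals := (reals \<sigma>)(z := (\<lambda>j l. if j < n \<and> l = 0 then v j else reals \<sigma> z j l))\<rparr>)"

text \<open>
  \<open>exec S c \<sigma> t \<sigma>'\<close>: started in \<open>\<sigma>\<close>, the command \<open>c\<close> terminates in \<open>\<sigma>'\<close> after time \<open>t\<close>.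
  Assignments and tests take unit time, whatever the size of their expressions; this size
  is fixed by the program text, so it only affects constant factors.
\<close>

inductive exec :: "lp_solver \<Rightarrow> com \<Rightarrow> state \<Rightarrow> nat \<Rightarrow> state \<Rightarrow> bool" for S where
  Skip: "exec S Skip \<sigma> 1 \<sigma>"
| NAssign: "exec S (NAssign a i j e) \<sigma> 1
    (\<sigma>\<lparr>nats := upd (nats \<sigma>) a (nval i \<sigma>) (nval j \<sigma>) (nval e \<sigma>)\<rparr>)"
| RAssign: "exec S (RAssign a i j e) \<sigma> 1
    (\<sigma>\<lparr>reals := upd (reals \<sigma>) a (nval i \<sigma>) (nval j \<sigma>) (rval e \<sigma>)\<rparr>)"
| Solve_LP: "exec S (Solve_LP n k A b c z ok) \<sigma> (1 + (nval n \<sigma> + nval k \<sigma>) ^ 3)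
    (store_lp_result z ok (nval n \<sigma>)
      (S (nval n \<sigma>) (nval k \<sigma>) (reals \<sigma> A) (\<lambda>i. reals \<sigma> b i 0) (\<lambda>j. reals \<sigma> c j 0)) \<sigma>)"
| Seq: "\<lbrakk>exec S c \<sigma> t \<sigma>'; exec S d \<sigma>' u \<sigma>''\<rbrakk> \<Longrightarrow> exec S (Seq c d) \<sigma> (t + u) \<sigma>''"
| Cond_True: "\<lbrakk>bval b \<sigma>; exec S c \<sigma> t \<sigma>'\<rbrakk> \<Longrightarrow> exec S (Cond b c d) \<sigma> (1 + t) \<sigma>'"
| Cond_False: "\<lbrakk>\<not> bval b \<sigma>; exec S d \<sigma> t \<sigma>'\<rbrakk> \<Longrightarrow> exec S (Cond b c d) \<sigma> (1 + t) \<sigma>'"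
| Loop_True: "\<lbrakk>bval b \<sigma>; exec S c \<sigma> t \<sigma>'; exec S (Loop b c) \<sigma>' u \<sigma>''\<rbrakk>
    \<Longrightarrow> exec S (Loop b c) \<sigma> (1 + t + u) \<sigma>''"
| Loop_False: "\<not> bval b \<sigma> \<Longrightarrow> exec S (Loop b c) \<sigma> 1 \<sigma>"

inductive_cases exec_SkipE: "exec S Skip \<sigma> t \<sigma>'"
inductive_cases exec_NAssignE: "exec S (NAssign a i j e) \<sigma> t \<sigma>'"
inductive_cases exec_RAssignE: "exec S (RAssign a i j e) \<sigma> t \<sigma>'"
inductive_cases exec_Solve_LPE: "exec S (Solve_LP n k A b c z ok) \<sigma> t \<sigma>'"
inductive_cases exec_SeqE: "exec S (Seq c d) \<sigma> t \<sigma>'"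
inductive_cases exec_CondE: "exec S (Cond b c d) \<sigma> t \<sigma>'"
inductive_cases exec_LoopE: "exec S (Loop b c) \<sigma> t \<sigma>'"

lemma exec_deterministic:
  "exec S c \<sigma> t \<sigma>' \<Longrightarrow> exec S c \<sigma> u \<sigma>'' \<Longrightarrow> u = t \<and> \<sigma>'' = \<sigma>'"
proof (induction arbitrary: u \<sigma>'' rule: exec.induct)
  case (Seq c \<sigma> t \<sigma>1 d v \<sigma>2)
  obtain t' \<sigma>1' v' where *: "exec S c \<sigma> t' \<sigma>1'" "exec S d \<sigma>1' v' \<sigma>''" "u = t' + v'"
    using Seq.prems by (rule exec_SeqE)
  from Seq.IH(1)[OF *(1)] Seq.IH(2) * show ?case by simp
next
  case (Cond_True b \<sigma> c t \<sigma>1 d)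
  obtain t' where *: "exec S c \<sigma> t' \<sigma>''" "u = 1 + t'"
    using Cond_True.prems by (rule exec_CondE) (simp_all add: Cond_True.hyps)
  from Cond_True.IH[OF *(1)] *(2) show ?case by simp
next
  case (Cond_False b \<sigma> d t \<sigma>1 c)
  obtain t' where *: "exec S d \<sigma> t' \<sigma>''" "u = 1 + t'"
    using Cond_False.prems by (rule exec_CondE) (simp_all add: Cond_False.hyps)
  from Cond_False.IH[OF *(1)] *(2) show ?case by simp
next
  case (Loop_True b \<sigma> c t \<sigma>1 v \<sigma>2)
  obtain t' \<sigma>1' v' where *: "exec S c \<sigma> t' \<sigma>1'" "exec S (Loop b c) \<sigma>1' v' \<sigma>''"
      "u = 1 + t' + v'"
    using Loop_True.prems by (rule exec_LoopE) (simp_all add: Loop_True.hyps)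
  from Loop_True.IH(1)[OF *(1)] Loop_True.IH(2) * show ?case by simp
next
  case (Loop_False b \<sigma> c)
  show ?case
    using Loop_False.prems by (rule exec_LoopE) (simp_all add: Loop_False.hyps)
next
  case (Skip \<sigma>)
  then show ?case by (rule exec_SkipE) simp
next
  case (NAssign a i j e \<sigma>)
  then show ?case by (rule exec_NAssignE) simp
next
  case (RAssign a i j e \<sigma>)
  then show ?case by (rule exec_RAssignE) simp
next
  case (Solve_LP n k A b c z ok \<sigma>)
  then show ?case by (rule exec_Solve_LPE) simp
qed

section \<open>Input and output\<close>

text \<open>Cells that do not hold input data may have arbitrary initial contents.\<close>

definition input_state ::
    "network \<Rightarrow> real \<Rightarrow> real \<Rightarrow> real list \<Rightarrow> real list \<Rightarrow> state \<Rightarrow> bool" where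
  "input_state net xbar ybar ks ps \<sigma> \<longleftrightarrow>
     nats \<sigma> ''N'' 0 0 = roads net \<and> nats \<sigma> ''K'' 0 0 = length ks \<and>
     (\<forall>i\<in>{1..roads net}.
        reals \<sigma> ''d'' i 0 = dist_of net i \<and>
        reals \<sigma> ''vfree'' i 0 = vfree net i \<and>
        reals \<sigma> ''rho_max'' i 0 = rho_max net i \<and>
        reals \<sigma> ''hw_aut'' i 0 = hw_aut net i \<and>
        reals \<sigma> ''hw_hum'' i 0 = hw_hum net i) \<and>
     reals \<sigma> ''veh_len'' 0 0 = veh_len net \<and>
     reals \<sigma> ''xbar'' 0 0 = xbar \<and> reals \<sigma> ''ybar'' 0 0 = ybar \<and>
     (\<forall>j < length ks. reals \<sigma> ''kappa'' j 0 = ks ! j) \<and>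
     (\<forall>j < length ps. reals \<sigma> ''phi'' j 0 = ps ! j)"

definition output_of :: "network \<Rightarrow> state \<Rightarrow> nat \<times> real \<times> routing" where
  "output_of net \<sigma> =
     (nats \<sigma> ''m'' 0 0, reals \<sigma> ''l0'' 0 0,
      \<lambda>i\<in>{1..roads net}. reals \<sigma> ''x'' i 0,
      \<lambda>i\<in>{1..roads net}. reals \<sigma> ''y'' i 0,
      \<lambda>i\<in>{1..roads net}. nats \<sigma> ''s'' i 0)"

text \<open>The flag \<open>found\<close> tells whether the problem has a solution at all.\<close>

definition output_correct ::
    "network \<Rightarrow> real \<Rightarrow> real \<Rightarrow> (real \<Rightarrow> real) \<Rightarrow> state \<Rightarrow> bool" where
  "output_correct net xbar ybar \<phi> \<sigma> \<longleftrightarrow>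
     (if nats \<sigma> ''found'' 0 0 = 1 then output_of net \<sigma> \<in> opt_solutions net xbar ybar \<phi>
      else opt_solutions net xbar ybar \<phi> = {})"

end

theory Submission
  imports Defs "HOL-Analysis.Function_Topology"
begin

text \<open>
  Write \<open>a i\<close> for the free-flow latency of road \<open>i\<close>. After multiplication by the flow, the equation
  \<open>latency = l\<close> of a congested road becomes linear in the two flows, and so do the capacity
  constraint and the contribution of the road to the total latency. For a fixed equilibrium latency
  \<open>l\<close> the following routings therefore form a polyhedron with a linear cost: every road with
  \<open>a i < l\<close> is congested at latency exactly \<open>l\<close>, all other roads are in free-flow, human drivers
  only use roads of latency \<open>l\<close>, and the altruism constraints hold. They are called saturated; each
  of them with \<open>a 1 \<le> l\<close> is an equilibrium (\<open>saturated_ANE\<close>).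

  The heart of the matter is that some saturated routing is at least as good as any given
  equilibrium, with \<open>l\<close> taken from the finite set of quotients \<open>a i / q\<close>, where \<open>q\<close> is an
  altruism level or 1 (\<open>relaxed_to_saturated\<close>). In an equilibrium a road shorter than \<open>l\<close> may be
  congested above \<open>l\<close> by autonomous vehicles, and longer roads may be congested as well. Charging
  every road the smaller latency \<open>max l (a i)\<close> gives a relaxed routing of no greater cost that
  satisfies the altruism constraints for these latencies (\<open>ANE_relaxed\<close>). A relaxed routing stays
  relaxed when \<open>l\<close> is lowered to the next quotient: capacities grow, no free-flow latency is passed,
  and the altruism constraints depend on \<open>l\<close> only through the position of the ratios \<open>a i / l\<close> among
  the levels. There, flow is moved from roads with
  \<open>l \<le> a i\<close> to shorter roads that have room left: this lowers the cost and helps the altruism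
  constraints. Either the shorter roads fill up and the routing is saturated, or all flow ends up on
  the shorter roads; then everybody travels at latency \<open>l\<close>, altruism is no longer needed, and \<open>l\<close> can
  drop to the longest of these roads. The number of roads shorter than \<open>l\<close> decreases, so the process
  stops. Minima over a single polyhedron exist by compactness, hence the problem has a solution as
  soon as one of the finitely many polyhedra is nonempty.

  For the equivalence with best-case equilibria it only remains to see that the constraint
  \<open>a m \<le> l < a (m + 1)\<close> excludes no routing. An equilibrium latency below \<open>a 1\<close> is possible without
  human-driven flow only, and it can then be raised to \<open>a 1\<close> (\<open>ANE_lift\<close>).

  The algorithm solves one linear program with \<open>O(N)\<close> variables and constraints for each of the
  \<open>N * (|K| + 1)\<close> quotients. It needs the values of the profile at \<open>a k / l\<close> for all roads \<open>k\<close>. A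
  separate scan of the levels for each value would be quadratic in \<open>|K|\<close>; but for \<open>l = a i / q\<close> with
  increasing \<open>q\<close> the ratio \<open>a k / l = a k * q / a i\<close> increases, so for each pair of roads \<open>i\<close>, \<open>k\<close> a
  single merge of two sorted lists finds the values for all levels \<open>q\<close> (\<open>runs_merge\<close>). The running
  time is then dominated by the linear programs, which take \<open>O(|K| N\<^sup>4)\<close> in total.
\<close>

section \<open>Congested roads as linear equations\<close>

text \<open>
  Multiplied by the flow, the latency \<open>l\<close> of a congested road satisfies the linear equation
  \<open>load net i l x y = road_cap net i\<close>; at \<open>l = a i\<close> the load equals \<open>road_cap\<close> exactly when the
  flow is maximal.
\<close>

definition road_cap :: "network \<Rightarrow> nat \<Rightarrow> real" where
  "road_cap net i = dist_of net i * rho_max net i"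

definition hum_coef :: "network \<Rightarrow> nat \<Rightarrow> real \<Rightarrow> real" where
  "hum_coef net i l =
     l + dist_of net i / vfree net i * (rho_max net i * (hw_hum net i + veh_len net) - 1)"

definition aut_coef :: "network \<Rightarrow> nat \<Rightarrow> real \<Rightarrow> real" where
  "aut_coef net i l =
     l + dist_of net i / vfree net i * (rho_max net i * (hw_aut net i + veh_len net) - 1)"

definition load :: "network \<Rightarrow> nat \<Rightarrow> real \<Rightarrow> real \<Rightarrow> real \<Rightarrow> real" where
  "load net i l x y = hum_coef net i l * x + aut_coef net i l * y"

text \<open>
  Every road is charged the latency \<open>max l (a i)\<close>. The last condition on a road expresses altruism
  at latencies just below that of road \<open>i\<close>, which at most the roads \<open>k < i\<close> can offer. At \<open>i = 1\<close> the
  sum is empty: no autonomous user may insist on less than the equilibrium latency.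
\<close>

definition relaxed_routing ::
    "network \<Rightarrow> real \<Rightarrow> real \<Rightarrow> (real \<Rightarrow> real) \<Rightarrow> real \<Rightarrow> (nat \<Rightarrow> real) \<Rightarrow> (nat \<Rightarrow> real) \<Rightarrow> bool" where
  "relaxed_routing net xbar ybar \<phi> l x y \<longleftrightarrow>
     (\<forall>i\<in>{1..roads net}. 0 \<le> x i \<and> 0 \<le> y i \<and>
        load net i (max l (ff_latency net i)) (x i) (y i) \<le> road_cap net i \<and>
        (l < ff_latency net i \<longrightarrow> x i \<le> 0) \<and>
        \<phi> (max l (ff_latency net i) / l) * ybar \<le> (\<Sum>k\<in>{1..<i}. y k)) \<and>
     (\<Sum>i\<in>{1..roads net}. x i) = xbar \<and> (\<Sum>i\<in>{1..roads net}. y i) = ybar"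

text \<open>
  Together with the capacity constraint, the additional inequality puts all roads shorter than \<open>l\<close>
  at latency exactly \<open>l\<close>.
\<close>

definition saturated_routing ::
    "network \<Rightarrow> real \<Rightarrow> real \<Rightarrow> (real \<Rightarrow> real) \<Rightarrow> real \<Rightarrow> (nat \<Rightarrow> real) \<Rightarrow> (nat \<Rightarrow> real) \<Rightarrow> bool" where
  "saturated_routing net xbar ybar \<phi> l x y \<longleftrightarrow>
     relaxed_routing net xbar ybar \<phi> l x y \<and>
     (\<forall>i\<in>{1..roads net}. ff_latency net i < l \<longrightarrow> road_cap net i \<le> load net i l (x i) (y i))"

definition level_cost :: "network \<Rightarrow> real \<Rightarrow> (nat \<Rightarrow> real) \<Rightarrow> (nat \<Rightarrow> real) \<Rightarrow> real" where
  "level_cost net l x y = (\<Sum>i\<in>{1..roads net}. max l (ff_latency net i) * (x i + y i))"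

lemma valid_networkD:
  assumes "valid_network net" "i \<in> {1..roads net}"
  shows "0 < dist_of net i" "0 < vfree net i" "0 < rho_max net i" "0 < veh_len net"
    "0 \<le> hw_aut net i" "hw_aut net i \<le> hw_hum net i" "0 \<le> hw_hum net i"
    "\<And>x y. 0 \<le> x \<Longrightarrow> 0 \<le> y \<Longrightarrow> 0 < x + y \<Longrightarrow> rho_crit net i x y < rho_max net i"
  using assms unfolding valid_network_def by fastforce+

lemma ff_latency_less_iff:
  assumes "valid_network net" "i \<in> {1..roads net}" "j \<in> {1..roads net}"
  shows "ff_latency net i < ff_latency net j \<longleftrightarrow> i < j"
  using assms unfolding valid_network_def by (metis linorder_neqE_nat order.asym strict_mono_onD order_less_irrefl)

lemma ff_latency_le_iff:
  assumes "valid_network net" "i \<in> {1..roads net}" "j \<in> {1..roads net}"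
  shows "ff_latency net i \<le> ff_latency net j \<longleftrightarrow> i \<le> j"
  using ff_latency_less_iff[OF assms(1,3,2)] by (simp add: not_less[symmetric])

lemma ff_latency_pos: "valid_network net \<Longrightarrow> i \<in> {1..roads net} \<Longrightarrow> 0 < ff_latency net i"
  by (simp add: ff_latency_def valid_networkD)

text \<open>
  The bounds on the critical density at purely human and purely autonomous flow say that
  \<open>rho_max\<close> times the vehicle spacing exceeds 1.
\<close>

lemma coef_pos:
  assumes v: "valid_network net" and i: "i \<in> {1..roads net}" and l: "0 \<le> l"
  shows "l < hum_coef net i l" "l < aut_coef net i l"
proof -
  note d = valid_networkD[OF v i]
  have h: "0 < hw_hum net i + veh_len net" "0 < hw_aut net i + veh_len net" using d by linarith+
  have "inverse (hw_hum net i + veh_len net) < rho_max net i"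
    using d(8)[of 1 0] by (simp add: rho_crit_def)
  then have 1: "0 < rho_max net i * (hw_hum net i + veh_len net) - 1"
    using h by (simp add: field_simps)
  have "inverse (hw_aut net i + veh_len net) < rho_max net i"
    using d(8)[of 0 1] by (simp add: rho_crit_def)
  then have 2: "0 < rho_max net i * (hw_aut net i + veh_len net) - 1"
    using h by (simp add: field_simps)
  show "l < hum_coef net i l" "l < aut_coef net i l"
    unfolding hum_coef_def aut_coef_def using 1 2 d(1,2) by simp_all
qed

lemma load_shift: "load net i l' x y = load net i l x y + (l' - l) * (x + y)"
  by (simp add: load_def hum_coef_def aut_coef_def algebra_simps)

text \<open>
  Read backwards: a congested road at a higher latency carries less flow.
\<close>

lemma load_mono:
  assumes "l \<le> l'" "0 \<le> x" "0 \<le> y"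
  shows "load net i l x y \<le> load net i l' x y"
  using load_shift[of net i l' x y l] assms by simp

lemma congested_road:
  assumes v: "valid_network net" and i: "i \<in> {1..roads net}" and xy: "0 \<le> x" "0 \<le> y" "0 < x + y"
  shows "latency net i x y (Suc 0) * (x + y)
           = road_cap net i - load net i 0 x y"
    and "x + y < z_max net i x y \<longleftrightarrow> load net i (ff_latency net i) x y < road_cap net i"
    and "x + y = z_max net i x y \<longleftrightarrow> load net i (ff_latency net i) x y = road_cap net i"
proof -
  note d = valid_networkD[OF v i]
  \<comment> \<open>capacity is the inequality \<open>w \<le> vfree net i\<close>\<close>
  define w where "w = y * (hw_aut net i + veh_len net) + x * (hw_hum net i + veh_len net)"
  have wpos: "w > 0"
  proof -
    have "w \<ge> (x + y) * veh_len net"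
      using d xy by (simp add: w_def algebra_simps)
    then show ?thesis using d(4) xy(3) by (smt (verit) mult_pos_pos)
  qed
  have rc: "rho_crit net i x y = (x + y) / w"
  proof -
    have "y / (x + y) * hw_aut net i + x / (x + y) * hw_hum net i + veh_len net = w / (x + y)"
    proof -
      have 1: "y / (x + y) + x / (x + y) = 1"
        using xy(3) by (simp add: add_divide_distrib[symmetric] add.commute)
      have "w / (x + y) = y / (x + y) * hw_aut net i + x / (x + y) * hw_hum net i
          + (y / (x + y) + x / (x + y)) * veh_len net"
        by (simp add: w_def add_divide_distrib algebra_simps)
      then show ?thesis by (simp add: 1)
    qed
    then show ?thesis by (simp add: rho_crit_def inverse_eq_divide)
  qed
  have zm: "z_max net i x y = vfree net i * (x + y) / w" by (simp add: z_max_def rc)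
  have ld: "load net i l x y = (l - ff_latency net i) * (x + y) + ff_latency net i * rho_max net i * w" for l
    unfolding load_def hum_coef_def aut_coef_def w_def ff_latency_def[symmetric]
    by (simp add: algebra_simps)
  have D: "road_cap net i = ff_latency net i * rho_max net i * vfree net i"
    using d by (simp add: road_cap_def ff_latency_def)
  have p: "0 < ff_latency net i * rho_max net i" using d by (simp add: ff_latency_def)
  show "latency net i x y (Suc 0) * (x + y) = road_cap net i - load net i 0 x y"
  proof -
    define z where "z = x + y"
    have z: "z > 0" using xy(3) by (simp add: z_def)
    have "(z / w - rho_max net i) / (vfree net i * z / w) = (z - rho_max net i * w) / (vfree net i * z)"
      using wpos z d by (simp add: field_simps)
    then have "latency net i x y (Suc 0) * z
        = dist_of net i * (rho_max net i / z + (z - rho_max net i * w) / (vfree net i * z)) * z"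
      by (simp add: latency_def zm rc z_def[symmetric])
    also have "\<dots> = dist_of net i * rho_max net i + dist_of net i / vfree net i * (z - rho_max net i * w)"
      using z d by (simp add: distrib_left distrib_right)
    also have "\<dots> = road_cap net i - load net i 0 x y"
      unfolding ld z_def[symmetric] by (simp add: road_cap_def ff_latency_def right_diff_distrib)
    finally show ?thesis by (simp add: z_def)
  qed
  have "load net i (ff_latency net i) x y < road_cap net i \<longleftrightarrow> w < vfree net i"
    unfolding ld D using mult_less_cancel_left_pos[OF p] by simp
  also have "\<dots> \<longleftrightarrow> (x + y) * w < (x + y) * vfree net i"
    using mult_less_cancel_left_pos[OF xy(3)] by simp
  also have "\<dots> \<longleftrightarrow> x + y < z_max net i x y"
    unfolding zm by (simp only: pos_less_divide_eq[OF wpos] mult.commute[of "x + y" "vfree net i"])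
  finally show "x + y < z_max net i x y \<longleftrightarrow> load net i (ff_latency net i) x y < road_cap net i" by simp
  have "load net i (ff_latency net i) x y = road_cap net i \<longleftrightarrow> w = vfree net i"
    unfolding ld D using p by auto
  also have "\<dots> \<longleftrightarrow> (x + y) * w = (x + y) * vfree net i"
    using xy(3) by auto
  also have "\<dots> \<longleftrightarrow> x + y = z_max net i x y"
    unfolding zm using wpos by (simp only: eq_divide_eq mult.commute[of "x + y" "vfree net i"]) simp
  finally show "x + y = z_max net i x y \<longleftrightarrow> load net i (ff_latency net i) x y = road_cap net i" by simp
qed

lemma latency_congested_iff:
  assumes v: "valid_network net" and i: "i \<in> {1..roads net}" and xy: "0 \<le> x" "0 \<le> y" "0 < x + y"
  shows "latency net i x y (Suc 0) = l \<longleftrightarrow> load net i l x y = road_cap net i"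
proof -
  have "latency net i x y (Suc 0) = l \<longleftrightarrow> latency net i x y (Suc 0) * (x + y) = l * (x + y)"
    using xy(3) by simp
  also have "\<dots> \<longleftrightarrow> load net i l x y = road_cap net i"
    unfolding congested_road(1)[OF assms] load_shift[of net i l x y 0] by auto
  finally show ?thesis .
qed

lemma latency_free: "latency net i x y 0 = ff_latency net i"
  by (simp add: latency_def ff_latency_def)

text \<open>
  The last part is what relaxed routings need from an equilibrium: whether a road is empty, in
  free-flow or congested, its flows fit onto a congested road of any latency between the
  free-flow latency and its own.
\<close>

lemma feasible_road:
  assumes v: "valid_network net" and r: "(x, y, s) \<in> feasible_routings net xbar ybar"
    and i: "i \<in> {1..roads net}"
  shows "0 \<le> x i" "0 \<le> y i" "ff_latency net i \<le> latency net i (x i) (y i) (s i)"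
    "ff_latency net i \<le> l \<Longrightarrow> l \<le> latency net i (x i) (y i) (s i) \<Longrightarrow>
       load net i l (x i) (y i) \<le> road_cap net i"
proof -
  show xi: "0 \<le> x i" and yi: "0 \<le> y i" using r i by (auto simp: feasible_routings_def)
  have cap: "x i + y i \<le> z_max net i (x i) (y i)"
    and fr: "x i + y i = 0 \<or> x i + y i = z_max net i (x i) (y i) \<Longrightarrow> s i = 0"
    and si: "s i = 0 \<or> s i = Suc 0"
    using r i by (auto simp: feasible_routings_def PiE_def Pi_def)
  have c: "0 < road_cap net i" using valid_networkD[OF v i] by (simp add: road_cap_def)
  show "ff_latency net i \<le> latency net i (x i) (y i) (s i)"
  proof (cases "s i = 0")
    case False
    then have s: "s i = Suc 0" and pos: "0 < x i + y i" and lt: "x i + y i < z_max net i (x i) (y i)"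
      using si fr cap xi yi by fastforce+
    have "load net i (ff_latency net i) (x i) (y i) < road_cap net i"
      using congested_road(2)[OF v i xi yi pos] lt by simp
    moreover have "load net i (latency net i (x i) (y i) (s i)) (x i) (y i) = road_cap net i"
      using latency_congested_iff[OF v i xi yi pos, THEN iffD1, OF refl] s by simp
    ultimately show ?thesis using load_mono[OF _ xi yi] by (metis linorder_not_less nle_le)
  qed (simp add: latency_free)
  assume l: "ff_latency net i \<le> l" "l \<le> latency net i (x i) (y i) (s i)"
  show "load net i l (x i) (y i) \<le> road_cap net i"
  proof (cases "x i + y i = 0")
    case True
    then have "x i = 0" "y i = 0" using xi yi by linarith+
    then show ?thesis using c by (simp add: load_def)
  next
    case False
    then have pos: "0 < x i + y i" using xi yi by linarith
    show ?thesis
    proof (cases "s i = 0")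
      case True
      then have "l = ff_latency net i" using l by (simp add: latency_free)
      then show ?thesis using congested_road(2,3)[OF v i xi yi pos] cap by (auto simp: le_less)
    next
      case False
      then have s: "s i = Suc 0" using si by simp
      have "load net i (latency net i (x i) (y i) (s i)) (x i) (y i) = road_cap net i"
        using latency_congested_iff[OF v i xi yi pos, THEN iffD1, OF refl] s by simp
      then show ?thesis using load_mono[OF l(2) xi yi] by metis
    qed
  qed
qed

section \<open>The altruism profile as a step function\<close>

text \<open>
  The number \<open>n\<close> of levels below \<open>\<kappa>\<close> determines \<open>\<phi> \<kappa>\<close>. The merge in the search
  program computes this number.
\<close>

lemma profile_pieces:
  assumes p: "altruism_profile \<phi> ks ps" and k: "0 \<le> \<kappa>"
    and below: "\<And>j. j < n \<Longrightarrow> ks ! j < \<kappa>" and above: "n < length ks \<Longrightarrow> \<kappa> \<le> ks ! n"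
    and n: "n \<le> length ks"
  shows "\<phi> \<kappa> = (if n = 0 then 0 else if n = length ks then 1 else ps ! (n - 1))"
proof -
  have *: "ks \<noteq> []" "length ks = Suc (length ps)"
    "\<And>\<kappa>. 0 \<le> \<kappa> \<Longrightarrow> \<kappa> \<le> hd ks \<Longrightarrow> \<phi> \<kappa> = 0"
    "\<And>j \<kappa>. j < length ps \<Longrightarrow> ks ! j < \<kappa> \<Longrightarrow> \<kappa> \<le> ks ! Suc j \<Longrightarrow> \<phi> \<kappa> = ps ! j"
    "\<And>\<kappa>. last ks < \<kappa> \<Longrightarrow> \<phi> \<kappa> = 1"
    using p by (auto simp: altruism_profile_def)
  consider "n = 0" | "n = length ks" "n \<noteq> 0" | m where "n = Suc m" "n < length ks"
    using n by (metis le_neq_implies_less not0_implies_Suc)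
  then show ?thesis
  proof cases
    case 1
    then show ?thesis using *(1,3) above k by (simp add: hd_conv_nth)
  next
    case 2
    then show ?thesis using *(1,5) below[of "n - 1"] by (simp add: last_conv_nth)
  next
    case 3
    then show ?thesis using *(2) *(4)[of m] below[of m] above by simp
  qed
qed

lemma level_position:
  assumes p: "altruism_profile \<phi> ks ps"
  obtains n where "n \<le> length ks" "\<And>j. j < n \<Longrightarrow> ks ! j < \<kappa>" "n < length ks \<Longrightarrow> \<kappa> \<le> ks ! n"
proof -
  define P where "P n \<longleftrightarrow> n = length ks \<or> (n < length ks \<and> \<kappa> \<le> ks ! n)" for n
  have ex: "P (length ks)" by (simp add: P_def)
  have 1: "P (LEAST n. P n)" using ex by (rule LeastI)
  have 2: "\<not> P j" if "j < (LEAST n. P n)" for j using that by (rule not_less_Least)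
  have le: "(LEAST n. P n) \<le> length ks" using ex by (rule Least_le)
  show ?thesis
  proof
    show "(LEAST n. P n) \<le> length ks" by (rule le)
    show "ks ! j < \<kappa>" if "j < (LEAST n. P n)" for j
      using 2[OF that] that le by (auto simp: P_def)
    show "\<kappa> \<le> ks ! (LEAST n. P n)" if "(LEAST n. P n) < length ks"
      using 1 that by (auto simp: P_def)
  qed
qed

text \<open>
  Levels belong to the piece on their left, so the profile is left-continuous. This turns the
  altruism condition at latencies below that of a road into a condition at the road itself.
\<close>

lemma profile_left_constant:
  assumes p: "altruism_profile \<phi> ks ps" and k: "0 < \<kappa>"
  obtains \<kappa>' where "0 \<le> \<kappa>'" "\<kappa>' < \<kappa>" "\<phi> \<kappa>' = \<phi> \<kappa>"
proof -
  obtain n where n: "n \<le> length ks" "\<And>j. j < n \<Longrightarrow> ks ! j < \<kappa>" "n < length ks \<Longrightarrow> \<kappa> \<le> ks ! n"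
    using level_position[OF p] by metis
  \<comment> \<open>no level lies between \<open>M\<close> and \<open>\<kappa>\<close>\<close>
  define M where "M = Max (insert 0 ((!) ks ` {..<n}))"
  have M: "M < \<kappa>" "0 \<le> M" using n(2) k by (auto simp: M_def)
  have Mj: "ks ! j \<le> M" if "j < n" for j using that by (auto simp: M_def)
  define \<kappa>' where "\<kappa>' = (M + \<kappa>) / 2"
  have k': "M < \<kappa>'" "\<kappa>' < \<kappa>" using M by (auto simp: \<kappa>'_def)
  have "\<phi> \<kappa>' = \<phi> \<kappa>"
    using profile_pieces[OF p _ n(2,3,1)] profile_pieces[OF p, of \<kappa>' n] k' M n Mj k
    by (smt (verit))
  then show ?thesis using that[of \<kappa>'] k' M by simp
qed

text \<open>
  The source of the finite candidate set: as \<open>l\<close> decreases, \<open>\<phi> (a k / l)\<close> changes only when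
  \<open>l\<close> passes below some quotient \<open>a k / q\<close>.
\<close>

lemma profile_jump:
  assumes p: "altruism_profile \<phi> ks ps" and k: "0 \<le> \<kappa>" "\<kappa> \<le> \<kappa>'" "\<phi> \<kappa> \<noteq> \<phi> \<kappa>'"
  obtains q where "q \<in> set ks" "\<kappa> \<le> q" "q < \<kappa>'"
proof -
  obtain n where n: "n \<le> length ks" "\<And>j. j < n \<Longrightarrow> ks ! j < \<kappa>'" "n < length ks \<Longrightarrow> \<kappa>' \<le> ks ! n"
    using level_position[OF p] by metis
  have "\<exists>j<n. \<kappa> \<le> ks ! j"
  proof (rule ccontr)
    assume "\<not> ?thesis"
    then have "\<And>j. j < n \<Longrightarrow> ks ! j < \<kappa>" by force
    then have "\<phi> \<kappa> = \<phi> \<kappa>'"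
      using profile_pieces[OF p, of \<kappa> n] profile_pieces[OF p, of \<kappa>' n] k n by force
    then show False using k by simp
  qed
  then show ?thesis using that n by (metis le_neq_implies_less nth_mem order_less_le_trans less_imp_le_nat linorder_not_less)
qed

lemma profile_mono: "altruism_profile \<phi> ks ps \<Longrightarrow> 0 \<le> \<kappa> \<Longrightarrow> \<kappa> \<le> \<kappa>' \<Longrightarrow> \<phi> \<kappa> \<le> \<phi> \<kappa>'"
  unfolding altruism_profile_def by (auto intro: mono_onD)

lemma profile_range: "altruism_profile \<phi> ks ps \<Longrightarrow> 0 \<le> \<kappa> \<Longrightarrow> 0 \<le> \<phi> \<kappa> \<and> \<phi> \<kappa> \<le> 1"
  unfolding altruism_profile_def by fastforce

section \<open>Compactness\<close>

lemma compact_box: "compact (PiE (UNIV :: nat set) (\<lambda>_. {0..B::real}))"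
proof -
  have "compactin (product_topology (\<lambda>_. euclidean) (UNIV::nat set)) (PiE UNIV (\<lambda>_. {0..B}))"
    by (simp add: compactin_PiE)
  then show ?thesis by (simp add: euclidean_product_topology)
qed

text \<open>
  Only the coordinates in \<open>I\<close> are bounded; since neither \<open>V\<close> nor \<open>f\<close> depends on the others, these
  can be set to zero, which makes the domain compact in the product topology.
\<close>

lemma min_attained:
  fixes V :: "((nat \<Rightarrow> real) \<times> (nat \<Rightarrow> real)) set" and f :: "(nat \<Rightarrow> real) \<times> (nat \<Rightarrow> real) \<Rightarrow> real"
  assumes cl: "closed V" and ne: "V \<noteq> {}"
    and bd: "\<And>x y i. (x, y) \<in> V \<Longrightarrow> i \<in> I \<Longrightarrow> 0 \<le> x i \<and> x i \<le> B \<and> 0 \<le> y i \<and> y i \<le> B"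
    and tr: "\<And>x y x' y'. (x, y) \<in> V \<Longrightarrow> (\<And>i. i \<in> I \<Longrightarrow> x' i = x i \<and> y' i = y i) \<Longrightarrow>
      (x', y') \<in> V \<and> f (x', y') = f (x, y)"
    and cont: "continuous_on UNIV f"
    and B: "0 \<le> B"
  obtains p where "p \<in> V" "\<And>q. q \<in> V \<Longrightarrow> f p \<le> f q"
proof -
  define Box where "Box = PiE (UNIV :: nat set) (\<lambda>_. {0..B})"
  define cut where "cut x = (\<lambda>i. if i \<in> I then x i else 0)" for x :: "nat \<Rightarrow> real"
  have cut: "(cut x, cut y) \<in> (Box \<times> Box) \<inter> V \<and> f (cut x, cut y) = f (x, y)" if "(x, y) \<in> V" for x y
    using tr[OF that, of "cut x" "cut y"] bd[OF that] B by (auto simp: Box_def cut_def)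
  have "compact ((Box \<times> Box) \<inter> V)"
    by (intro compact_Int_closed compact_Times cl) (simp_all add: Box_def compact_box)
  moreover have "(Box \<times> Box) \<inter> V \<noteq> {}" using ne cut by fastforce
  moreover have "continuous_on ((Box \<times> Box) \<inter> V) f" using cont continuous_on_subset by blast
  ultimately obtain p where p: "p \<in> (Box \<times> Box) \<inter> V" "\<And>q. q \<in> (Box \<times> Box) \<inter> V \<Longrightarrow> f p \<le> f q"
    using continuous_attains_inf[of "(Box \<times> Box) \<inter> V" f] by blast
  show ?thesis
  proof
    show "p \<in> V" using p by simp
    show "f p \<le> f q" if "q \<in> V" for q
      using p(2)[of "(cut (fst q), cut (snd q))"] cut[of "fst q" "snd q"] that by simp
  qed
qed

lemma continuous_on_fst_coord [continuous_intros]: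
  "continuous_on A (\<lambda>p::(nat \<Rightarrow> real) \<times> (nat \<Rightarrow> real). fst p i)"
  by (rule continuous_on_product_then_coordinatewise) (intro continuous_intros)

lemma continuous_on_snd_coord [continuous_intros]:
  "continuous_on A (\<lambda>p::(nat \<Rightarrow> real) \<times> (nat \<Rightarrow> real). snd p i)"
  by (rule continuous_on_product_then_coordinatewise) (intro continuous_intros)

lemma closed_Collect_Ball:
  "(\<And>i. i \<in> I \<Longrightarrow> closed {p. P i p}) \<Longrightarrow> closed {p. \<forall>i\<in>I. P i p}"
  by (simp add: Collect_ball_eq closed_INT)

lemma closed_Collect_imp_const: "closed {p. P p} \<Longrightarrow> closed {p. c \<longrightarrow> P p}"
  by (cases c) simp_all

lemma closed_relaxed: "closed {p. relaxed_routing net xbar ybar \<phi> l (fst p) (snd p)}"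
  unfolding relaxed_routing_def load_def
  by (intro closed_Collect_Ball closed_Collect_conj closed_Collect_le closed_Collect_eq
      closed_Collect_imp_const continuous_intros)

lemma closed_saturated: "closed {p. saturated_routing net xbar ybar \<phi> l (fst p) (snd p)}"
  unfolding saturated_routing_def load_def
  by (intro closed_Collect_Ball closed_Collect_conj closed_relaxed closed_Collect_le
      closed_Collect_imp_const continuous_intros)

lemma relaxed_cong:
  assumes "\<And>i. i \<in> {1..roads net} \<Longrightarrow> x' i = x i \<and> y' i = y i"
  shows "relaxed_routing net xbar ybar \<phi> l x' y' \<longleftrightarrow> relaxed_routing net xbar ybar \<phi> l x y"
proof -
  have 1: "(\<Sum>k\<in>{1..<i}. y' k) = (\<Sum>k\<in>{1..<i}. y k)" if "i \<in> {1..roads net}" for i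
    using assms that by (intro sum.cong) auto
  have "sum x' {1..roads net} = sum x {1..roads net}" "sum y' {1..roads net} = sum y {1..roads net}"
    using assms by (auto intro: sum.cong)
  then show ?thesis unfolding relaxed_routing_def using assms 1 by simp
qed

lemma saturated_cong:
  assumes "\<And>i. i \<in> {1..roads net} \<Longrightarrow> x' i = x i \<and> y' i = y i"
  shows "saturated_routing net xbar ybar \<phi> l x' y' \<longleftrightarrow> saturated_routing net xbar ybar \<phi> l x y"
  unfolding saturated_routing_def using relaxed_cong[of net x' x y' y, OF assms] assms by simp

lemma level_cost_cong:
  assumes "\<And>i. i \<in> {1..roads net} \<Longrightarrow> x' i = x i \<and> y' i = y i"
  shows "level_cost net l x' y' = level_cost net l x y"
  unfolding level_cost_def using assms by (intro sum.cong) auto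

lemma relaxed_bounds:
  assumes "relaxed_routing net xbar ybar \<phi> l x y" "i \<in> {1..roads net}"
  shows "0 \<le> x i \<and> x i \<le> xbar \<and> 0 \<le> y i \<and> y i \<le> ybar"
  using assms member_le_sum[of i "{1..roads net}" x] member_le_sum[of i "{1..roads net}" y]
  by (force simp: relaxed_routing_def)

lemma saturated_min_attained:
  assumes "saturated_routing net xbar ybar \<phi> l x0 y0" "0 \<le> xbar" "0 \<le> ybar"
  obtains x y where "saturated_routing net xbar ybar \<phi> l x y"
    "\<And>x' y'. saturated_routing net xbar ybar \<phi> l x' y' \<Longrightarrow> level_cost net l x y \<le> level_cost net l x' y'"
proof -
  let ?V = "{p. saturated_routing net xbar ybar \<phi> l (fst p) (snd p)}"
  have b: "0 \<le> x i \<and> x i \<le> xbar + ybar \<and> 0 \<le> y i \<and> y i \<le> xbar + ybar"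
    if "(x, y) \<in> ?V" "i \<in> {1..roads net}" for x y i
    using relaxed_bounds[of net xbar ybar \<phi> l x y i] that assms(2,3) by (simp add: saturated_routing_def)
  obtain p where p: "p \<in> ?V" "\<And>q. q \<in> ?V \<Longrightarrow>
      level_cost net l (fst p) (snd p) \<le> level_cost net l (fst q) (snd q)"
  proof (rule min_attained[OF closed_saturated, where I = "{1..roads net}"
        and f = "\<lambda>p. level_cost net l (fst p) (snd p)" and B = "xbar + ybar"])
    show "?V \<noteq> {}" using assms(1) by force
    show "continuous_on UNIV (\<lambda>p. level_cost net l (fst p) (snd p))"
      unfolding level_cost_def by (intro continuous_intros)
    show "(x', y') \<in> ?V \<and> level_cost net l (fst (x', y')) (snd (x', y')) = level_cost net l (fst (x, y)) (snd (x, y))"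
      if "(x, y) \<in> ?V" "\<And>i. i \<in> {1..roads net} \<Longrightarrow> x' i = x i \<and> y' i = y i" for x y x' y'
      using saturated_cong[of net x' x y' y xbar ybar \<phi> l, OF that(2)] level_cost_cong[of net x' x y' y l, OF that(2)] that(1) by simp
  qed (use b assms(2,3) in auto)
  show ?thesis using that[of "fst p" "snd p"] p by force
qed

section \<open>Equilibria versus saturated routings\<close>

locale mixed_traffic =
  fixes net :: network and xbar ybar :: real and \<phi> :: "real \<Rightarrow> real" and ks ps :: "real list"
  assumes valid: "valid_network net" and xbar: "0 \<le> xbar" and ybar: "0 \<le> ybar"
    and profile: "altruism_profile \<phi> ks ps"
begin

abbreviation "N \<equiv> roads net"
abbreviation "a \<equiv> ff_latency net"
abbreviation "relaxed \<equiv> relaxed_routing net xbar ybar \<phi>"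
abbreviation "saturated \<equiv> saturated_routing net xbar ybar \<phi>"
abbreviation "cost \<equiv> level_cost net"

lemma one_road: "1 \<in> {1..N}" using valid by (auto simp: valid_network_def)

lemma a_pos: "i \<in> {1..N} \<Longrightarrow> 0 < a i" using ff_latency_pos valid by blast

lemma a_first: "i \<in> {1..N} \<Longrightarrow> a 1 \<le> a i"
  using ff_latency_le_iff[OF valid one_road] by auto

text \<open>
  Latencies are at least \<open>max l (a i)\<close>, so charging this value lowers the cost and makes capacity and
  altruism easier to satisfy.
\<close>

lemma ANE_relaxed:
  assumes r: "(x, y, s) \<in> ANE net xbar ybar l \<phi>" and l: "a 1 \<le> l"
  shows "relaxed l x y" "cost l x y \<le> total_latency net (x, y, s)"
proof -
  let ?lat = "\<lambda>i. latency net i (x i) (y i) (s i)"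
  have f: "(x, y, s) \<in> feasible_routings net xbar ybar"
    and l0: "0 < l" and hum: "\<And>i. i \<in> {1..N} \<Longrightarrow> 0 < x i \<Longrightarrow> ?lat i = l"
    and min: "\<And>i. i \<in> {1..N} \<Longrightarrow> l \<le> ?lat i"
    and alt: "\<And>t. 0 \<le> t \<Longrightarrow> \<phi> (t / l) * ybar \<le> (\<Sum>i | i \<in> {1..N} \<and> ?lat i \<le> t. y i)"
    using r by (auto simp: ANE_def)
  note fr = feasible_road[OF valid f]
  have lat: "max l (a i) \<le> ?lat i" if "i \<in> {1..N}" for i
    using fr(3) min that by simp
  show "cost l x y \<le> total_latency net (x, y, s)"
    unfolding level_cost_def total_latency_def prod.case
    by (intro sum_mono) (use lat fr(1,2) in \<open>simp add: mult.commute mult_left_mono\<close>)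
  show "relaxed l x y"
    unfolding relaxed_routing_def
  proof (intro conjI ballI impI)
    fix i assume i: "i \<in> {1..N}"
    show "0 \<le> x i" "0 \<le> y i" using fr i by auto
    show "load net i (max l (a i)) (x i) (y i) \<le> road_cap net i"
      using fr(4)[OF i, of "max l (a i)"] lat[OF i] by simp
    show "x i \<le> 0" if "l < a i" using hum[OF i] lat[OF i] that by force
    \<comment> \<open>roads of latency at most \<open>\<kappa> * l < max l (a i)\<close> have an index below \<open>i\<close>\<close>
    obtain \<kappa> where k: "0 \<le> \<kappa>" "\<kappa> < max l (a i) / l" "\<phi> \<kappa> = \<phi> (max l (a i) / l)"
      using profile_left_constant[OF profile, of "max l (a i) / l"] l0 by (metis divide_pos_pos max.strict_coboundedI1)
    have kl: "\<kappa> * l < max l (a i)" using k(2) l0 by (simp add: field_simps)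
    have "\<phi> (max l (a i) / l) * ybar = \<phi> (\<kappa> * l / l) * ybar" using k l0 by simp
    also have "\<dots> \<le> (\<Sum>k | k \<in> {1..N} \<and> ?lat k \<le> \<kappa> * l. y k)" using alt[of "\<kappa> * l"] k(1) l0 by simp
    also have "\<dots> \<le> (\<Sum>k\<in>{1..<i}. y k)"
    proof (intro sum_mono2)
      show "{k \<in> {1..N}. ?lat k \<le> \<kappa> * l} \<subseteq> {1..<i}"
      proof clarify
        fix k assume k: "k \<in> {1..N}" "?lat k \<le> \<kappa> * l"
        then have "max l (a k) < max l (a i)" using lat[OF k(1)] kl by linarith
        then have "a k < a i" by auto
        then show "k \<in> {1..<i}" using ff_latency_less_iff[OF valid k(1) i] k by simp
      qed
    qed (use fr(2) i in auto)
    finally show "\<phi> (max l (a i) / l) * ybar \<le> (\<Sum>k\<in>{1..<i}. y k)" .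
  qed (use f in \<open>simp_all add: feasible_routings_def\<close>)
qed

text \<open>
  A road with \<open>a i = l\<close> counts as free-flow, which agrees with the convention at maximum flow.
\<close>

definition state_at :: "real \<Rightarrow> nat \<Rightarrow> nat" where
  "state_at l = (\<lambda>i\<in>{1..N}. if a i < l then 1 else 0)"

lemma saturated_latency:
  assumes s: "saturated l x y" and l: "a 1 \<le> l" and i: "i \<in> {1..N}"
  shows "latency net i (x i) (y i) (state_at l i) = max l (a i)"
    and "x i + y i \<le> z_max net i (x i) (y i)"
    and "x i + y i = 0 \<or> x i + y i = z_max net i (x i) (y i) \<Longrightarrow> state_at l i = 0"
proof -
  have xy: "0 \<le> x i" "0 \<le> y i"
    and up: "load net i (max l (a i)) (x i) (y i) \<le> road_cap net i"
    and lo: "a i < l \<Longrightarrow> road_cap net i \<le> load net i l (x i) (y i)"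
    using s i by (auto simp: saturated_routing_def relaxed_routing_def)
  note d = valid_networkD[OF valid i]
  have c: "0 < road_cap net i" using d by (simp add: road_cap_def)
  have z: "x i + y i = 0 \<or> 0 < x i + y i" using xy by linarith
  have cong: "0 < x i + y i \<and> load net i l (x i) (y i) = road_cap net i
      \<and> load net i (a i) (x i) (y i) < road_cap net i" if al: "a i < l"
  proof -
    have e: "load net i l (x i) (y i) = road_cap net i" using up lo[OF al] al by simp
    then have "load net i l (x i) (y i) > 0" using c by simp
    then have "x i \<noteq> 0 \<or> y i \<noteq> 0" by (auto simp: load_def)
    then have p: "0 < x i + y i" using xy by linarith
    then have "0 < (l - a i) * (x i + y i)" using al by simp
    then show ?thesis using p e load_shift[of net i l "x i" "y i" "a i"] by linarith
  qed
  show "latency net i (x i) (y i) (state_at l i) = max l (a i)"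
  proof (cases "a i < l")
    case True
    then show ?thesis
      using cong latency_congested_iff[OF valid i xy] i by (simp add: state_at_def)
  next
    case False
    then show ?thesis using i by (simp add: state_at_def latency_free)
  qed
  show "x i + y i \<le> z_max net i (x i) (y i)"
  proof (cases "x i + y i = 0")
    case True
    then have "x i = 0" "y i = 0" using xy by linarith+
    then show ?thesis using d by (simp add: z_max_def rho_crit_def)
  next
    case False
    then have p: "0 < x i + y i" using xy by simp
    have "load net i (a i) (x i) (y i) \<le> road_cap net i"
      using up load_mono[of "a i" "max l (a i)" "x i" "y i" net i] xy by simp
    then show ?thesis using congested_road(2,3)[OF valid i xy p] by (auto simp: le_less)
  qed
  show "state_at l i = 0" if "x i + y i = 0 \<or> x i + y i = z_max net i (x i) (y i)"
  proof (cases "a i < l")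
    case True
    then show ?thesis using cong that congested_road(3)[OF valid i xy] by auto
  qed (use i in \<open>simp add: state_at_def\<close>)
qed

text \<open>
  Roads are ordered by \<open>max l (a i)\<close> as well, so the constraints at the finitely many indices imply
  the altruism condition for every latency \<open>t\<close>: it suffices to use the first road slower than \<open>t\<close>.
\<close>

lemma saturated_ANE:
  assumes s: "saturated l x y" and l: "a 1 \<le> l"
  shows "(restrict x {1..N}, restrict y {1..N}, state_at l) \<in> ANE net xbar ybar l \<phi>"
    and "total_latency net (restrict x {1..N}, restrict y {1..N}, state_at l) = cost l x y"
proof -
  note sl = saturated_latency[OF s l]
  have l0: "0 < l" using l a_pos[OF one_road] by linarith
  have R: "\<And>i. i \<in> {1..N} \<Longrightarrow> 0 \<le> x i \<and> 0 \<le> y i \<and> (l < a i \<longrightarrow> x i \<le> 0)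
        \<and> \<phi> (max l (a i) / l) * ybar \<le> (\<Sum>k\<in>{1..<i}. y k)"
     "(\<Sum>i\<in>{1..N}. x i) = xbar" "(\<Sum>i\<in>{1..N}. y i) = ybar"
    using s by (auto simp: saturated_routing_def relaxed_routing_def)
  show "total_latency net (restrict x {1..N}, restrict y {1..N}, state_at l) = cost l x y"
    unfolding total_latency_def level_cost_def prod.case
    by (intro sum.cong) (use sl(1) in \<open>auto simp: mult.commute\<close>)
  have alt: "\<phi> (t / l) * ybar \<le> (\<Sum>i | i \<in> {1..N} \<and> max l (a i) \<le> t. y i)" if t: "0 \<le> t" for t
  proof (cases "\<exists>i. i \<in> {1..N} \<and> t < max l (a i)")
    case False
    then have "{i. i \<in> {1..N} \<and> max l (a i) \<le> t} = {1..N}" by force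
    then show ?thesis using R(3) profile_range[OF profile, of "t / l"] t l0 ybar
      by (simp add: mult_left_le_one_le)
  next
    case True
    define i where "i = (LEAST i. i \<in> {1..N} \<and> t < max l (a i))"
    have i: "i \<in> {1..N}" "t < max l (a i)" using LeastI_ex[OF True] by (auto simp: i_def)
    have below: "max l (a k) \<le> t" if "k \<in> {1..<i}" for k
    proof -
      have "\<not> (k \<in> {1..N} \<and> t < max l (a k))" using not_less_Least[of k] that by (auto simp: i_def)
      then show ?thesis using that i(1) by auto
    qed
    have "\<phi> (t / l) * ybar \<le> \<phi> (max l (a i) / l) * ybar"
      using i(2) l0 t by (intro mult_right_mono profile_mono[OF profile] ybar) (simp_all add: divide_right_mono)
    also have "\<dots> \<le> (\<Sum>k\<in>{1..<i}. y k)" using R(1)[OF i(1)] by simp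
    also have "\<dots> \<le> (\<Sum>i | i \<in> {1..N} \<and> max l (a i) \<le> t. y i)"
      using below i(1) R(1) by (intro sum_mono2) auto
    finally show ?thesis .
  qed
  have sum_eq: "(\<Sum>i | i \<in> {1..N} \<and> latency net i (restrict x {1..N} i) (restrict y {1..N} i) (state_at l i) \<le> t.
        restrict y {1..N} i) = (\<Sum>i | i \<in> {1..N} \<and> max l (a i) \<le> t. y i)" for t
    using sl(1) by (intro sum.cong) auto
  show "(restrict x {1..N}, restrict y {1..N}, state_at l) \<in> ANE net xbar ybar l \<phi>"
    unfolding ANE_def mem_Collect_eq prod.case sum_eq
  proof (intro conjI ballI impI allI l0)
    show "(restrict x {1..N}, restrict y {1..N}, state_at l) \<in> feasible_routings net xbar ybar"
      using R sl(2,3) by (auto simp: feasible_routings_def state_at_def)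
    fix i assume i: "i \<in> {1..N}"
    show "latency net i (restrict x {1..N} i) (restrict y {1..N} i) (state_at l i) = l"
      if "0 < restrict x {1..N} i"
      using sl(1)[OF i] R(1)[OF i] that i by fastforce
    show "l \<le> latency net i (restrict x {1..N} i) (restrict y {1..N} i) (state_at l i)"
      using sl(1)[OF i] i by simp
  qed (rule alt)
qed

section \<open>Reduction to finitely many equilibrium latencies\<close>

text \<open>
  The factor 1 contributes the free-flow latencies themselves: they are the points where the set of
  roads open to human drivers changes.
\<close>

definition candidates :: "real set" where
  "candidates = (\<lambda>(i, q). a i / q) ` ({1..N} \<times> insert 1 (set ks))"

lemma finite_candidates: "finite candidates"
  by (simp add: candidates_def)

lemma cost_mono:
  assumes "relaxed l x y" "l' \<le> l"
  shows "cost l' x y \<le> cost l x y"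
  unfolding level_cost_def using assms
  by (intro sum_mono mult_right_mono) (auto simp: relaxed_routing_def)

lemma lower_to_candidate:
  assumes r: "relaxed l x y" and l: "a 1 \<le> l"
  obtains l' where "l' \<in> candidates" "a 1 \<le> l'" "l' \<le> l" "relaxed l' x y"
proof -
  define l' where "l' = Max {c \<in> candidates. c \<le> l}"
  have fin: "finite {c \<in> candidates. c \<le> l}" using finite_candidates by simp
  have ac: "a i \<in> candidates" if "i \<in> {1..N}" for i
    using that by (auto simp: candidates_def intro!: image_eqI[of _ _ "(i, 1)"])
  have mem: "l' \<in> {c \<in> candidates. c \<le> l}"
    unfolding l'_def using fin ac[OF one_road] l by (intro Max_in) auto
  have max: "c \<le> l'" if "c \<in> candidates" "c \<le> l" for c
    unfolding l'_def using fin that by simp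
  have l'1: "a 1 \<le> l'" using max ac one_road l by blast
  have l'0: "0 < l'" using l'1 a_pos[OF one_road] by linarith
  have R: "\<And>i. i \<in> {1..N} \<Longrightarrow> 0 \<le> x i \<and> 0 \<le> y i \<and> (l < a i \<longrightarrow> x i \<le> 0)
        \<and> load net i (max l (a i)) (x i) (y i) \<le> road_cap net i
        \<and> \<phi> (max l (a i) / l) * ybar \<le> (\<Sum>k\<in>{1..<i}. y k)"
     "(\<Sum>i\<in>{1..N}. x i) = xbar" "(\<Sum>i\<in>{1..N}. y i) = ybar"
    using r by (auto simp: relaxed_routing_def)
  have cmp: "l' < a i \<longleftrightarrow> l < a i" if "i \<in> {1..N}" for i
    using max[OF ac[OF that]] mem by force
  have phi: "\<phi> (max l' (a i) / l') = \<phi> (max l (a i) / l)" if i: "i \<in> {1..N}" for i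
  proof (cases "l < a i")
    case True
    have "\<phi> (a i / l) = \<phi> (a i / l')"
    proof (rule ccontr)
      assume "\<phi> (a i / l) \<noteq> \<phi> (a i / l')"
      then obtain q where q: "q \<in> set ks" "a i / l \<le> q" "q < a i / l'"
        using profile_jump[OF profile, of "a i / l" "a i / l'"] a_pos[OF i] l'0 mem
        by (smt (verit, best) divide_left_mono divide_nonneg_pos mem_Collect_eq mult_pos_pos)
      have q0: "0 < q" using q(2) a_pos[OF i] l'0 mem by (smt (verit) divide_pos_pos mem_Collect_eq)
      have "a i / q \<le> l" using q(2) q0 l'0 mem by (simp add: field_simps)
      moreover have "l' < a i / q" using q(3) q0 l'0 by (simp add: field_simps)
      moreover have "a i / q \<in> candidates" using i q(1) by (auto simp: candidates_def intro!: image_eqI[of _ _ "(i, q)"])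
      ultimately show False using max by force
    qed
    then show ?thesis using True cmp[OF i] by (simp add: max_def)
  next
    case False
    then show ?thesis using cmp[OF i] l'0 mem by (cases "a i = l") (auto simp: max_def)
  qed
  have "relaxed l' x y"
    unfolding relaxed_routing_def
  proof (intro conjI ballI impI)
    fix i assume i: "i \<in> {1..N}"
    show "load net i (max l' (a i)) (x i) (y i) \<le> road_cap net i"
    proof -
      have "max l' (a i) \<le> max l (a i)" using mem by auto
      then show ?thesis using load_mono[of "max l' (a i)" "max l (a i)" "x i" "y i" net i] R(1)[OF i] by linarith
    qed
  qed (use R cmp phi in auto)
  then show ?thesis using that mem l'1 by blast
qed

text \<open>
  Moves \<open>\<epsilon>\<close> units of flow from road \<open>k\<close> to road \<open>i\<close>.
\<close>

definition shift_flow :: "nat \<Rightarrow> nat \<Rightarrow> real \<Rightarrow> (nat \<Rightarrow> real) \<Rightarrow> nat \<Rightarrow> real" where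
  "shift_flow k i \<epsilon> u = (\<lambda>j. u j + (if j = i then \<epsilon> else 0) - (if j = k then \<epsilon> else 0))"

lemma sum_shift_flow:
  assumes "finite S"
  shows "(\<Sum>j\<in>S. g j * shift_flow k i \<epsilon> u j)
    = (\<Sum>j\<in>S. g j * u j) + \<epsilon> * ((if i \<in> S then g i else 0) - (if k \<in> S then g k else 0))"
proof -
  have "g j * shift_flow k i \<epsilon> u j = g j * u j + (if j = i then \<epsilon> * g i else 0) - (if j = k then \<epsilon> * g k else 0)" for j
    by (simp add: shift_flow_def algebra_simps)
  then have "(\<Sum>j\<in>S. g j * shift_flow k i \<epsilon> u j)
      = (\<Sum>j\<in>S. g j * u j + (if j = i then \<epsilon> * g i else 0) - (if j = k then \<epsilon> * g k else 0))"
    by (simp only:)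
  also have "\<dots> = (\<Sum>j\<in>S. g j * u j) + \<epsilon> * ((if i \<in> S then g i else 0) - (if k \<in> S then g k else 0))"
    using assms by (simp add: sum.distrib sum_subtractf algebra_simps)
  finally show ?thesis .
qed

lemmas sum_shift_flow_plain = sum_shift_flow[where g = "\<lambda>_. 1", simplified]

text \<open>
  The potential that decreases when flow moves to a shorter road. The cost alone does not serve: at
  \<open>a k = l\<close> such a move leaves it unchanged.
\<close>

definition high_flow :: "real \<Rightarrow> (nat \<Rightarrow> real) \<Rightarrow> (nat \<Rightarrow> real) \<Rightarrow> real" where
  "high_flow l x y = (\<Sum>i\<in>{1..N}. (if l \<le> a i then 1 else 0) * x i) + (\<Sum>i\<in>{1..N}. (if l \<le> a i then 1 else 0) * y i)"

lemma cost_split: "cost l x y = (\<Sum>i\<in>{1..N}. max l (a i) * x i) + (\<Sum>i\<in>{1..N}. max l (a i) * y i)"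
  by (simp add: level_cost_def distrib_left sum.distrib)

text \<open>
  Road \<open>i\<close> has room left and precedes \<open>k\<close>. Human-driven flow can be moved as well, since it is
  present on \<open>k\<close> only if \<open>a k = l\<close>.
\<close>

lemma improve_unsaturated:
  assumes r: "relaxed l x y" and l: "0 < l" and i: "i \<in> {1..N}" "a i < l" "load net i l (x i) (y i) < road_cap net i"
    and k: "k \<in> {1..N}" "l \<le> a k" "0 < x k \<or> 0 < y k"
  obtains x' y' where "relaxed l x' y'" "cost l x' y' \<le> cost l x y" "high_flow l x' y' < high_flow l x y"
proof -
  have R: "\<And>i. i \<in> {1..N} \<Longrightarrow> 0 \<le> x i \<and> 0 \<le> y i \<and> (l < a i \<longrightarrow> x i \<le> 0)
        \<and> load net i (max l (a i)) (x i) (y i) \<le> road_cap net i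
        \<and> \<phi> (max l (a i) / l) * ybar \<le> (\<Sum>k\<in>{1..<i}. y k)"
     "(\<Sum>i\<in>{1..N}. x i) = xbar" "(\<Sum>i\<in>{1..N}. y i) = ybar"
    using r by (auto simp: relaxed_routing_def)
  have ik: "i < k" "i \<noteq> k" using ff_latency_less_iff[OF valid i(1) k(1)] i k by auto
  note cp = coef_pos[OF valid]
  have ci: "0 < hum_coef net i l" "0 < aut_coef net i l" using cp[OF i(1), of l] l by auto
  have ck: "0 < hum_coef net k (a k)" "0 < aut_coef net k (a k)"
    using cp[OF k(1), of "a k"] k l by auto
  define slack where "slack = road_cap net i - load net i l (x i) (y i)"
  have slack: "0 < slack" using i by (simp add: slack_def)
  have prefix: "(\<Sum>j\<in>{1..<m}. u j) \<le> (\<Sum>j\<in>{1..<m}. shift_flow k i \<epsilon> u j)" if "0 \<le> \<epsilon>" for m \<epsilon> u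
    using sum_shift_flow_plain[of "{1..<m}" k i \<epsilon> u] ik i(1) that by auto
  have mx: "max l (a i) = l" "max l (a k) = a k" using i k by auto
  from k(3) show ?thesis
  proof
    assume yk: "0 < y k"
    \<comment> \<open>the most that neither empties \<open>k\<close> nor overfills \<open>i\<close>\<close>
    define \<epsilon> where "\<epsilon> = min (y k) (slack / aut_coef net i l)"
    have e: "0 < \<epsilon>" "\<epsilon> \<le> y k" "\<epsilon> * aut_coef net i l \<le> slack"
      using yk slack ci by (auto simp: \<epsilon>_def min_def field_simps)
    let ?y = "shift_flow k i \<epsilon> y"
    have lk: "load net k (a k) (x k) (?y k) \<le> road_cap net k"
    proof -
      have "load net k (a k) (x k) (?y k) = load net k (a k) (x k) (y k) - aut_coef net k (a k) * \<epsilon>"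
        using ik by (simp add: load_def shift_flow_def algebra_simps)
      moreover have "load net k (a k) (x k) (y k) \<le> road_cap net k" using R(1)[OF k(1)] mx by simp
      ultimately show ?thesis using ck e(1) by (smt (verit) mult_pos_pos)
    qed
    have li: "load net i l (x i) (?y i) \<le> road_cap net i"
      using e(3) ik by (simp add: load_def shift_flow_def slack_def algebra_simps)
    have "relaxed l x ?y"
      unfolding relaxed_routing_def
    proof (intro conjI ballI impI)
      fix j assume j: "j \<in> {1..N}"
      show "0 \<le> ?y j" using R(1)[OF j] e ik by (auto simp: shift_flow_def)
      show "load net j (max l (a j)) (x j) (?y j) \<le> road_cap net j"
        using R(1)[OF j] lk li mx by (cases "j = i \<or> j = k") (auto simp: shift_flow_def)
      show "\<phi> (max l (a j) / l) * ybar \<le> (\<Sum>k\<in>{1..<j}. ?y k)"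
        using R(1)[OF j] prefix[where \<epsilon> = \<epsilon> and m = j and u = y] e by linarith
    qed (use R i k in \<open>auto simp: sum_shift_flow_plain\<close>)
    moreover have "cost l x ?y \<le> cost l x y"
      unfolding cost_split sum_shift_flow[OF finite_atLeastAtMost]
      using i k e by (simp add: mult_le_0_iff)
    moreover have "high_flow l x ?y < high_flow l x y"
      unfolding high_flow_def sum_shift_flow[OF finite_atLeastAtMost]
      using i k e by simp
    ultimately show ?thesis using that by blast
  next
    assume xk: "0 < x k"
    have ak: "a k = l" using R(1)[OF k(1)] xk k(2) by force
    define \<epsilon> where "\<epsilon> = min (x k) (slack / hum_coef net i l)"
    have e: "0 < \<epsilon>" "\<epsilon> \<le> x k" "\<epsilon> * hum_coef net i l \<le> slack"
      using xk slack ci by (auto simp: \<epsilon>_def min_def field_simps)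
    let ?x = "shift_flow k i \<epsilon> x"
    have lk: "load net k (a k) (?x k) (y k) \<le> road_cap net k"
    proof -
      have "load net k (a k) (?x k) (y k) = load net k (a k) (x k) (y k) - hum_coef net k (a k) * \<epsilon>"
        using ik by (simp add: load_def shift_flow_def algebra_simps)
      moreover have "load net k (a k) (x k) (y k) \<le> road_cap net k" using R(1)[OF k(1)] mx by simp
      ultimately show ?thesis using ck e(1) by (smt (verit) mult_pos_pos)
    qed
    have li: "load net i l (?x i) (y i) \<le> road_cap net i"
      using e(3) ik by (simp add: load_def shift_flow_def slack_def algebra_simps)
    have "relaxed l ?x y"
      unfolding relaxed_routing_def
    proof (intro conjI ballI impI)
      fix j assume j: "j \<in> {1..N}"
      show "0 \<le> ?x j" using R(1)[OF j] e ik by (auto simp: shift_flow_def)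
      show "load net j (max l (a j)) (?x j) (y j) \<le> road_cap net j"
        using R(1)[OF j] lk li mx by (cases "j = i \<or> j = k") (auto simp: shift_flow_def)
      show "?x j \<le> 0" if "l < a j" using R(1)[OF j] that i k ak e by (auto simp: shift_flow_def)
    qed (use R i k in \<open>auto simp: sum_shift_flow_plain\<close>)
    moreover have "cost l ?x y \<le> cost l x y"
      unfolding cost_split sum_shift_flow[OF finite_atLeastAtMost]
      using i k e by (simp add: mult_le_0_iff)
    moreover have "high_flow l ?x y < high_flow l x y"
      unfolding high_flow_def sum_shift_flow[OF finite_atLeastAtMost]
      using i k e by simp
    ultimately show ?thesis using that by blast
  qed
qed

text \<open>
  Instead of moving flow step by step, take a routing of least \<open>high_flow\<close> among those that cost no
  more than the given one: there no move is possible.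
\<close>

lemma saturate_or_drain:
  assumes r: "relaxed l x y" and l: "0 < l"
  obtains x' y' where "relaxed l x' y'" "cost l x' y' \<le> cost l x y"
    "saturated l x' y' \<or> (\<forall>i\<in>{1..N}. l \<le> a i \<longrightarrow> x' i = 0 \<and> y' i = 0)"
proof -
  let ?V = "{p. relaxed l (fst p) (snd p) \<and> cost l (fst p) (snd p) \<le> cost l x y}"
  have b: "0 \<le> u i \<and> u i \<le> xbar + ybar \<and> 0 \<le> w i \<and> w i \<le> xbar + ybar"
    if "(u, w) \<in> ?V" "i \<in> {1..N}" for u w i
    using relaxed_bounds[of net xbar ybar \<phi> l u w i] that xbar ybar by simp
  obtain p where p: "p \<in> ?V" "\<And>q. q \<in> ?V \<Longrightarrow>
      high_flow l (fst p) (snd p) \<le> high_flow l (fst q) (snd q)"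
  proof (rule min_attained[of ?V "{1..N}" "xbar + ybar" "\<lambda>p. high_flow l (fst p) (snd p)"])
    show "closed ?V"
      unfolding level_cost_def
      by (intro closed_Collect_conj closed_relaxed closed_Collect_le continuous_intros)
    show "?V \<noteq> {}" using r by force
    show "continuous_on UNIV (\<lambda>p. high_flow l (fst p) (snd p))"
      unfolding high_flow_def by (intro continuous_intros)
    show "(x', y') \<in> ?V \<and> high_flow l (fst (x', y')) (snd (x', y')) = high_flow l (fst (x, y)) (snd (x, y))"
      if "(x, y) \<in> ?V" "\<And>i. i \<in> {1..N} \<Longrightarrow> x' i = x i \<and> y' i = y i" for x y x' y'
    proof -
      have "high_flow l x' y' = high_flow l x y"
        unfolding high_flow_def using that(2) by (intro arg_cong2[where f = "(+)"] sum.cong) auto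
      then show ?thesis
        using relaxed_cong[of net x' x y' y xbar ybar \<phi> l, OF that(2)]
          level_cost_cong[of net x' x y' y l, OF that(2)] that(1) by simp
    qed
  qed (use b xbar ybar in auto)
  obtain x' y' where p': "p = (x', y')" by (cases p)
  have r': "relaxed l x' y'" "cost l x' y' \<le> cost l x y" using p(1) p' by auto
  have "saturated l x' y'" if k: "k \<in> {1..N}" "l \<le> a k" "x' k \<noteq> 0 \<or> y' k \<noteq> 0" for k
  proof (rule ccontr)
    assume "\<not> saturated l x' y'"
    then obtain i where i: "i \<in> {1..N}" "a i < l" "load net i l (x' i) (y' i) < road_cap net i"
      using r' by (auto simp: saturated_routing_def not_le)
    have k0: "0 < x' k \<or> 0 < y' k" using r'(1) k by (force simp: relaxed_routing_def)
    then obtain x'' y'' where "relaxed l x'' y''" "cost l x'' y'' \<le> cost l x' y'"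
        "high_flow l x'' y'' < high_flow l x' y'"
      using improve_unsaturated[OF r'(1) l i k(1,2) k0] by blast
    then show False using p(2)[of "(x'', y'')"] r'(2) p' by simp
  qed
  then show ?thesis using that r' by blast
qed

lemma relaxed_to_saturated:
  assumes "relaxed l x y" "a 1 \<le> l"
  shows "\<exists>l' x' y'. l' \<in> candidates \<and> a 1 \<le> l' \<and> saturated l' x' y' \<and> cost l' x' y' \<le> cost l x y"
  using assms
proof (induction "card {i \<in> {1..N}. a i < l}" arbitrary: l x y rule: less_induct)
  case less
  obtain l1 where l1: "l1 \<in> candidates" "a 1 \<le> l1" "l1 \<le> l" "relaxed l1 x y"
    using lower_to_candidate less.prems by blast
  have l10: "0 < l1" using l1 a_pos[OF one_road] by linarith
  obtain x1 y1 where r1: "relaxed l1 x1 y1" "cost l1 x1 y1 \<le> cost l1 x y"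
    and dich: "saturated l1 x1 y1 \<or> (\<forall>i\<in>{1..N}. l1 \<le> a i \<longrightarrow> x1 i = 0 \<and> y1 i = 0)"
    using saturate_or_drain[OF l1(4) l10] by blast
  have c1: "cost l1 x1 y1 \<le> cost l x y" using r1(2) cost_mono[OF less.prems(1) l1(3)] by linarith
  show ?case
  proof (cases "saturated l1 x1 y1")
    case True
    then show ?thesis using l1 c1 by blast
  next
    case False
    then have zero: "\<And>i. i \<in> {1..N} \<Longrightarrow> l1 \<le> a i \<Longrightarrow> x1 i = 0 \<and> y1 i = 0"
      and ex: "\<exists>i\<in>{1..N}. a i < l1"
      using dich r1(1) by (auto simp: saturated_routing_def)
    define B where "B = {i \<in> {1..N}. a i < l1}"
    \<comment> \<open>all flow is on \<open>B\<close>, where \<open>l2\<close> is the largest free-flow latency\<close>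
    define l2 where "l2 = Max (a ` B)"
    have B: "finite B" "B \<noteq> {}" using ex by (auto simp: B_def)
    have l2B: "l2 \<in> a ` B" and l2max: "\<And>i. i \<in> B \<Longrightarrow> a i \<le> l2"
      using B by (auto simp: l2_def)
    obtain m where m: "m \<in> {1..N}" "l2 = a m" "a m < l1" using l2B by (auto simp: B_def)
    have l2: "a 1 \<le> l2" "l2 < l1" "0 < l2" using m a_first[of m] a_pos[of m] by auto
    have R: "\<And>i. i \<in> {1..N} \<Longrightarrow> 0 \<le> x1 i \<and> 0 \<le> y1 i
        \<and> load net i (max l1 (a i)) (x1 i) (y1 i) \<le> road_cap net i
        \<and> \<phi> (max l1 (a i) / l1) * ybar \<le> (\<Sum>k\<in>{1..<i}. y1 k)"
     "(\<Sum>i\<in>{1..N}. x1 i) = xbar" "(\<Sum>i\<in>{1..N}. y1 i) = ybar"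
      using r1 by (auto simp: relaxed_routing_def)
    \<comment> \<open>at latency \<open>l2\<close> the altruism constraint of a road outside \<open>B\<close> asks for at most the whole demand\<close>
    have "relaxed l2 x1 y1"
      unfolding relaxed_routing_def
    proof (intro conjI ballI impI)
      fix i assume i: "i \<in> {1..N}"
      show "load net i (max l2 (a i)) (x1 i) (y1 i) \<le> road_cap net i"
      proof -
        have "max l2 (a i) \<le> max l1 (a i)" using l2 by auto
        then show ?thesis using load_mono[of "max l2 (a i)" "max l1 (a i)" "x1 i" "y1 i" net i] R(1)[OF i] by linarith
      qed
      show "x1 i \<le> 0" if "l2 < a i" using zero[OF i] l2max[of i] that i by (force simp: B_def)
      show "\<phi> (max l2 (a i) / l2) * ybar \<le> (\<Sum>k\<in>{1..<i}. y1 k)"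
      proof (cases "a i < l1")
        case True
        then have "a i \<le> l2" using l2max[of i] i by (simp add: B_def)
        then show ?thesis using R(1)[OF i] True l2 l10 by (simp add: max_def)
      next
        case False
        have "(\<Sum>k\<in>{1..<i}. y1 k) = (\<Sum>i\<in>{1..N}. y1 i)"
        proof (intro sum.mono_neutral_left ballI)
          fix k assume k: "k \<in> {1..N} - {1..<i}"
          then have "a i \<le> a k" using ff_latency_le_iff[OF valid i, of k] by auto
          then show "y1 k = 0" using zero[of k] k False by auto
        qed (use i in auto)
        then show ?thesis
          using R(3) profile_range[OF profile, of "max l2 (a i) / l2"] l2 ybar
          by (simp add: mult_left_le_one_le)
      qed
    qed (use R in auto)
    moreover have "card {i \<in> {1..N}. a i < l2} < card {i \<in> {1..N}. a i < l}"
    proof (rule psubset_card_mono)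
      have "m \<notin> {i \<in> {1..N}. a i < l2}" "m \<in> {i \<in> {1..N}. a i < l}" using m l1 by auto
      then show "{i \<in> {1..N}. a i < l2} \<subset> {i \<in> {1..N}. a i < l}" using l2 l1 by force
    qed simp
    moreover have "cost l2 x1 y1 \<le> cost l1 x1 y1" using cost_mono[OF r1(1)] l2 by simp
    ultimately show ?thesis using less.hyps[of l2 x1 y1] l2(1) c1 by force
  qed
qed

section \<open>Equivalence with best-case equilibria\<close>

text \<open>
  For \<open>l < a 1\<close> no road has latency \<open>l\<close>, so there is no human-driven flow; a larger equilibrium
  latency only weakens the altruism condition.
\<close>

lemma ANE_lift:
  assumes r: "r \<in> ANE net xbar ybar l \<phi>"
  obtains l' where "a 1 \<le> l'" "r \<in> ANE net xbar ybar l' \<phi>"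
proof (cases "a 1 \<le> l")
  case True
  then show ?thesis using that r by blast
next
  case False
  obtain x y s where r': "r = (x, y, s)" by (cases r)
  let ?lat = "\<lambda>i. latency net i (x i) (y i) (s i)"
  have f: "(x, y, s) \<in> feasible_routings net xbar ybar"
    and l0: "0 < l" and hum: "\<And>i. i \<in> {1..N} \<Longrightarrow> 0 < x i \<Longrightarrow> ?lat i = l"
    and alt: "\<And>t. 0 \<le> t \<Longrightarrow> \<phi> (t / l) * ybar \<le> (\<Sum>i | i \<in> {1..N} \<and> ?lat i \<le> t. y i)"
    using r by (auto simp: ANE_def r')
  have lat: "a 1 \<le> ?lat i" if "i \<in> {1..N}" for i
    using feasible_road(3)[OF valid f that] a_first[OF that] by linarith
  have "r \<in> ANE net xbar ybar (a 1) \<phi>"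
    unfolding ANE_def mem_Collect_eq prod.case r'
  proof (intro conjI ballI impI allI f a_pos one_road lat)
    show "?lat i = a 1" if "i \<in> {1..N}" "0 < x i" for i
      using hum[OF that] lat[OF that(1)] False by simp
    show "\<phi> (t / a 1) * ybar \<le> (\<Sum>i | i \<in> {1..N} \<and> ?lat i \<le> t. y i)" if "0 \<le> t" for t
    proof -
      have "t / a 1 \<le> t / l" using False l0 that by (intro divide_left_mono) auto
      then have "\<phi> (t / a 1) * ybar \<le> \<phi> (t / l) * ybar"
        using that a_pos[OF one_road] by (intro mult_right_mono profile_mono[OF profile] ybar) auto
      then show ?thesis using alt[OF that] by linarith
    qed
  qed
  then show ?thesis using that by blast
qed

lemma road_interval:
  assumes l: "a 1 \<le> l"
  obtains m where "m \<in> {1..N}" "ereal l \<in> {ff_latency_ext net m ..< ff_latency_ext net (Suc m)}"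
proof -
  define B where "B = {i \<in> {1..N}. a i \<le> l}"
  have B: "finite B" "B \<noteq> {}" using one_road l by (auto simp: B_def)
  define m where "m = Max B"
  have m: "m \<in> B" "\<And>i. i \<in> B \<Longrightarrow> i \<le> m" using B by (auto simp: m_def)
  have mN: "m \<in> {1..N}" "a m \<le> l" using m by (auto simp: B_def)
  have "l < a (Suc m)" if "Suc m \<le> N"
    using m(2)[of "Suc m"] that by (auto simp: B_def not_le[symmetric])
  then show ?thesis using that[of m] mN by (simp add: ff_latency_ext_def)
qed

lemma feasible_opt_iff:
  "(\<exists>m l0. m \<in> {1..N} \<and> ereal l0 \<in> {ff_latency_ext net m ..< ff_latency_ext net (Suc m)}
      \<and> r \<in> ANE net xbar ybar l0 \<phi>) \<longleftrightarrow> (\<exists>l0. r \<in> ANE net xbar ybar l0 \<phi>)"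
  using ANE_lift road_interval by metis

lemma opt_solutions_BANE:
  "(\<lambda>(m, l0, r). r) ` opt_solutions net xbar ybar \<phi> = BANE net xbar ybar \<phi>"
proof -
  let ?ok = "\<lambda>m l0 r. m \<in> {1..N} \<and> ereal l0 \<in> {ff_latency_ext net m ..< ff_latency_ext net (Suc m)}
      \<and> r \<in> ANE net xbar ybar l0 \<phi>"
  have opt: "(m, l0, r) \<in> opt_solutions net xbar ybar \<phi> \<longleftrightarrow>
      ?ok m l0 r \<and> (\<forall>m' l0' r'. ?ok m' l0' r' \<longrightarrow> \<not> total_latency net r' < total_latency net r)" for m l0 r
    by (auto simp: opt_solutions_def is_arg_min_def)
  have ban: "r \<in> BANE net xbar ybar \<phi> \<longleftrightarrow> (\<exists>l0. r \<in> ANE net xbar ybar l0 \<phi>) \<and>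
      (\<forall>r'. (\<exists>l0. r' \<in> ANE net xbar ybar l0 \<phi>) \<longrightarrow> \<not> total_latency net r' < total_latency net r)" for r
    by (auto simp: BANE_def is_arg_min_def)
  have "r \<in> (\<lambda>(m, l0, r). r) ` opt_solutions net xbar ybar \<phi> \<longleftrightarrow> r \<in> BANE net xbar ybar \<phi>" for r
  proof -
    have "r \<in> (\<lambda>(m, l0, r). r) ` opt_solutions net xbar ybar \<phi> \<longleftrightarrow>
        (\<exists>m l0. (m, l0, r) \<in> opt_solutions net xbar ybar \<phi>)" by force
    then show ?thesis unfolding opt ban feasible_opt_iff[symmetric] by blast
  qed
  then show ?thesis by blast
qed

end

section \<open>The linear program of a candidate latency\<close>

text \<open>
  Column 0 is a bound on the cost (which makes the optimal value available as a coordinate of the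
  solution), columns \<open>k\<close> and \<open>n + k\<close> are the human-driven and autonomous flow of road \<open>k\<close>. With
  \<open>k\<close> ranging over the roads, the rows are as follows:
  \<^item> row 0: the cost is at most variable 0;
  \<^item> rows \<open>k\<close> and \<open>n + k\<close>: flows are nonnegative;
  \<^item> row \<open>2n + k\<close>: capacity;
  \<^item> row \<open>3n + k\<close>: saturation if \<open>a k < l\<close>, no human drivers if \<open>l < a k\<close>, void if \<open>a k = l\<close>;
  \<^item> row \<open>4n + k\<close>: altruism;
  \<^item> the last four rows: both demands, each as two inequalities.

  Multiples of \<open>n\<close> are written as sums because programs can only add indices.
\<close>

definition lp_A :: "network \<Rightarrow> real \<Rightarrow> nat \<Rightarrow> nat \<Rightarrow> real" where
  "lp_A net l r c = (let n = roads net; a = ff_latency net in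
     if r = 0 then (if c = 0 then - 1 else if c \<le> n then max l (a c) else max l (a (c - n)))
     else if r \<le> n + n then (if c = r then - 1 else 0)
     else if r \<le> n + n + n then
       (let k = r - (n + n) in
        if c = k then hum_coef net k (max l (a k))
        else if c = n + k then aut_coef net k (max l (a k)) else 0)
     else if r \<le> n + n + n + n then
       (let k = r - (n + n + n) in
        if a k < l then (if c = k then - hum_coef net k l else if c = n + k then - aut_coef net k l else 0)
        else if l < a k then (if c = k then 1 else 0) else 0)
     else if r \<le> n + n + n + n + n then
       (if n < c \<and> c < n + (r - (n + n + n + n)) then - 1 else 0)
     else if r = n + n + n + n + n + 1 then (if 0 < c \<and> c \<le> n then 1 else 0)
     else if r = n + n + n + n + n + 2 then (if 0 < c \<and> c \<le> n then - 1 else 0)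
     else if r = n + n + n + n + n + 3 then (if n < c then 1 else 0)
     else (if n < c then - 1 else 0))"

definition lp_b :: "network \<Rightarrow> real \<Rightarrow> real \<Rightarrow> (real \<Rightarrow> real) \<Rightarrow> real \<Rightarrow> nat \<Rightarrow> real" where
  "lp_b net xbar ybar \<phi> l r = (let n = roads net; a = ff_latency net in
     if r \<le> n + n then 0
     else if r \<le> n + n + n then road_cap net (r - (n + n))
     else if r \<le> n + n + n + n then
       (let k = r - (n + n + n) in if a k < l then - road_cap net k else 0)
     else if r \<le> n + n + n + n + n then
       (let k = r - (n + n + n + n) in - (\<phi> (max l (a k) / l) * ybar))
     else if r = n + n + n + n + n + 1 then xbar
     else if r = n + n + n + n + n + 2 then - xbar
     else if r = n + n + n + n + n + 3 then ybar
     else - ybar)"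

definition lp_c :: "nat \<Rightarrow> real" where "lp_c c = (if c = 0 then 1 else 0)"

lemma sum_columns:
  fixes f :: "nat \<Rightarrow> real"
  shows "(\<Sum>c<n + n + 1. f c) = f 0 + (\<Sum>k\<in>{1..n}. f k) + (\<Sum>k\<in>{1..n}. f (n + k))"
proof -
  have "{..<n + n + 1} = insert 0 ({1..n} \<union> (+) n ` {1..n})"
    by (auto simp: image_iff Bex_def)
  also have "(\<Sum>c\<in>\<dots>. f c) = f 0 + (\<Sum>c\<in>{1..n} \<union> (+) n ` {1..n}. f c)"
    by (rule sum.insert) auto
  also have "(\<Sum>c\<in>{1..n} \<union> (+) n ` {1..n}. f c) = (\<Sum>k\<in>{1..n}. f k) + (\<Sum>k\<in>(+) n ` {1..n}. f k)"
    by (rule sum.union_disjoint) auto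
  also have "(\<Sum>k\<in>(+) n ` {1..n}. f k) = (\<Sum>k\<in>{1..n}. f (n + k))"
    by (subst sum.reindex) auto
  finally show ?thesis by simp
qed

lemma all_rows:
  fixes n :: nat
  shows "(\<forall>r<n + n + n + n + n + 5. P r) \<longleftrightarrow>
     P 0 \<and> (\<forall>k\<in>{1..n}. P k \<and> P (n + k) \<and> P (n + n + k) \<and> P (n + n + n + k) \<and> P (n + n + n + n + k)) \<and>
     P (n + n + n + n + n + 1) \<and> P (n + n + n + n + n + 2) \<and> P (n + n + n + n + n + 3)
     \<and> P (n + n + n + n + n + 4)" (is "?L \<longleftrightarrow> ?R")
proof
  assume ?R
  show ?L
  proof (intro allI impI)
    fix r assume r: "r < n + n + n + n + n + 5"
    have block: "P r" if "m < r" "r \<le> m + n" "\<forall>k\<in>{1..n}. P (m + k)" for m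
    proof -
      have "r - m \<in> {1..n}" using that by auto
      then have "P (m + (r - m))" using that(3) by blast
      then show ?thesis using that(1) by simp
    qed
    consider "r = 0" | "0 < r" "r \<le> n" | "n < r" "r \<le> n + n" | "n + n < r" "r \<le> n + n + n"
      | "n + n + n < r" "r \<le> n + n + n + n" | "n + n + n + n < r" "r \<le> n + n + n + n + n"
      | "n + n + n + n + n < r" by (metis not_le not_gr_zero)
    then show "P r"
    proof cases
      case 7
      then have "r = n + n + n + n + n + 1 \<or> r = n + n + n + n + n + 2
          \<or> r = n + n + n + n + n + 3 \<or> r = n + n + n + n + n + 4" using r by linarith
      then show ?thesis using \<open>?R\<close> by blast
    next
      case 2
      then have "r \<in> {1..n}" by simp
      then show ?thesis using \<open>?R\<close> by blast
    next
      case 3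
      then show ?thesis by (rule block) (use \<open>?R\<close> in blast)
    next
      case 4
      then show ?thesis by (rule block) (use \<open>?R\<close> in blast)
    next
      case 5
      then show ?thesis by (rule block) (use \<open>?R\<close> in blast)
    next
      case 6
      then show ?thesis by (rule block) (use \<open>?R\<close> in blast)
    qed (use \<open>?R\<close> in blast)
  qed
qed auto

lemma sum_two_columns:
  fixes z :: "nat \<Rightarrow> real"
  assumes "k \<in> {1..n}"
  shows "(\<Sum>c<n + n + 1. (if c = k then p else if c = n + k then q else 0) * z c) = p * z k + q * z (n + k)"
proof -
  have "(\<Sum>c<n + n + 1. (if c = k then p else if c = n + k then q else 0) * z c)
      = (\<Sum>c<n + n + 1. (if c = k then p * z k else 0) + (if c = n + k then q * z (n + k) else 0))"
    using assms by (intro sum.cong) auto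
  also have "\<dots> = p * z k + q * z (n + k)" using assms by (simp only: sum.distrib sum.delta finite_lessThan) auto
  finally show ?thesis .
qed

lemma sum_one_column:
  fixes z :: "nat \<Rightarrow> real"
  assumes "k < m"
  shows "(\<Sum>c<m. (if c = k then p else 0) * z c) = p * z k"
proof -
  have "(\<Sum>c<m. (if c = k then p else 0) * z c) = (\<Sum>c<m. if c = k then p * z k else 0)"
    by (intro sum.cong) auto
  then show ?thesis using assms by simp
qed

lemma lp_rows:
  fixes net z
  defines "n \<equiv> roads net" and "a \<equiv> ff_latency net"
  defines "row \<equiv> \<lambda>l r. \<Sum>c<n + n + 1. lp_A net l r c * z c"
  shows "row l 0 = level_cost net l z (\<lambda>k. z (n + k)) - z 0"
    and "k \<in> {1..n + n} \<Longrightarrow> row l k = - z k"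
    and "k \<in> {1..n} \<Longrightarrow> row l (n + n + k) = load net k (max l (a k)) (z k) (z (n + k))"
    and "k \<in> {1..n} \<Longrightarrow> row l (n + n + n + k) =
      (if a k < l then - load net k l (z k) (z (n + k)) else if l < a k then z k else 0)"
    and "k \<in> {1..n} \<Longrightarrow> row l (n + n + n + n + k) = - (\<Sum>j\<in>{1..<k}. z (n + j))"
    and "row l (n + n + n + n + n + 1) = (\<Sum>j\<in>{1..n}. z j)"
    and "row l (n + n + n + n + n + 2) = - (\<Sum>j\<in>{1..n}. z j)"
    and "row l (n + n + n + n + n + 3) = (\<Sum>j\<in>{1..n}. z (n + j))"
    and "row l (n + n + n + n + n + 4) = - (\<Sum>j\<in>{1..n}. z (n + j))"
proof -
  show "row l 0 = level_cost net l z (\<lambda>k. z (n + k)) - z 0"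
    unfolding row_def sum_columns
    by (simp add: lp_A_def n_def[symmetric] level_cost_def distrib_left sum.distrib)
  show "row l k = - z k" if k: "k \<in> {1..n + n}"
  proof -
    have "row l k = (\<Sum>c<n + n + 1. (if c = k then -1 else 0) * z c)"
      unfolding row_def using k by (intro sum.cong) (auto simp: lp_A_def n_def[symmetric])
    then show ?thesis using k by (subst (asm) sum_one_column) auto
  qed
  show "row l (n + n + k) = load net k (max l (a k)) (z k) (z (n + k))" if k: "k \<in> {1..n}"
  proof -
    have "row l (n + n + k) = (\<Sum>c<n + n + 1. (if c = k then hum_coef net k (max l (a k))
        else if c = n + k then aut_coef net k (max l (a k)) else 0) * z c)"
      unfolding row_def using k by (intro sum.cong) (auto simp: lp_A_def n_def[symmetric] a_def)
    then show ?thesis using sum_two_columns[OF k] by (simp add: load_def)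
  qed
  show "row l (n + n + n + k) =
      (if a k < l then - load net k l (z k) (z (n + k)) else if l < a k then z k else 0)" if k: "k \<in> {1..n}"
  proof -
    have "row l (n + n + n + k) = (\<Sum>c<n + n + 1. (if c = k then
          (if a k < l then - hum_coef net k l else if l < a k then 1 else 0)
        else if c = n + k then (if a k < l then - aut_coef net k l else 0) else 0) * z c)"
      unfolding row_def using k by (intro sum.cong) (auto simp: lp_A_def n_def[symmetric] a_def)
    then show ?thesis using sum_two_columns[OF k] by (simp add: load_def)
  qed
  show "row l (n + n + n + n + k) = - (\<Sum>j\<in>{1..<k}. z (n + j))" if k: "k \<in> {1..n}"
  proof -
    have "row l (n + n + n + n + k)
        = (\<Sum>j\<in>{1..n}. if j < k then - z (n + j) else 0)"
      unfolding row_def sum_columns using k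
      by (auto simp: lp_A_def n_def[symmetric] intro!: sum.cong sum.neutral)
    also have "\<dots> = (\<Sum>j\<in>{1..<k}. - z (n + j))"
      using k by (intro sum.mono_neutral_cong_right) auto
    finally show ?thesis by (simp add: sum_negf)
  qed
  show "row l (n + n + n + n + n + 1) = (\<Sum>j\<in>{1..n}. z j)"
    "row l (n + n + n + n + n + 2) = - (\<Sum>j\<in>{1..n}. z j)"
    "row l (n + n + n + n + n + 3) = (\<Sum>j\<in>{1..n}. z (n + j))"
    "row l (n + n + n + n + n + 4) = - (\<Sum>j\<in>{1..n}. z (n + j))"
    unfolding row_def sum_columns
    by (simp_all add: lp_A_def n_def[symmetric] sum_negf[symmetric])
qed

lemma lp_feasible_iff:
  fixes net z
  defines "n \<equiv> roads net"
  shows "(\<forall>r<n + n + n + n + n + 5. (\<Sum>c<n + n + 1. lp_A net l r c * z c) \<le> lp_b net xbar ybar \<phi> l r)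
    \<longleftrightarrow> saturated_routing net xbar ybar \<phi> l z (\<lambda>k. z (n + k)) \<and> level_cost net l z (\<lambda>k. z (n + k)) \<le> z 0"
proof -
  let ?a = "ff_latency net"
  note rows = lp_rows[where net = net and z = z and l = l, folded n_def]
  have r2: "\<And>k. k \<in> {1..n} \<Longrightarrow> (\<Sum>c<n + n + 1. lp_A net l k c * z c) = - z k"
    "\<And>k. k \<in> {1..n} \<Longrightarrow> (\<Sum>c<n + n + 1. lp_A net l (n + k) c * z c) = - z (n + k)"
    using rows(2) by auto
  have b: "lp_b net xbar ybar \<phi> l 0 = 0"
    "\<And>k. k \<in> {1..n} \<Longrightarrow> lp_b net xbar ybar \<phi> l k = 0"
    "\<And>k. k \<in> {1..n} \<Longrightarrow> lp_b net xbar ybar \<phi> l (n + k) = 0"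
    "\<And>k. k \<in> {1..n} \<Longrightarrow> lp_b net xbar ybar \<phi> l (n + n + k) = road_cap net k"
    "\<And>k. k \<in> {1..n} \<Longrightarrow> lp_b net xbar ybar \<phi> l (n + n + n + k) = (if ?a k < l then - road_cap net k else 0)"
    "\<And>k. k \<in> {1..n} \<Longrightarrow> lp_b net xbar ybar \<phi> l (n + n + n + n + k) = - (\<phi> (max l (?a k) / l) * ybar)"
    "lp_b net xbar ybar \<phi> l (n + n + n + n + n + 1) = xbar"
    "lp_b net xbar ybar \<phi> l (n + n + n + n + n + 2) = - xbar"
    "lp_b net xbar ybar \<phi> l (n + n + n + n + n + 3) = ybar"
    "lp_b net xbar ybar \<phi> l (n + n + n + n + n + 4) = - ybar"
    by (auto simp: lp_b_def n_def[symmetric])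
  have "(\<forall>r<n + n + n + n + n + 5. (\<Sum>c<n + n + 1. lp_A net l r c * z c) \<le> lp_b net xbar ybar \<phi> l r)
    \<longleftrightarrow> level_cost net l z (\<lambda>k. z (n + k)) - z 0 \<le> 0 \<and>
      (\<forall>k\<in>{1..n}. - z k \<le> 0 \<and> - z (n + k) \<le> 0 \<and>
         load net k (max l (?a k)) (z k) (z (n + k)) \<le> road_cap net k \<and>
         (if ?a k < l then - load net k l (z k) (z (n + k)) else if l < ?a k then z k else 0)
           \<le> (if ?a k < l then - road_cap net k else 0) \<and>
         - (\<Sum>j\<in>{1..<k}. z (n + j)) \<le> - (\<phi> (max l (?a k) / l) * ybar)) \<and>
      (\<Sum>j\<in>{1..n}. z j) \<le> xbar \<and> - (\<Sum>j\<in>{1..n}. z j) \<le> - xbar \<and>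
      (\<Sum>j\<in>{1..n}. z (n + j)) \<le> ybar \<and> - (\<Sum>j\<in>{1..n}. z (n + j)) \<le> - ybar"
    unfolding all_rows
    by (intro conj_cong ball_cong refl) (simp_all only: rows(1,3-) r2 b)
  also have "\<dots> \<longleftrightarrow> saturated_routing net xbar ybar \<phi> l z (\<lambda>k. z (n + k))
      \<and> level_cost net l z (\<lambda>k. z (n + k)) \<le> z 0"
  proof -
    have k: "(- z k \<le> 0 \<and> - z (n + k) \<le> 0 \<and>
         load net k (max l (?a k)) (z k) (z (n + k)) \<le> road_cap net k \<and>
         (if ?a k < l then - load net k l (z k) (z (n + k)) else if l < ?a k then z k else 0)
           \<le> (if ?a k < l then - road_cap net k else 0) \<and>
         - (\<Sum>j\<in>{1..<k}. z (n + j)) \<le> - (\<phi> (max l (?a k) / l) * ybar)) \<longleftrightarrow>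
       (0 \<le> z k \<and> 0 \<le> z (n + k) \<and>
         load net k (max l (?a k)) (z k) (z (n + k)) \<le> road_cap net k \<and>
         (l < ?a k \<longrightarrow> z k \<le> 0) \<and>
         \<phi> (max l (?a k) / l) * ybar \<le> (\<Sum>j\<in>{1..<k}. z (n + j))) \<and>
       (?a k < l \<longrightarrow> road_cap net k \<le> load net k l (z k) (z (n + k)))" for k
      by (cases "?a k < l"; cases "l < ?a k") (simp_all, argo?)
    have eq: "u \<le> v \<and> - u \<le> - v \<longleftrightarrow> u = v"
      "u \<le> v \<and> - u \<le> - v \<and> R \<longleftrightarrow> u = v \<and> R" for u v :: real and R by auto
    show ?thesis
      unfolding saturated_routing_def relaxed_routing_def n_def[symmetric] k
        diff_le_0_iff_le eq
      by (simp only: ball_conj_distrib conj_ac)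
  qed
  finally show ?thesis .
qed

lemma lp_optimal_cong:
  assumes "\<And>i j. i < k \<Longrightarrow> j < n \<Longrightarrow> A i j = A' i j" "\<And>i. i < k \<Longrightarrow> b i = b' i"
    "\<And>j. j < n \<Longrightarrow> c j = c' j"
  shows "lp_optimal n k A b c = lp_optimal n k A' b' c'"
proof -
  have "(\<lambda>z. \<forall>i<k. (\<Sum>j<n. A i j * z j) \<le> b i) = (\<lambda>z. \<forall>i<k. (\<Sum>j<n. A' i j * z j) \<le> b' i)"
    using assms
    by (intro ext iff_allI imp_cong refl arg_cong2[where f = "(\<le>)"] sum.cong) auto
  moreover have "(\<lambda>z. \<Sum>j<n. c j * z j) = (\<lambda>z. \<Sum>j<n. c' j * z j)"
    using assms by (intro ext sum.cong) auto
  ultimately show ?thesis unfolding lp_optimal_def by simp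
qed

lemma lp_optimal_point_cong:
  assumes "\<And>j. j < n \<Longrightarrow> z j = z' j"
  shows "lp_optimal n k A b c z = lp_optimal n k A b c z'"
proof -
  have "(\<Sum>j<n. f j * z j) = (\<Sum>j<n. f j * z' j)" for f :: "nat \<Rightarrow> real"
    using assms by (intro sum.cong) auto
  then show ?thesis unfolding lp_optimal_def is_arg_min_def by simp
qed

context mixed_traffic begin

definition candidate_lp :: "real \<Rightarrow> (nat \<Rightarrow> real) \<Rightarrow> bool" where
  "candidate_lp l = lp_optimal (N + N + 1) (N + N + N + N + N + 5) (lp_A net l) (lp_b net xbar ybar \<phi> l) lp_c"

definition epigraph_point :: "real \<Rightarrow> (nat \<Rightarrow> real) \<Rightarrow> bool" where
  "epigraph_point l z \<longleftrightarrow> saturated l z (\<lambda>k. z (N + k)) \<and> cost l z (\<lambda>k. z (N + k)) \<le> z 0"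

lemma lp_objective: "(\<Sum>j<N + N + 1. lp_c j * z j) = z 0"
proof -
  have "(\<Sum>j<N + N + 1. lp_c j * z j) = 1 * z 0"
    unfolding lp_c_def by (rule sum_one_column) simp
  then show ?thesis by simp
qed

lemma candidate_lp_iff:
  "candidate_lp l z \<longleftrightarrow> epigraph_point l z \<and> (\<forall>w. epigraph_point l w \<longrightarrow> z 0 \<le> w 0)"
proof -
  have "candidate_lp l z \<longleftrightarrow> is_arg_min (\<lambda>w. w 0) (epigraph_point l) z"
    unfolding candidate_lp_def lp_optimal_def lp_feasible_iff lp_objective epigraph_point_def ..
  then show ?thesis unfolding is_arg_min_def not_ex de_Morgan_conj not_less by blast
qed

text \<open>
  The inverse of reading the flows off a vector of variables.
\<close>

definition encode :: "real \<Rightarrow> (nat \<Rightarrow> real) \<Rightarrow> (nat \<Rightarrow> real) \<Rightarrow> nat \<Rightarrow> real" where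
  "encode v x y j = (if j = 0 then v else if j \<le> N then x j else y (j - N))"

lemma encode:
  "saturated l (encode v x y) (\<lambda>k. encode v x y (N + k)) \<longleftrightarrow> saturated l x y"
  "cost l (encode v x y) (\<lambda>k. encode v x y (N + k)) = cost l x y"
  "encode v x y 0 = v"
proof -
  have *: "encode v x y i = x i \<and> encode v x y (N + i) = y i" if "i \<in> {1..N}" for i
    using that by (auto simp: encode_def)
  show "saturated l (encode v x y) (\<lambda>k. encode v x y (N + k)) \<longleftrightarrow> saturated l x y"
    by (rule saturated_cong) (rule *)
  show "cost l (encode v x y) (\<lambda>k. encode v x y (N + k)) = cost l x y"
    by (rule level_cost_cong) (rule *)
qed (simp add: encode_def)

lemma epigraph_encode: "saturated l x y \<Longrightarrow> epigraph_point l (encode (cost l x y) x y)"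
  by (simp add: epigraph_point_def encode)

lemma candidate_lp_optimal:
  assumes "candidate_lp l z"
  shows "saturated l z (\<lambda>k. z (N + k))" "cost l z (\<lambda>k. z (N + k)) \<le> z 0"
    "saturated l x y \<Longrightarrow> z 0 \<le> cost l x y"
proof -
  have z: "epigraph_point l z" "\<And>w. epigraph_point l w \<Longrightarrow> z 0 \<le> w 0"
    using assms by (simp_all add: candidate_lp_iff)
  from z(1) show "saturated l z (\<lambda>k. z (N + k))" "cost l z (\<lambda>k. z (N + k)) \<le> z 0"
    by (simp_all add: epigraph_point_def)
  assume "saturated l x y"
  from z(2)[OF epigraph_encode[OF this]] show "z 0 \<le> cost l x y" by (simp add: encode)
qed

lemma candidate_lp_solvable:
  assumes "saturated l x y"
  shows "\<exists>z. candidate_lp l z"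
proof -
  obtain x' y' where xy: "saturated l x' y'"
    "\<And>x'' y''. saturated l x'' y'' \<Longrightarrow> cost l x' y' \<le> cost l x'' y''"
    using saturated_min_attained[OF assms xbar ybar] by blast
  have "candidate_lp l (encode (cost l x' y') x' y')"
    unfolding candidate_lp_iff
  proof (intro conjI allI impI)
    show "encode (cost l x' y') x' y' 0 \<le> w 0" if "epigraph_point l w" for w
    proof -
      have "cost l x' y' \<le> cost l w (\<lambda>k. w (N + k))" "cost l w (\<lambda>k. w (N + k)) \<le> w 0"
        using that xy(2) unfolding epigraph_point_def by blast+
      then show ?thesis unfolding encode(3) by linarith
    qed
  qed (rule epigraph_encode[OF xy(1)])
  then show ?thesis by blast
qed

end

section \<open>Timed total correctness of programs\<close>

text \<open>
  A weakest-precondition style judgement with a time bound. Postconditions need not mention what a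
  program leaves alone: by \<open>exec_agree\<close> and \<open>runs_conseq\<close>, agreement outside the written arrays can
  be added to any postcondition, because these arrays can be read off the program text.
\<close>

definition runs :: "lp_solver \<Rightarrow> com \<Rightarrow> state \<Rightarrow> nat \<Rightarrow> (state \<Rightarrow> bool) \<Rightarrow> bool" where
  "runs S c \<sigma> T Q \<longleftrightarrow> (\<exists>t \<sigma>'. exec S c \<sigma> t \<sigma>' \<and> t \<le> T \<and> Q \<sigma>')"

primrec nat_writes :: "com \<Rightarrow> name set" where
  "nat_writes Skip = {}"
| "nat_writes (NAssign a i j e) = {a}"
| "nat_writes (RAssign a i j e) = {}"
| "nat_writes (Solve_LP n k A b c z ok) = {ok}"
| "nat_writes (Seq c d) = nat_writes c \<union> nat_writes d"
| "nat_writes (Cond b c d) = nat_writes c \<union> nat_writes d"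
| "nat_writes (Loop b c) = nat_writes c"

primrec real_writes :: "com \<Rightarrow> name set" where
  "real_writes Skip = {}"
| "real_writes (NAssign a i j e) = {}"
| "real_writes (RAssign a i j e) = {a}"
| "real_writes (Solve_LP n k A b c z ok) = {z}"
| "real_writes (Seq c d) = real_writes c \<union> real_writes d"
| "real_writes (Cond b c d) = real_writes c \<union> real_writes d"
| "real_writes (Loop b c) = real_writes c"

definition agree :: "name set \<Rightarrow> name set \<Rightarrow> state \<Rightarrow> state \<Rightarrow> bool" where
  "agree ns rs \<sigma> \<sigma>' \<longleftrightarrow>
     (\<forall>v. v \<notin> ns \<longrightarrow> nats \<sigma>' v = nats \<sigma> v) \<and> (\<forall>v. v \<notin> rs \<longrightarrow> reals \<sigma>' v = reals \<sigma> v)"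

lemma agree_refl [simp]: "agree ns rs \<sigma> \<sigma>"
  by (simp add: agree_def)

lemma agree_trans: "agree ns rs \<sigma> \<sigma>' \<Longrightarrow> agree ns rs \<sigma>' \<sigma>'' \<Longrightarrow> agree ns rs \<sigma> \<sigma>''"
  by (simp add: agree_def)

lemma agree_mono: "agree ns rs \<sigma> \<sigma>' \<Longrightarrow> ns \<subseteq> ns' \<Longrightarrow> rs \<subseteq> rs' \<Longrightarrow> agree ns' rs' \<sigma> \<sigma>'"
  by (auto simp: agree_def)

lemma agree_nats: "agree ns rs \<sigma> \<sigma>' \<Longrightarrow> v \<notin> ns \<Longrightarrow> nats \<sigma>' v = nats \<sigma> v"
  and agree_reals: "agree ns rs \<sigma> \<sigma>' \<Longrightarrow> w \<notin> rs \<Longrightarrow> reals \<sigma>' w = reals \<sigma> w"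
  by (auto simp: agree_def)

lemma upd_same [simp]: "upd M a i j v a i j = v"
  by (simp add: upd_def)

lemma upd_other: "upd M a i j v b k l = (if b = a \<and> k = i \<and> l = j then v else M b k l)"
  by (simp add: upd_def)

lemma upd_array: "b \<noteq> a \<Longrightarrow> upd M a i j v b = M b"
  by (simp add: upd_def)

lemma exec_agree: "exec S c \<sigma> t \<sigma>' \<Longrightarrow> agree (nat_writes c) (real_writes c) \<sigma> \<sigma>'"
proof (induction rule: exec.induct)
  case (Solve_LP n k A b c z ok \<sigma>)
  then show ?case
    by (auto simp: agree_def store_lp_result_def upd_array split: option.splits)
next
  case (Seq c \<sigma> t \<sigma>' d u \<sigma>'')
  then show ?case by (auto intro: agree_trans agree_mono)
next
  case (Loop_True b \<sigma> c t \<sigma>' u \<sigma>'')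
  then show ?case by (auto intro: agree_trans)
qed (auto simp: agree_def upd_array)

lemma runs_conseq:
  assumes "runs S c \<sigma> T Q" "T \<le> T'"
    "\<And>\<sigma>'. Q \<sigma>' \<Longrightarrow> agree (nat_writes c) (real_writes c) \<sigma> \<sigma>' \<Longrightarrow> Q' \<sigma>'"
  shows "runs S c \<sigma> T' Q'"
  using assms exec_agree unfolding runs_def by (meson order_trans)

lemma runs_Skip: "Q \<sigma> \<Longrightarrow> 1 \<le> T \<Longrightarrow> runs S Skip \<sigma> T Q"
  unfolding runs_def using exec.Skip by blast

lemma runs_NAssign:
  "Q (\<sigma>\<lparr>nats := upd (nats \<sigma>) a (nval i \<sigma>) (nval j \<sigma>) (nval e \<sigma>)\<rparr>) \<Longrightarrow> 1 \<le> T \<Longrightarrow> runs S (NAssign a i j e) \<sigma> T Q"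
  unfolding runs_def using exec.NAssign by blast

lemma runs_RAssign:
  "Q (\<sigma>\<lparr>reals := upd (reals \<sigma>) a (nval i \<sigma>) (nval j \<sigma>) (rval e \<sigma>)\<rparr>) \<Longrightarrow> 1 \<le> T \<Longrightarrow> runs S (RAssign a i j e) \<sigma> T Q"
  unfolding runs_def using exec.RAssign by blast

lemma runs_Solve_LP:
  "Q (store_lp_result z ok (nval n \<sigma>)
      (S (nval n \<sigma>) (nval k \<sigma>) (reals \<sigma> A) (\<lambda>i. reals \<sigma> b i 0) (\<lambda>j. reals \<sigma> c j 0)) \<sigma>) \<Longrightarrow>
   1 + (nval n \<sigma> + nval k \<sigma>) ^ 3 \<le> T \<Longrightarrow> runs S (Solve_LP n k A b c z ok) \<sigma> T Q"
  unfolding runs_def using exec.Solve_LP by blast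

lemma runs_Seq:
  assumes "runs S c \<sigma> T1 (\<lambda>\<sigma>'. runs S d \<sigma>' T2 Q)" "T1 + T2 \<le> T"
  shows "runs S (Seq c d) \<sigma> T Q"
proof -
  obtain t \<sigma>' u \<sigma>'' where "exec S c \<sigma> t \<sigma>'" "t \<le> T1" "exec S d \<sigma>' u \<sigma>''" "u \<le> T2" "Q \<sigma>''"
    using assms(1) unfolding runs_def by blast
  then show ?thesis unfolding runs_def
    by (intro exI[of _ "t + u"] exI[of _ \<sigma>'']) (use assms(2) in \<open>auto intro: exec.Seq\<close>)
qed

lemma runs_Cond:
  assumes "bval b \<sigma> \<Longrightarrow> runs S c \<sigma> T1 Q" "\<not> bval b \<sigma> \<Longrightarrow> runs S d \<sigma> T1 Q" "1 + T1 \<le> T"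
  shows "runs S (Cond b c d) \<sigma> T Q"
proof (cases "bval b \<sigma>")
  case True
  then obtain t \<sigma>' where "exec S c \<sigma> t \<sigma>'" "t \<le> T1" "Q \<sigma>'" using assms(1) unfolding runs_def by blast
  then show ?thesis unfolding runs_def
    by (intro exI[of _ "1 + t"] exI[of _ \<sigma>']) (use assms(3) exec.Cond_True[of b \<sigma> S c t \<sigma>' d] True in auto)
next
  case False
  then obtain t \<sigma>' where "exec S d \<sigma> t \<sigma>'" "t \<le> T1" "Q \<sigma>'" using assms(2) unfolding runs_def by blast
  then show ?thesis unfolding runs_def
    by (intro exI[of _ "1 + t"] exI[of _ \<sigma>']) (use assms(3) exec.Cond_False[of b \<sigma> S d t \<sigma>' c] False in auto)
qed

text \<open>
  The variant \<open>\<mu>\<close> bounds the number of iterations, so amortised costs are expressed by its choice.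
\<close>

lemma runs_Loop:
  fixes \<mu> :: "state \<Rightarrow> nat"
  assumes step: "\<And>\<sigma>. I \<sigma> \<Longrightarrow> bval b \<sigma> \<Longrightarrow> runs S c \<sigma> T (\<lambda>\<sigma>'. I \<sigma>' \<and> \<mu> \<sigma>' < \<mu> \<sigma>)"
    and init: "I \<sigma>" and post: "\<And>\<sigma>'. I \<sigma>' \<Longrightarrow> \<not> bval b \<sigma>' \<Longrightarrow> Q \<sigma>'"
    and time: "1 + \<mu> \<sigma> * (T + 1) \<le> U"
  shows "runs S (Loop b c) \<sigma> U Q"
proof -
  have "runs S (Loop b c) \<sigma> (1 + \<mu> \<sigma> * (T + 1)) Q"
    using init
  proof (induction "\<mu> \<sigma>" arbitrary: \<sigma> rule: less_induct)
    case less
    show ?case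
    proof (cases "bval b \<sigma>")
      case True
      then obtain t \<sigma>' where 1: "exec S c \<sigma> t \<sigma>'" "t \<le> T" "I \<sigma>'" "\<mu> \<sigma>' < \<mu> \<sigma>"
        using step less.prems unfolding runs_def by blast
      then obtain u \<sigma>'' where 2: "exec S (Loop b c) \<sigma>' u \<sigma>''" "u \<le> 1 + \<mu> \<sigma>' * (T + 1)" "Q \<sigma>''"
        using less.hyps unfolding runs_def by blast
      have "(\<mu> \<sigma>' + 1) * (T + 1) \<le> \<mu> \<sigma> * (T + 1)" using 1(4) by (intro mult_right_mono) auto
      then have "1 + t + u \<le> 1 + \<mu> \<sigma> * (T + 1)" using 1(2) 2(2) by simp
      then show ?thesis unfolding runs_def using exec.Loop_True[OF True 1(1) 2(1)] 2(3) by blast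
    next
      case False
      then show ?thesis unfolding runs_def using exec.Loop_False post less.prems by force
    qed
  qed
  then show ?thesis using runs_conseq time by blast
qed

abbreviation NV :: "name \<Rightarrow> nexp" where "NV v \<equiv> NCell v (NNum 0) (NNum 0)"
abbreviation RV :: "name \<Rightarrow> rexp" where "RV v \<equiv> RCell v (NNum 0) (NNum 0)"
abbreviation R1 :: "name \<Rightarrow> nexp \<Rightarrow> rexp" where "R1 a i \<equiv> RCell a i (NNum 0)"

definition For :: "name \<Rightarrow> nat \<Rightarrow> nexp \<Rightarrow> com \<Rightarrow> com" where
  "For v lo hi c = Seq (NAssign v (NNum 0) (NNum 0) (NNum lo))
     (Loop (NLess (NV v) hi) (Seq c (NAssign v (NNum 0) (NNum 0) (NAdd (NV v) (NNum 1)))))"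

lemma writes_For [simp]:
  "nat_writes (For v lo hi c) = insert v (nat_writes c)"
  "real_writes (For v lo hi c) = real_writes c"
  by (auto simp: For_def)

text \<open>
  The frame condition is built in: the body may assume agreement with the initial state outside the
  written arrays, so the invariant \<open>I\<close> only has to describe what the loop computes.
\<close>

lemma runs_For:
  assumes body: "\<And>n \<sigma>'. lo \<le> n \<Longrightarrow> n < H \<Longrightarrow> I n \<sigma>' \<Longrightarrow> nats \<sigma>' v 0 0 = n \<Longrightarrow>
        agree (insert v (nat_writes c)) (real_writes c) \<sigma> \<sigma>' \<Longrightarrow>
        runs S c \<sigma>' T (\<lambda>\<sigma>''. I (Suc n) (\<sigma>''\<lparr>nats := upd (nats \<sigma>'') v 0 0 (Suc n)\<rparr>))"
    and v: "v \<notin> nat_writes c"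
    and hi: "\<And>\<sigma>'. agree (insert v (nat_writes c)) (real_writes c) \<sigma> \<sigma>' \<Longrightarrow> nval hi \<sigma>' = H"
    and lo: "lo \<le> H"
    and init: "I lo (\<sigma>\<lparr>nats := upd (nats \<sigma>) v 0 0 lo\<rparr>)"
    and post: "\<And>\<sigma>'. I H \<sigma>' \<Longrightarrow> agree (insert v (nat_writes c)) (real_writes c) \<sigma> \<sigma>' \<Longrightarrow> Q \<sigma>'"
    and time: "2 + (H - lo) * (T + 2) \<le> U"
  shows "runs S (For v lo hi c) \<sigma> U Q"
proof -
  let ?ag = "agree (insert v (nat_writes c)) (real_writes c)"
  let ?J = "\<lambda>\<sigma>'. ?ag \<sigma> \<sigma>' \<and> lo \<le> nats \<sigma>' v 0 0 \<and> nats \<sigma>' v 0 0 \<le> H \<and> I (nats \<sigma>' v 0 0) \<sigma>'"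
  show ?thesis
    unfolding For_def
  proof (rule runs_Seq[where ?T1.0 = 1 and ?T2.0 = "1 + (H - lo) * (T + 2)"], rule runs_NAssign)
    let ?\<sigma>0 = "\<sigma>\<lparr>nats := upd (nats \<sigma>) v (nval (NNum 0) \<sigma>) (nval (NNum 0) \<sigma>) (nval (NNum lo) \<sigma>)\<rparr>"
    show "runs S (Loop (NLess (NV v) hi) (Seq c (NAssign v (NNum 0) (NNum 0) (NAdd (NV v) (NNum 1)))))
        ?\<sigma>0 (1 + (H - lo) * (T + 2)) Q"
    proof (rule runs_Loop[where I = ?J and \<mu> = "\<lambda>\<sigma>'. H - nats \<sigma>' v 0 0" and T = "T + 1"])
      show "?J ?\<sigma>0" using lo init by (auto simp: agree_def upd_array)
      show "Q \<sigma>'" if "?J \<sigma>'" "\<not> bval (NLess (NV v) hi) \<sigma>'" for \<sigma>'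
        using that hi[of \<sigma>'] post[of \<sigma>'] by auto
      fix \<sigma>' assume J: "?J \<sigma>'" and b: "bval (NLess (NV v) hi) \<sigma>'"
      define n where "n = nats \<sigma>' v 0 0"
      have n: "lo \<le> n" "n < H" "I n \<sigma>'" using J b hi[of \<sigma>'] by (auto simp: n_def)
      have "runs S c \<sigma>' T (\<lambda>\<sigma>''. I (Suc n) (\<sigma>''\<lparr>nats := upd (nats \<sigma>'') v 0 0 (Suc n)\<rparr>))"
        using body[OF n] J by (simp add: n_def)
      then show "runs S (Seq c (NAssign v (NNum 0) (NNum 0) (NAdd (NV v) (NNum 1)))) \<sigma>' (T + 1)
          (\<lambda>\<sigma>''. ?J \<sigma>'' \<and> H - nats \<sigma>'' v 0 0 < H - nats \<sigma>' v 0 0)"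
      proof (rule runs_Seq[OF runs_conseq])
        fix \<sigma>'' assume I: "I (Suc n) (\<sigma>''\<lparr>nats := upd (nats \<sigma>'') v 0 0 (Suc n)\<rparr>)"
          and ag: "agree (nat_writes c) (real_writes c) \<sigma>' \<sigma>''"
        have nv: "nats \<sigma>'' v 0 0 = n" using ag v by (simp add: agree_def n_def)
        have "?ag \<sigma> \<sigma>''" using ag J by (auto simp: agree_def)
        then have "?ag \<sigma> (\<sigma>''\<lparr>nats := upd (nats \<sigma>'') v 0 0 (Suc n)\<rparr>)" by (simp add: agree_def upd_array)
        then show "runs S (NAssign v (NNum 0) (NNum 0) (NAdd (NV v) (NNum 1))) \<sigma>'' 1
          (\<lambda>\<sigma>''. ?J \<sigma>'' \<and> H - nats \<sigma>'' v 0 0 < H - nats \<sigma>' v 0 0)"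
          using I n nv by (intro runs_NAssign) (auto simp: n_def[symmetric])
      qed auto
    qed (simp add: upd_def)
  qed (use time in auto)
qed

text \<open>
  Case distinctions inside expressions, compiled to nested conditionals with an assignment at each
  leaf. Arrays can then be specified by the value of a single expression in their index.
\<close>

datatype cexp = CVal rexp | CIf bexp cexp cexp

primrec cval :: "cexp \<Rightarrow> state \<Rightarrow> real" where
  "cval (CVal e) \<sigma> = rval e \<sigma>"
| "cval (CIf b c d) \<sigma> = (if bval b \<sigma> then cval c \<sigma> else cval d \<sigma>)"

primrec cdepth :: "cexp \<Rightarrow> nat" where
  "cdepth (CVal e) = 1"
| "cdepth (CIf b c d) = Suc (max (cdepth c) (cdepth d))"

primrec CAssign :: "name \<Rightarrow> nexp \<Rightarrow> nexp \<Rightarrow> cexp \<Rightarrow> com" where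
  "CAssign a i j (CVal e) = RAssign a i j e"
| "CAssign a i j (CIf b c d) = Cond b (CAssign a i j c) (CAssign a i j d)"

lemma writes_CAssign [simp]: "nat_writes (CAssign a i j e) = {}" "real_writes (CAssign a i j e) = {a}"
  by (induction e) auto

lemma runs_CAssign:
  "Q (\<sigma>\<lparr>reals := upd (reals \<sigma>) a (nval i \<sigma>) (nval j \<sigma>) (cval e \<sigma>)\<rparr>) \<Longrightarrow> cdepth e \<le> T \<Longrightarrow>
    runs S (CAssign a i j e) \<sigma> T Q"
proof (induction e arbitrary: T)
  case (CVal e)
  then show ?case by (auto intro: runs_RAssign)
next
  case (CIf b c d)
  show ?case unfolding CAssign.simps
    by (rule runs_Cond[where ?T1.0 = "T - 1"]) (use CIf in auto)
qed

definition Fill :: "name \<Rightarrow> name \<Rightarrow> nat \<Rightarrow> nexp \<Rightarrow> cexp \<Rightarrow> com" where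
  "Fill a v lo hi e = For v lo hi (CAssign a (NV v) (NNum 0) e)"

lemma writes_Fill [simp]: "nat_writes (Fill a v lo hi e) = {v}" "real_writes (Fill a v lo hi e) = {a}"
  by (simp_all add: Fill_def)

lemma runs_Fill:
  assumes hi: "\<And>\<sigma>'. agree {v} {a} \<sigma> \<sigma>' \<Longrightarrow> nval hi \<sigma>' = H" and lo: "lo \<le> H"
    and val: "\<And>\<sigma>' n. agree {v} {a} \<sigma> \<sigma>' \<Longrightarrow> lo \<le> n \<Longrightarrow> n < H \<Longrightarrow> nats \<sigma>' v 0 0 = n \<Longrightarrow> cval e \<sigma>' = V n"
    and post: "\<And>\<sigma>'. agree {v} {a} \<sigma> \<sigma>' \<Longrightarrow> (\<And>n. lo \<le> n \<Longrightarrow> n < H \<Longrightarrow> reals \<sigma>' a n 0 = V n) \<Longrightarrow> Q \<sigma>'"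
    and time: "2 + (H - lo) * (cdepth e + 2) \<le> T"
  shows "runs S (Fill a v lo hi e) \<sigma> T Q"
  unfolding Fill_def
proof (rule runs_For[where I = "\<lambda>m \<sigma>'. \<forall>n. lo \<le> n \<and> n < m \<longrightarrow> reals \<sigma>' a n 0 = V n" and T = "cdepth e" and H = H])
  fix n \<sigma>'
  assume "lo \<le> n" "n < H" "\<forall>m. lo \<le> m \<and> m < n \<longrightarrow> reals \<sigma>' a m 0 = V m" "nats \<sigma>' v 0 0 = n"
    "agree (insert v (nat_writes (CAssign a (NV v) (NNum 0) e))) (real_writes (CAssign a (NV v) (NNum 0) e)) \<sigma> \<sigma>'"
  then show "runs S (CAssign a (NV v) (NNum 0) e) \<sigma>' (cdepth e)
      (\<lambda>\<sigma>''. \<forall>m. lo \<le> m \<and> m < Suc n \<longrightarrow> reals (\<sigma>''\<lparr>nats := upd (nats \<sigma>'') v 0 0 (Suc n)\<rparr>) a m 0 = V m)"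
    using val[of \<sigma>' n] by (intro runs_CAssign) (auto simp: upd_other less_Suc_eq)
qed (use assms in auto)

definition Fill2 :: "name \<Rightarrow> name \<Rightarrow> nexp \<Rightarrow> name \<Rightarrow> nexp \<Rightarrow> cexp \<Rightarrow> com" where
  "Fill2 a u rows v cols e = For u 0 rows (For v 0 cols (CAssign a (NV u) (NV v) e))"

lemma writes_Fill2 [simp]:
  "nat_writes (Fill2 a u rows v cols e) = {u, v}" "real_writes (Fill2 a u rows v cols e) = {a}"
  by (simp_all add: Fill2_def)

lemma runs_Fill2:
  assumes uv: "u \<noteq> v"
    and rows: "\<And>\<sigma>'. agree {u, v} {a} \<sigma> \<sigma>' \<Longrightarrow> nval rows \<sigma>' = R"
    and cols: "\<And>\<sigma>'. agree {u, v} {a} \<sigma> \<sigma>' \<Longrightarrow> nval cols \<sigma>' = C"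
    and val: "\<And>\<sigma>' i j. agree {u, v} {a} \<sigma> \<sigma>' \<Longrightarrow> i < R \<Longrightarrow> j < C \<Longrightarrow>
       nats \<sigma>' u 0 0 = i \<Longrightarrow> nats \<sigma>' v 0 0 = j \<Longrightarrow> cval e \<sigma>' = V i j"
    and post: "\<And>\<sigma>'. agree {u, v} {a} \<sigma> \<sigma>' \<Longrightarrow> (\<And>i j. i < R \<Longrightarrow> j < C \<Longrightarrow> reals \<sigma>' a i j = V i j) \<Longrightarrow> Q \<sigma>'"
    and time: "2 + R * (2 + C * (cdepth e + 2) + 2) \<le> T"
  shows "runs S (Fill2 a u rows v cols e) \<sigma> T Q"
  unfolding Fill2_def
proof (rule runs_For[where I = "\<lambda>m \<sigma>'. \<forall>i j. i < m \<and> j < C \<longrightarrow> reals \<sigma>' a i j = V i j"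
      and T = "2 + C * (cdepth e + 2)" and H = R])
  fix r \<sigma>1
  let ?inner = "For v 0 cols (CAssign a (NV u) (NV v) e)"
  assume r: "r < R" and done1: "\<forall>i j. i < r \<and> j < C \<longrightarrow> reals \<sigma>1 a i j = V i j"
    and u: "nats \<sigma>1 u 0 0 = r" and "agree (insert u (nat_writes ?inner)) (real_writes ?inner) \<sigma> \<sigma>1"
  then have ag1: "agree {u, v} {a} \<sigma> \<sigma>1" by simp
  show "runs S ?inner \<sigma>1 (2 + C * (cdepth e + 2))
      (\<lambda>\<sigma>''. \<forall>i j. i < Suc r \<and> j < C \<longrightarrow> reals (\<sigma>''\<lparr>nats := upd (nats \<sigma>'') u 0 0 (Suc r)\<rparr>) a i j = V i j)"
  proof (rule runs_For[where I = "\<lambda>m \<sigma>'. (\<forall>i j. i < r \<and> j < C \<longrightarrow> reals \<sigma>' a i j = V i j) \<and> (\<forall>j<m. reals \<sigma>' a r j = V r j)"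
        and T = "cdepth e" and H = C])
    fix c \<sigma>2
    assume c: "c < C" and "(\<forall>i j. i < r \<and> j < C \<longrightarrow> reals \<sigma>2 a i j = V i j) \<and> (\<forall>j<c. reals \<sigma>2 a r j = V r j)"
      and v: "nats \<sigma>2 v 0 0 = c"
      and ag2: "agree (insert v (nat_writes (CAssign a (NV u) (NV v) e))) (real_writes (CAssign a (NV u) (NV v) e)) \<sigma>1 \<sigma>2"
    moreover have "agree {u, v} {a} \<sigma> \<sigma>2" using ag1 ag2 by (auto simp: agree_def)
    moreover have "nats \<sigma>2 u 0 0 = r" using ag2 u uv by (simp add: agree_def)
    ultimately show "runs S (CAssign a (NV u) (NV v) e) \<sigma>2 (cdepth e)
        (\<lambda>\<sigma>''. (\<forall>i j. i < r \<and> j < C \<longrightarrow> reals (\<sigma>''\<lparr>nats := upd (nats \<sigma>'') v 0 0 (Suc c)\<rparr>) a i j = V i j)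
          \<and> (\<forall>j<Suc c. reals (\<sigma>''\<lparr>nats := upd (nats \<sigma>'') v 0 0 (Suc c)\<rparr>) a r j = V r j))"
      using val[of \<sigma>2 r c] r by (intro runs_CAssign) (auto simp: upd_other less_Suc_eq)
  next
    fix \<sigma>' assume "agree (insert v (nat_writes (CAssign a (NV u) (NV v) e))) (real_writes (CAssign a (NV u) (NV v) e)) \<sigma>1 \<sigma>'"
    then have "agree {u, v} {a} \<sigma> \<sigma>'" using ag1 by (auto simp: agree_def)
    then show "nval cols \<sigma>' = C" by (rule cols)
  qed (use done1 in \<open>auto simp: less_Suc_eq\<close>)
qed (use uv rows post time in \<open>auto simp del: mult_Suc_right\<close>)

section \<open>The search program\<close>

abbreviation nN :: nexp where "nN \<equiv> NV ''N''"
abbreviation nK :: nexp where "nK \<equiv> NV ''K''"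
abbreviation n2 :: nexp where "n2 \<equiv> NAdd nN nN"
abbreviation n3 :: nexp where "n3 \<equiv> NAdd n2 nN"
abbreviation n4 :: nexp where "n4 \<equiv> NAdd n3 nN"
abbreviation n5 :: nexp where "n5 \<equiv> NAdd n4 nN"

definition NLe :: "nexp \<Rightarrow> nexp \<Rightarrow> bexp" where "NLe e f = BNot (NLess f e)"
definition NEq :: "nexp \<Rightarrow> nexp \<Rightarrow> bexp" where "NEq e f = BAnd (NLe e f) (NLe f e)"

lemma bval_NLe [simp]: "bval (NLe e f) \<sigma> \<longleftrightarrow> nval e \<sigma> \<le> nval f \<sigma>"
  by (auto simp: NLe_def)

lemma bval_NEq [simp]: "bval (NEq e f) \<sigma> \<longleftrightarrow> nval e \<sigma> = nval f \<sigma>"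
  by (auto simp: NEq_def)

definition aE :: "nexp \<Rightarrow> rexp" where
  "aE k = RDiv (R1 ''d'' k) (R1 ''vfree'' k)"
definition capE :: "nexp \<Rightarrow> rexp" where
  "capE k = RMul (R1 ''d'' k) (R1 ''rho_max'' k)"
definition humE :: "nexp \<Rightarrow> rexp \<Rightarrow> rexp" where
  "humE k l = RAdd l (RMul (aE k) (RSub (RMul (R1 ''rho_max'' k) (RAdd (R1 ''hw_hum'' k) (RV ''veh_len''))) (RNum 1)))"
definition autE :: "nexp \<Rightarrow> rexp \<Rightarrow> rexp" where
  "autE k l = RAdd l (RMul (aE k) (RSub (RMul (R1 ''rho_max'' k) (RAdd (R1 ''hw_aut'' k) (RV ''veh_len''))) (RNum 1)))"

abbreviation neg :: "rexp \<Rightarrow> rexp" where "neg e \<equiv> RSub (RNum 0) e"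

text \<open>
  Array \<open>t\<close> holds the latencies \<open>max l (a k)\<close>.
\<close>

definition cell_A :: cexp where
  "cell_A = (let r = NV ''r''; c = NV ''c''; l = RV ''l'' in
     CIf (NEq r (NNum 0))
       (CIf (NEq c (NNum 0)) (CVal (RNum (- 1)))
         (CIf (NLe c nN) (CVal (R1 ''t'' c)) (CVal (R1 ''t'' (NSub c nN)))))
     (CIf (NLe r n2) (CIf (NEq c r) (CVal (RNum (- 1))) (CVal (RNum 0)))
     (CIf (NLe r n3)
       (let k = NSub r n2 in
        CIf (NEq c k) (CVal (humE k (R1 ''t'' k)))
          (CIf (NEq c (NAdd nN k)) (CVal (autE k (R1 ''t'' k))) (CVal (RNum 0))))
     (CIf (NLe r n4)
       (let k = NSub r n3 in
        CIf (RLess (aE k) l)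
          (CIf (NEq c k) (CVal (neg (humE k l)))
            (CIf (NEq c (NAdd nN k)) (CVal (neg (autE k l))) (CVal (RNum 0))))
          (CIf (RLess l (aE k)) (CIf (NEq c k) (CVal (RNum 1)) (CVal (RNum 0))) (CVal (RNum 0))))
     (CIf (NLe r n5)
       (CIf (BAnd (NLess nN c) (NLess c (NAdd nN (NSub r n4)))) (CVal (RNum (- 1))) (CVal (RNum 0)))
     (CIf (NEq r (NAdd n5 (NNum 1)))
       (CIf (BAnd (NLess (NNum 0) c) (NLe c nN)) (CVal (RNum 1)) (CVal (RNum 0)))
     (CIf (NEq r (NAdd n5 (NNum 2)))
       (CIf (BAnd (NLess (NNum 0) c) (NLe c nN)) (CVal (RNum (- 1))) (CVal (RNum 0)))
     (CIf (NEq r (NAdd n5 (NNum 3)))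
       (CIf (NLess nN c) (CVal (RNum 1)) (CVal (RNum 0)))
       (CIf (NLess nN c) (CVal (RNum (- 1))) (CVal (RNum 0)))))))))))"

text \<open>
  Column \<open>j\<close> of the table \<open>T\<close> holds the profile values for the multiplier \<open>q j\<close> of the current
  candidate \<open>l = a i / q j\<close>.
\<close>

definition cell_b :: cexp where
  "cell_b = (let r = NV ''r'' in
     CIf (NLe r n2) (CVal (RNum 0))
     (CIf (NLe r n3) (CVal (capE (NSub r n2)))
     (CIf (NLe r n4)
       (CIf (RLess (aE (NSub r n3)) (RV ''l'')) (CVal (neg (capE (NSub r n3)))) (CVal (RNum 0)))
     (CIf (NLe r n5)
       (CVal (neg (RMul (RCell ''T'' (NSub r n4) (NV ''j'')) (RV ''ybar''))))
     (CIf (NEq r (NAdd n5 (NNum 1))) (CVal (RV ''xbar''))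
     (CIf (NEq r (NAdd n5 (NNum 2))) (CVal (neg (RV ''xbar'')))
     (CIf (NEq r (NAdd n5 (NNum 3))) (CVal (RV ''ybar''))
       (CVal (neg (RV ''ybar''))))))))))"

definition cell_t :: cexp where
  "cell_t = CIf (RLess (RV ''l'') (aE (NV ''k''))) (CVal (aE (NV ''k''))) (CVal (RV ''l''))"

definition cell_obj :: cexp where
  "cell_obj = CIf (NEq (NV ''c'') (NNum 0)) (CVal (RNum 1)) (CVal (RNum 0))"

text \<open>
  The altruism levels followed by 1, the multipliers of the candidates.
\<close>

definition cell_q :: cexp where
  "cell_q = CIf (NLess (NV ''j'') nK) (CVal (R1 ''kappa'' (NV ''j''))) (CVal (RNum 1))"

definition cell_T :: cexp where
  "cell_T = CIf (NEq (NV ''p'') (NNum 0)) (CVal (RNum 0))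
     (CIf (NLess (NV ''p'') nK) (CVal (R1 ''phi'' (NSub (NV ''p'') (NNum 1)))) (CVal (RNum 1)))"

abbreviation incr :: "name \<Rightarrow> com" where
  "incr v \<equiv> NAssign v (NNum 0) (NNum 0) (NAdd (NV v) (NNum 1))"
abbreviation nset :: "name \<Rightarrow> nexp \<Rightarrow> com" where
  "nset v e \<equiv> NAssign v (NNum 0) (NNum 0) e"
abbreviation rset :: "name \<Rightarrow> rexp \<Rightarrow> com" where
  "rset v e \<equiv> RAssign v (NNum 0) (NNum 0) e"

text \<open>
  Fills row \<open>k\<close> of the table for the current road \<open>i\<close>. The pointer \<open>p\<close> advances to the number of
  levels below the ratio that belongs to \<open>q j\<close>. It returns to 0 for the additional multiplier 1,
  which does not continue the increasing sequence of levels.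
\<close>

definition merge_body :: com where
  "merge_body =
     Cond (BAnd (NLess (NV ''p'') nK)
           (BNot (BAnd (BNot (RLess (R1 ''kappa'' (NV ''p'')) (RNum 1)))
              (BNot (RLess (R1 ''kappa'' (NV ''p''))
                 (RDiv (RMul (aE (NV ''k'')) (R1 ''q'' (NV ''j''))) (aE (NV ''i''))))))))
       (incr ''p'')
       (Seq (CAssign ''T'' (NV ''k'') (NV ''j'') cell_T)
         (Seq (incr ''j'') (Cond (NLess (NV ''j'') nK) Skip (nset ''p'' (NNum 0)))))"

definition merge_prog :: com where
  "merge_prog = Seq (nset ''j'' (NNum 0)) (Seq (nset ''p'' (NNum 0))
     (Loop (NLess (NV ''j'') (NAdd nK (NNum 1))) merge_body))"

definition tables_prog :: com where
  "tables_prog = For ''k'' 1 (NAdd nN (NNum 1)) merge_prog"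

definition mark_prog :: com where
  "mark_prog = For ''k'' 1 (NAdd nN (NNum 1))
     (Seq (Cond (RLess (aE (NV ''k'')) (RV ''l'')) (NAssign ''s'' (NV ''k'') (NNum 0) (NNum 1))
            (NAssign ''s'' (NV ''k'') (NNum 0) (NNum 0)))
       (Cond (RLess (RV ''l'') (aE (NV ''k''))) Skip (nset ''m'' (NV ''k''))))"

definition record_prog :: com where
  "record_prog = Seq (nset ''found'' (NNum 1)) (Seq (rset ''best'' (RV ''z''))
     (Seq (rset ''l0'' (RV ''l''))
     (Seq (Fill ''x'' ''k'' 1 (NAdd nN (NNum 1)) (CVal (R1 ''z'' (NV ''k''))))
     (Seq (Fill ''y'' ''k'' 1 (NAdd nN (NNum 1)) (CVal (R1 ''z'' (NAdd nN (NV ''k'')))))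
       mark_prog))))"

definition build_prog :: com where
  "build_prog = Seq (Fill ''t'' ''k'' 1 (NAdd nN (NNum 1)) cell_t)
     (Seq (Fill2 ''A'' ''r'' (NAdd n5 (NNum 5)) ''c'' (NAdd n2 (NNum 1)) cell_A)
     (Seq (Fill ''b'' ''r'' 0 (NAdd n5 (NNum 5)) cell_b)
       (Fill ''obj'' ''c'' 0 (NAdd n2 (NNum 1)) cell_obj)))"

definition solve_prog :: com where
  "solve_prog = Seq build_prog
     (Seq (Solve_LP (NAdd n2 (NNum 1)) (NAdd n5 (NNum 5)) ''A'' ''b'' ''obj'' ''z'' ''ok'')
       (Cond (BAnd (NLess (NNum 0) (NV ''ok''))
                (BNot (BAnd (NLess (NNum 0) (NV ''found'')) (BNot (RLess (RV ''z'') (RV ''best''))))))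
          record_prog Skip))"

text \<open>
  Candidates below the smallest free-flow latency are skipped. A level 0 leads to such a candidate,
  since division by zero yields 0.
\<close>

definition candidate_prog :: com where
  "candidate_prog = Seq (rset ''l'' (RDiv (aE (NV ''i'')) (R1 ''q'' (NV ''j''))))
     (Cond (RLess (RV ''l'') (aE (NNum 1))) Skip solve_prog)"

definition search_prog :: com where
  "search_prog = Seq (Fill ''q'' ''j'' 0 (NAdd nK (NNum 1)) cell_q)
     (Seq (nset ''found'' (NNum 0))
       (For ''i'' 1 (NAdd nN (NNum 1))
          (Seq tables_prog (For ''j'' 0 (NAdd nK (NNum 1)) candidate_prog))))"

lemma writes_progs [simp]:
  "nat_writes merge_prog = {''j'', ''p''}" "real_writes merge_prog = {''T''}"
  "nat_writes tables_prog = {''k'', ''j'', ''p''}" "real_writes tables_prog = {''T''}"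
  "nat_writes mark_prog = {''k'', ''s'', ''m''}" "real_writes mark_prog = {}"
  "nat_writes record_prog = {''found'', ''k'', ''s'', ''m''}"
  "real_writes record_prog = {''best'', ''l0'', ''x'', ''y''}"
  "nat_writes build_prog = {''k'', ''r'', ''c''}" "real_writes build_prog = {''t'', ''A'', ''b'', ''obj''}"
  "nat_writes solve_prog = {''k'', ''r'', ''c'', ''ok'', ''found'', ''s'', ''m''}"
  "real_writes solve_prog = {''t'', ''A'', ''b'', ''obj'', ''z'', ''best'', ''l0'', ''x'', ''y''}"
  "nat_writes candidate_prog = {''k'', ''r'', ''c'', ''ok'', ''found'', ''s'', ''m''}"
  "real_writes candidate_prog = {''l'', ''t'', ''A'', ''b'', ''obj'', ''z'', ''best'', ''l0'', ''x'', ''y''}"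
  by (auto simp: merge_prog_def merge_body_def tables_prog_def mark_prog_def record_prog_def
      build_prog_def solve_prog_def candidate_prog_def)

context mixed_traffic begin

abbreviation "inp \<equiv> input_state net xbar ybar ks ps"

lemma K_pos: "1 \<le> length ks"
  using profile by (auto simp: altruism_profile_def)

lemma N_pos: "1 \<le> N"
  using one_road by simp

lemma input_sizes: "inp \<sigma> \<Longrightarrow> nats \<sigma> ''N'' 0 0 = N" "inp \<sigma> \<Longrightarrow> nats \<sigma> ''K'' 0 0 = length ks"
  and input_scalars: "inp \<sigma> \<Longrightarrow> reals \<sigma> ''xbar'' 0 0 = xbar" "inp \<sigma> \<Longrightarrow> reals \<sigma> ''ybar'' 0 0 = ybar"
  and input_kappa: "inp \<sigma> \<Longrightarrow> j < length ks \<Longrightarrow> reals \<sigma> ''kappa'' j 0 = ks ! j"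
  and input_phi: "inp \<sigma> \<Longrightarrow> j < length ps \<Longrightarrow> reals \<sigma> ''phi'' j 0 = ps ! j"
  by (auto simp: input_state_def)

lemma input_exprs:
  assumes "inp \<sigma>" "nval k \<sigma> \<in> {1..N}"
  shows "rval (aE k) \<sigma> = a (nval k \<sigma>)" "rval (capE k) \<sigma> = road_cap net (nval k \<sigma>)"
    "rval (humE k l) \<sigma> = hum_coef net (nval k \<sigma>) (rval l \<sigma>)"
    "rval (autE k l) \<sigma> = aut_coef net (nval k \<sigma>) (rval l \<sigma>)"
  using assms
  by (auto simp: input_state_def aE_def capE_def humE_def autE_def ff_latency_def road_cap_def
      hum_coef_def aut_coef_def)

lemma input_agree:
  assumes "inp \<sigma>" "agree ns rs \<sigma> \<sigma>'" "ns \<inter> {''N'', ''K''} = {}"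
    "rs \<inter> {''d'', ''vfree'', ''rho_max'', ''hw_aut'', ''hw_hum'', ''veh_len'', ''xbar'', ''ybar'', ''kappa'', ''phi''} = {}"
  shows "inp \<sigma>'"
  using assms by (auto simp: input_state_def agree_def)

lemma input_upd:
  "v \<notin> {''N'', ''K''} \<Longrightarrow> inp (\<sigma>\<lparr>nats := upd (nats \<sigma>) v i j n\<rparr>) = inp \<sigma>"
  "w \<notin> {''d'', ''vfree'', ''rho_max'', ''hw_aut'', ''hw_hum'', ''veh_len'', ''xbar'', ''ybar'', ''kappa'', ''phi''} \<Longrightarrow>
    inp (\<sigma>\<lparr>reals := upd (reals \<sigma>) w i j u\<rparr>) = inp \<sigma>"
  by (auto simp: input_state_def upd_array)

section \<open>Correctness and running time of the search\<close>

lemma cval_cell_A: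
  assumes inp: "inp \<sigma>" and l: "reals \<sigma> ''l'' 0 0 = l"
    and t: "\<And>k. k \<in> {1..N} \<Longrightarrow> reals \<sigma> ''t'' k 0 = max l (a k)"
    and rc: "nats \<sigma> ''r'' 0 0 = r" "nats \<sigma> ''c'' 0 0 = c" and c: "c < N + N + 1"
  shows "cval cell_A \<sigma> = lp_A net l r c"
proof -
  note s = input_sizes[OF inp] l rc
  consider "r = 0" | "0 < r" "r \<le> N + N" | "N + N < r" "r \<le> N + N + N"
    | "N + N + N < r" "r \<le> N + N + N + N" | "N + N + N + N < r"
    by (metis not_le not_gr_zero)
  then show ?thesis
  proof cases
    case 1
    have "c \<le> N \<or> c - N \<in> {1..N}" using c by auto
    then show ?thesis using 1 t[of c] t[of "c - N"] by (auto simp: cell_A_def lp_A_def Let_def s)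
  next
    case 2
    then show ?thesis by (simp add: cell_A_def lp_A_def Let_def s)
  next
    case 3
    then have k: "r - (N + N) \<in> {1..N}" by auto
    then have "nval (NSub (NV ''r'') n2) \<sigma> \<in> {1..N}" by (simp add: s)
    note e = input_exprs[OF inp this]
    show ?thesis using 3 e t[OF k] by (simp add: cell_A_def lp_A_def Let_def s)
  next
    case 4
    then have k: "r - (N + N + N) \<in> {1..N}" by auto
    then have "nval (NSub (NV ''r'') n3) \<sigma> \<in> {1..N}" by (simp add: s)
    note e = input_exprs[OF inp this]
    show ?thesis using 4 e by (simp add: cell_A_def lp_A_def Let_def s)
  next
    case 5
    then show ?thesis by (simp add: cell_A_def lp_A_def Let_def s)
  qed
qed

lemma cval_cell_b:
  assumes inp: "inp \<sigma>" and l: "reals \<sigma> ''l'' 0 0 = l"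
    and T: "\<And>k. k \<in> {1..N} \<Longrightarrow> reals \<sigma> ''T'' k (nats \<sigma> ''j'' 0 0) = \<phi> (max l (a k) / l)"
    and r: "nats \<sigma> ''r'' 0 0 = r"
  shows "cval cell_b \<sigma> = lp_b net xbar ybar \<phi> l r"
proof -
  note s = input_sizes[OF inp] input_scalars[OF inp] l r
  consider "r \<le> N + N" | "N + N < r" "r \<le> N + N + N"
    | "N + N + N < r" "r \<le> N + N + N + N" | "N + N + N + N < r" "r \<le> N + N + N + N + N"
    | "N + N + N + N + N < r"
    by (metis not_le not_gr_zero)
  then show ?thesis
  proof cases
    case 1
    then show ?thesis by (simp add: cell_b_def lp_b_def Let_def s)
  next
    case 2
    then have "nval (NSub (NV ''r'') n2) \<sigma> \<in> {1..N}" by (auto simp: s)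
    note e = input_exprs[OF inp this]
    show ?thesis using 2 e by (simp add: cell_b_def lp_b_def Let_def s)
  next
    case 3
    then have "nval (NSub (NV ''r'') n3) \<sigma> \<in> {1..N}" by (auto simp: s)
    note e = input_exprs[OF inp this]
    show ?thesis using 3 e by (simp add: cell_b_def lp_b_def Let_def s)
  next
    case 4
    then have "r - (N + N + N + N) \<in> {1..N}" by auto
    then show ?thesis using 4 T by (simp add: cell_b_def lp_b_def Let_def s)
  next
    case 5
    then show ?thesis by (simp add: cell_b_def lp_b_def Let_def s)
  qed
qed

definition multiplier :: "nat \<Rightarrow> real" where
  "multiplier j = (if j < length ks then ks ! j else 1)"

text \<open>
  This is \<open>max l (a k) / l\<close> for \<open>l = a i / multiplier j\<close>, in a form that shows the
  dependence on the multiplier.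
\<close>

definition ratio :: "nat \<Rightarrow> nat \<Rightarrow> nat \<Rightarrow> real" where
  "ratio i k j = max 1 (a k * multiplier j / a i)"

definition multipliers_ok :: "state \<Rightarrow> bool" where
  "multipliers_ok \<sigma> \<longleftrightarrow> (\<forall>j\<le>length ks. reals \<sigma> ''q'' j 0 = multiplier j)"

lemma ratio_mono:
  assumes "i \<in> {1..N}" "k \<in> {1..N}" "Suc j < length ks"
  shows "ratio i k j \<le> ratio i k (Suc j)"
proof -
  have "ks ! j \<le> ks ! Suc j"
    using profile assms(3) by (auto simp: altruism_profile_def sorted_wrt_iff_nth_less less_imp_le)
  then have "a k * multiplier j / a i \<le> a k * multiplier (Suc j) / a i"
    using assms a_pos by (intro divide_right_mono mult_left_mono) (auto simp: multiplier_def less_imp_le)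
  then show ?thesis by (simp add: ratio_def max.coboundedI2)
qed

text \<open>
  Each iteration either advances the pointer or finishes a table entry, and the pointer is reset
  once only, so a number of iterations linear in the number of levels suffices.
\<close>

lemma runs_merge:
  assumes inp: "inp \<sigma>" and q: "multipliers_ok \<sigma>" and i: "nats \<sigma> ''i'' 0 0 = i" "i \<in> {1..N}"
    and k: "nats \<sigma> ''k'' 0 0 = k" "k \<in> {1..N}"
  shows "runs S merge_prog \<sigma> (35 * length ks) (\<lambda>\<sigma>'.
    (\<forall>j\<le>length ks. reals \<sigma>' ''T'' k j = \<phi> (ratio i k j)) \<and>
    (\<forall>k'. k' \<noteq> k \<longrightarrow> reals \<sigma>' ''T'' k' = reals \<sigma> ''T'' k'))"
proof -
  define K where "K = length ks"
  define J where "J \<sigma>' j p \<longleftrightarrow> agree {''j'', ''p''} {''T''} \<sigma> \<sigma>' \<and> j \<le> Suc K \<and> p \<le> K \<and>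
      (j \<le> K \<longrightarrow> (\<forall>n<p. ks ! n < ratio i k j)) \<and>
      (\<forall>n<j. reals \<sigma>' ''T'' k n = \<phi> (ratio i k n)) \<and>
      (\<forall>k'. k' \<noteq> k \<longrightarrow> reals \<sigma>' ''T'' k' = reals \<sigma> ''T'' k')" for \<sigma>' j p
  \<comment> \<open>the summand \<open>K + 1\<close> pays for the reset of the pointer at \<open>j = K\<close>\<close>
  define M where "M j p = (if j < K then (K - j) + (K - p) + (K + 1) else if j = K then K - p + 1 else 0)" for j p
  let ?j = "\<lambda>\<sigma>'. nats \<sigma>' ''j'' 0 0" and ?p = "\<lambda>\<sigma>'. nats \<sigma>' ''p'' 0 0"
  have K: "1 \<le> K" using K_pos by (simp add: K_def)
  have lps: "length ks = Suc (length ps)" using profile by (simp add: altruism_profile_def)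
  have loop: "runs S (Loop (NLess (NV ''j'') (NAdd nK (NNum 1))) merge_body) \<sigma>0 (1 + (3 * K + 1) * 8) (\<lambda>\<sigma>'.
    (\<forall>j\<le>length ks. reals \<sigma>' ''T'' k j = \<phi> (ratio i k j)) \<and>
    (\<forall>k'. k' \<noteq> k \<longrightarrow> reals \<sigma>' ''T'' k' = reals \<sigma> ''T'' k'))" if J0: "J \<sigma>0 (?j \<sigma>0) (?p \<sigma>0)"
     and start: "?j \<sigma>0 = 0" "?p \<sigma>0 = 0" for \<sigma>0
  proof (rule runs_Loop[where I = "\<lambda>\<sigma>'. J \<sigma>' (?j \<sigma>') (?p \<sigma>')" and \<mu> = "\<lambda>\<sigma>'. M (?j \<sigma>') (?p \<sigma>')" and T = 7])
    fix \<sigma>1 assume J1: "J \<sigma>1 (?j \<sigma>1) (?p \<sigma>1)" and b: "bval (NLess (NV ''j'') (NAdd nK (NNum 1))) \<sigma>1"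
    define j p where "j = ?j \<sigma>1" and "p = ?p \<sigma>1"
    have J1: "J \<sigma>1 j p" using J1 by (simp add: j_def p_def)
    have ag: "agree {''j'', ''p''} {''T''} \<sigma> \<sigma>1" using J1 by (simp add: J_def)
    have inp1: "inp \<sigma>1" using input_agree[OF inp ag] by simp
    note s = input_sizes[OF inp1]
    have j: "j \<le> K" using b by (simp add: s j_def K_def)
    have p: "p \<le> K" using J1 by (simp add: J_def)
    have ik: "nval (NV ''i'') \<sigma>1 = i" "nval (NV ''k'') \<sigma>1 = k"
      using ag i k by (simp_all add: agree_nats)
    have "nval (NV ''i'') \<sigma>1 \<in> {1..N}" "nval (NV ''k'') \<sigma>1 \<in> {1..N}" using ik i k by simp_all
    note e = this[THEN input_exprs(1)[OF inp1], unfolded ik]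
    have qj: "reals \<sigma>1 ''q'' j 0 = multiplier j"
      using ag q j by (simp add: agree_reals multipliers_ok_def K_def)
    let ?test = "BAnd (NLess (NV ''p'') nK)
           (BNot (BAnd (BNot (RLess (R1 ''kappa'' (NV ''p'')) (RNum 1)))
              (BNot (RLess (R1 ''kappa'' (NV ''p''))
                 (RDiv (RMul (aE (NV ''k'')) (R1 ''q'' (NV ''j''))) (aE (NV ''i'')))))))"
    have test: "bval ?test \<sigma>1 \<longleftrightarrow> p < K \<and> ks ! p < ratio i k j"
      using qj input_kappa[OF inp1, of p] s
      by (auto simp: e ratio_def j_def[symmetric] p_def[symmetric] K_def less_max_iff_disj)
    show "runs S merge_body \<sigma>1 7 (\<lambda>\<sigma>'. J \<sigma>' (?j \<sigma>') (?p \<sigma>') \<and> M (?j \<sigma>') (?p \<sigma>') < M (?j \<sigma>1) (?p \<sigma>1))"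
      unfolding merge_body_def
    proof (rule runs_Cond[where ?T1.0 = 6])
      assume "bval ?test \<sigma>1"
      then have t: "p < K" "ks ! p < ratio i k j" using test by blast+
      show "runs S (incr ''p'') \<sigma>1 6 (\<lambda>\<sigma>'. J \<sigma>' (?j \<sigma>') (?p \<sigma>') \<and> M (?j \<sigma>') (?p \<sigma>') < M (?j \<sigma>1) (?p \<sigma>1))"
      proof (rule runs_NAssign)
        let ?\<sigma> = "\<sigma>1\<lparr>nats := upd (nats \<sigma>1) ''p'' (nval (NNum 0) \<sigma>1) (nval (NNum 0) \<sigma>1) (nval (NAdd (NV ''p'') (NNum 1)) \<sigma>1)\<rparr>"
        have 1: "?j ?\<sigma> = j" "?p ?\<sigma> = Suc p" by (simp_all add: upd_array j_def p_def)
        have "J ?\<sigma> j (Suc p)" using J1 t unfolding J_def by (auto simp: agree_def upd_array less_Suc_eq)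
        then show "J ?\<sigma> (?j ?\<sigma>) (?p ?\<sigma>) \<and> M (?j ?\<sigma>) (?p ?\<sigma>) < M (?j \<sigma>1) (?p \<sigma>1)"
          unfolding 1 j_def[symmetric] p_def[symmetric] using t j by (auto simp: M_def)
      qed simp
    next
      assume "\<not> bval ?test \<sigma>1"
      then have t: "p < K \<Longrightarrow> ratio i k j \<le> ks ! p" using test not_le by blast
      have ph: "\<phi> (ratio i k j) = (if p = 0 then 0 else if p = length ks then 1 else ps ! (p - 1))"
        by (rule profile_pieces[OF profile]) (use J1 t j p in \<open>auto simp: J_def K_def ratio_def\<close>)
      have cT: "cval cell_T \<sigma>1 = \<phi> (ratio i k j)"
        using input_phi[OF inp1, of "p - 1"] p lps
        by (auto simp: ph cell_T_def s p_def[symmetric] K_def)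
      let ?Q = "\<lambda>\<sigma>'. J \<sigma>' (?j \<sigma>') (?p \<sigma>') \<and> M (?j \<sigma>') (?p \<sigma>') < M (?j \<sigma>1) (?p \<sigma>1)"
      let ?\<sigma>2 = "\<sigma>1\<lparr>reals := upd (reals \<sigma>1) ''T'' (nval (NV ''k'') \<sigma>1) (nval (NV ''j'') \<sigma>1) (cval cell_T \<sigma>1)\<rparr>"
      let ?\<sigma>3 = "?\<sigma>2\<lparr>nats := upd (nats ?\<sigma>2) ''j'' (nval (NNum 0) ?\<sigma>2) (nval (NNum 0) ?\<sigma>2) (nval (NAdd (NV ''j'') (NNum 1)) ?\<sigma>2)\<rparr>"
      have jp3: "?j ?\<sigma>3 = Suc j" "?p ?\<sigma>3 = p" by (simp_all add: upd_array j_def p_def)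
      have T3: "reals ?\<sigma>3 ''T'' k n = \<phi> (ratio i k n)" if "n < Suc j" for n
        using that J1 cT ik by (auto simp: J_def upd_other j_def less_Suc_eq)
      have T3': "reals ?\<sigma>3 ''T'' k' = reals \<sigma> ''T'' k'" if "k' \<noteq> k" for k'
        using that J1 ik by (auto simp: J_def upd_def)
      have ag3: "agree {''j'', ''p''} {''T''} \<sigma> ?\<sigma>3"
        using ag by (auto simp: agree_def upd_array)
      have K3: "nval nK ?\<sigma>3 = K" by (simp add: upd_array s K_def)
      show "runs S (Seq (CAssign ''T'' (NV ''k'') (NV ''j'') cell_T)
         (Seq (incr ''j'') (Cond (NLess (NV ''j'') nK) Skip (nset ''p'' (NNum 0))))) \<sigma>1 6 ?Q"
      proof (rule runs_Seq[where ?T1.0 = 3 and ?T2.0 = 3], rule runs_CAssign,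
          rule runs_Seq[where ?T1.0 = 1 and ?T2.0 = 2], rule runs_NAssign,
          rule runs_Cond[where ?T1.0 = 1])
        assume "bval (NLess (NV ''j'') nK) ?\<sigma>3"
        then have jK: "Suc j < K" using K3 jp3 by simp
        have "J ?\<sigma>3 (Suc j) p"
          unfolding J_def using ag3 T3 T3' jK p J1 ratio_mono[OF i(2) k(2), of j]
          by (auto simp: J_def K_def intro: less_le_trans)
        then show "runs S Skip ?\<sigma>3 1 ?Q"
          using jK by (intro runs_Skip) (auto simp: jp3 upd_array j_def[symmetric] p_def[symmetric] M_def)
      next
        assume "\<not> bval (NLess (NV ''j'') nK) ?\<sigma>3"
        then have jK: "K \<le> Suc j" using K3 jp3 by simp
        let ?\<sigma>4 = "?\<sigma>3\<lparr>nats := upd (nats ?\<sigma>3) ''p'' (nval (NNum 0) ?\<sigma>3) (nval (NNum 0) ?\<sigma>3) (nval (NNum 0) ?\<sigma>3)\<rparr>"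
        have jp4: "?j ?\<sigma>4 = Suc j" "?p ?\<sigma>4 = 0" using jp3 by (simp_all add: upd_array)
        have "agree {''j'', ''p''} {''T''} \<sigma> ?\<sigma>4" using ag3 by (auto simp: agree_def upd_array)
        then have "J ?\<sigma>4 (Suc j) 0"
          unfolding J_def using T3 T3' j by auto
        then show "runs S (nset ''p'' (NNum 0)) ?\<sigma>3 1 ?Q"
          using jK j by (intro runs_NAssign) (auto simp: jp4 upd_array j_def[symmetric] p_def[symmetric] M_def)
      qed (simp_all add: cell_T_def)
    qed simp
  next
    show "J \<sigma>0 (?j \<sigma>0) (?p \<sigma>0)" by (rule J0)
    show "1 + M (?j \<sigma>0) (?p \<sigma>0) * (7 + 1) \<le> 1 + (3 * K + 1) * 8" using K start by (simp add: M_def)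
    fix \<sigma>' assume J': "J \<sigma>' (?j \<sigma>') (?p \<sigma>')" and b: "\<not> bval (NLess (NV ''j'') (NAdd nK (NNum 1))) \<sigma>'"
    have "inp \<sigma>'" using input_agree[OF inp, of "{''j'', ''p''}" "{''T''}" \<sigma>'] J' by (simp add: J_def)
    then have "length ks < ?j \<sigma>'" using b by (simp add: input_sizes)
    then show "(\<forall>j\<le>length ks. reals \<sigma>' ''T'' k j = \<phi> (ratio i k j)) \<and>
        (\<forall>k'. k' \<noteq> k \<longrightarrow> reals \<sigma>' ''T'' k' = reals \<sigma> ''T'' k')"
      using J' by (simp add: J_def)
  qed
  show ?thesis
    unfolding merge_prog_def
  proof (rule runs_Seq[where ?T1.0 = 1 and ?T2.0 = "2 + (3 * K + 1) * 8"], rule runs_NAssign,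
      rule runs_Seq[where ?T1.0 = 1 and ?T2.0 = "1 + (3 * K + 1) * 8"], rule runs_NAssign, rule loop)
    show "1 + (2 + (3 * K + 1) * 8) \<le> 35 * length ks" using K by (simp add: K_def)
  qed (simp_all add: J_def agree_def upd_array)
qed

lemma multipliers_agree:
  "multipliers_ok \<sigma> \<Longrightarrow> agree ns rs \<sigma> \<sigma>' \<Longrightarrow> ''q'' \<notin> rs \<Longrightarrow> multipliers_ok \<sigma>'"
  by (simp add: multipliers_ok_def agree_reals)

definition table_ok :: "nat \<Rightarrow> state \<Rightarrow> bool" where
  "table_ok i \<sigma> \<longleftrightarrow> (\<forall>k\<in>{1..N}. \<forall>j\<le>length ks. reals \<sigma> ''T'' k j = \<phi> (ratio i k j))"

lemma table_agree: "table_ok i \<sigma> \<Longrightarrow> agree ns rs \<sigma> \<sigma>' \<Longrightarrow> ''T'' \<notin> rs \<Longrightarrow> table_ok i \<sigma>'"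
  by (simp add: table_ok_def agree_reals)

lemma runs_tables:
  assumes inp: "inp \<sigma>" and q: "multipliers_ok \<sigma>" and i: "nats \<sigma> ''i'' 0 0 = i" "i \<in> {1..N}"
  shows "runs S tables_prog \<sigma> (2 + N * (35 * length ks + 2)) (table_ok i)"
  unfolding tables_prog_def
proof (rule runs_For[where H = "Suc N" and T = "35 * length ks"
      and I = "\<lambda>m \<sigma>'. \<forall>k\<in>{1..<m}. \<forall>j\<le>length ks. reals \<sigma>' ''T'' k j = \<phi> (ratio i k j)"])
  fix k \<sigma>1
  assume k: "1 \<le> k" "k < Suc N" "nats \<sigma>1 ''k'' 0 0 = k"
    and prev: "\<forall>k\<in>{1..<k}. \<forall>j\<le>length ks. reals \<sigma>1 ''T'' k j = \<phi> (ratio i k j)"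
    and "agree (insert ''k'' (nat_writes merge_prog)) (real_writes merge_prog) \<sigma> \<sigma>1"
  then have ag: "agree {''k'', ''j'', ''p''} {''T''} \<sigma> \<sigma>1" by simp
  have "inp \<sigma>1" "multipliers_ok \<sigma>1" "nats \<sigma>1 ''i'' 0 0 = i"
    using input_agree[OF inp ag] multipliers_agree[OF q ag] agree_nats[OF ag, of "''i''"] i by simp_all
  moreover have "k \<in> {1..N}" using k by simp
  ultimately have m: "runs S merge_prog \<sigma>1 (35 * length ks) (\<lambda>\<sigma>'.
      (\<forall>j\<le>length ks. reals \<sigma>' ''T'' k j = \<phi> (ratio i k j)) \<and>
      (\<forall>k'. k' \<noteq> k \<longrightarrow> reals \<sigma>' ''T'' k' = reals \<sigma>1 ''T'' k'))"
    using runs_merge i(2) k(3) by blast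
  show "runs S merge_prog \<sigma>1 (35 * length ks) (\<lambda>\<sigma>''.
      \<forall>k'\<in>{1..<Suc k}. \<forall>j\<le>length ks. reals (\<sigma>''\<lparr>nats := upd (nats \<sigma>'') ''k'' 0 0 (Suc k)\<rparr>) ''T'' k' j = \<phi> (ratio i k' j))"
    by (rule runs_conseq[OF m order_refl]) (use prev in \<open>auto simp: less_Suc_eq\<close>)
next
  fix \<sigma>' assume "agree (insert ''k'' (nat_writes merge_prog)) (real_writes merge_prog) \<sigma> \<sigma>'"
  then have "inp \<sigma>'" by (intro input_agree[OF inp]) auto
  then show "nval (NAdd nN (NNum 1)) \<sigma>' = Suc N" by (simp add: input_sizes)
qed (auto simp: table_ok_def)

lemma candidate_ratio:
  assumes "i \<in> {1..N}" "l = a i / multiplier j" "0 < l"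
  shows "max l (a k) / l = ratio i k j"
proof -
  have "max l (a k) / l = max (l / l) (a k / l)"
    using assms(3) by (simp add: max_def divide_right_mono field_simps)
  moreover have "a i \<noteq> 0" "multiplier j \<noteq> 0" using assms(2,3) by auto
  ultimately show ?thesis using assms by (simp add: ratio_def)
qed

definition lp_built :: "real \<Rightarrow> state \<Rightarrow> bool" where
  "lp_built l \<sigma> \<longleftrightarrow>
     (\<forall>r c. r < N + N + N + N + N + 5 \<longrightarrow> c < N + N + 1 \<longrightarrow> reals \<sigma> ''A'' r c = lp_A net l r c) \<and>
     (\<forall>r<N + N + N + N + N + 5. reals \<sigma> ''b'' r 0 = lp_b net xbar ybar \<phi> l r) \<and>
     (\<forall>c<N + N + 1. reals \<sigma> ''obj'' c 0 = lp_c c)"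

lemma runs_build:
  assumes inp: "inp \<sigma>" and l: "reals \<sigma> ''l'' 0 0 = l"
    and T: "\<And>k. k \<in> {1..N} \<Longrightarrow> reals \<sigma> ''T'' k (nats \<sigma> ''j'' 0 0) = \<phi> (max l (a k) / l)"
  shows "runs S build_prog \<sigma> (600 * N ^ 3) (lp_built l)"
proof -
  let ?R = "N + N + N + N + N + 5" and ?C = "N + N + 1"
  have hi: "nval (NAdd nN (NNum 1)) \<sigma>' = Suc N" "nval (NAdd n5 (NNum 5)) \<sigma>' = ?R" "nval (NAdd n2 (NNum 1)) \<sigma>' = ?C"
    if "inp \<sigma>'" for \<sigma>' using input_sizes[OF that] by simp_all
  have dep: "cdepth cell_t = 2" "cdepth cell_A \<le> 12" "cdepth cell_b \<le> 8" "cdepth cell_obj = 2"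
    by (simp_all add: cell_t_def cell_A_def cell_b_def cell_obj_def Let_def)
  have inp1: "inp \<sigma>'" if "inp \<sigma>''" "agree ns rs \<sigma>'' \<sigma>'" "ns \<subseteq> {''k'', ''r'', ''c''}" "rs \<subseteq> {''t'', ''A'', ''b'', ''obj''}"
    for \<sigma>' \<sigma>'' ns rs
    using input_agree[OF that(1,2)] that(3,4) by fastforce
  show ?thesis
    unfolding build_prog_def
  proof (rule runs_Seq[where ?T1.0 = "2 + (Suc N - 1) * (cdepth cell_t + 2)"
        and ?T2.0 = "(2 + ?R * (2 + ?C * (cdepth cell_A + 2) + 2)) + ((2 + (?R - 0) * (cdepth cell_b + 2)) + (2 + (?C - 0) * (cdepth cell_obj + 2)))"],
      rule runs_Fill[where H = "Suc N" and V = "\<lambda>k. max l (a k)"])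
    fix \<sigma>1 assume ag1: "agree {''k''} {''t''} \<sigma> \<sigma>1"
    then have i1: "inp \<sigma>1" by (intro inp1[OF inp ag1]) auto
    show "nval (NAdd nN (NNum 1)) \<sigma>1 = Suc N" by (rule hi[OF i1])
    show "cval cell_t \<sigma>1 = max l (a k)" if "1 \<le> k" "k < Suc N" "nats \<sigma>1 ''k'' 0 0 = k" for k
    proof -
      have "nval (NV ''k'') \<sigma>1 \<in> {1..N}" using that by simp
      from input_exprs[OF i1 this] show ?thesis
        using that ag1 l by (simp add: cell_t_def agree_reals max_def)
    qed
    assume t1: "\<And>k. 1 \<le> k \<Longrightarrow> k < Suc N \<Longrightarrow> reals \<sigma>1 ''t'' k 0 = max l (a k)"
    show "runs S (Seq (Fill2 ''A'' ''r'' (NAdd n5 (NNum 5)) ''c'' (NAdd n2 (NNum 1)) cell_A)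
        (Seq (Fill ''b'' ''r'' 0 (NAdd n5 (NNum 5)) cell_b) (Fill ''obj'' ''c'' 0 (NAdd n2 (NNum 1)) cell_obj)))
        \<sigma>1 ((2 + ?R * (2 + ?C * (cdepth cell_A + 2) + 2)) + ((2 + (?R - 0) * (cdepth cell_b + 2)) + (2 + (?C - 0) * (cdepth cell_obj + 2)))) (lp_built l)"
    proof (rule runs_Seq[OF _ order_refl], rule runs_Fill2[where R = ?R and C = ?C and V = "lp_A net l", OF _ _ _ _ _ order_refl])
      fix \<sigma>2 assume ag2: "agree {''r'', ''c''} {''A''} \<sigma>1 \<sigma>2"
      then have i2: "inp \<sigma>2" by (intro inp1[OF i1 ag2]) auto
      show "nval (NAdd n5 (NNum 5)) \<sigma>2 = ?R" "nval (NAdd n2 (NNum 1)) \<sigma>2 = ?C" by (rule hi[OF i2])+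
      show "cval cell_A \<sigma>2 = lp_A net l r c" if "c < ?C" "nats \<sigma>2 ''r'' 0 0 = r" "nats \<sigma>2 ''c'' 0 0 = c" for r c
        using ag1 ag2 l t1 by (intro cval_cell_A[OF i2 _ _ that(2,3,1)]) (auto simp: agree_reals)
      assume A2: "\<And>r c. r < ?R \<Longrightarrow> c < ?C \<Longrightarrow> reals \<sigma>2 ''A'' r c = lp_A net l r c"
      show "runs S (Seq (Fill ''b'' ''r'' 0 (NAdd n5 (NNum 5)) cell_b) (Fill ''obj'' ''c'' 0 (NAdd n2 (NNum 1)) cell_obj))
        \<sigma>2 ((2 + (?R - 0) * (cdepth cell_b + 2)) + (2 + (?C - 0) * (cdepth cell_obj + 2))) (lp_built l)"
      proof (rule runs_Seq[OF _ order_refl], rule runs_Fill[where H = ?R and V = "lp_b net xbar ybar \<phi> l", OF _ _ _ _ order_refl])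
        fix \<sigma>3 assume ag3: "agree {''r''} {''b''} \<sigma>2 \<sigma>3"
        then have i3: "inp \<sigma>3" by (intro inp1[OF i2 ag3]) auto
        show "nval (NAdd n5 (NNum 5)) \<sigma>3 = ?R" by (rule hi[OF i3])
        show "cval cell_b \<sigma>3 = lp_b net xbar ybar \<phi> l r" if "nats \<sigma>3 ''r'' 0 0 = r" for r
          using ag1 ag2 ag3 l T by (intro cval_cell_b[OF i3 _ _ that]) (auto simp: agree_reals agree_nats)
        assume b3: "\<And>r. 0 \<le> r \<Longrightarrow> r < ?R \<Longrightarrow> reals \<sigma>3 ''b'' r 0 = lp_b net xbar ybar \<phi> l r"
        show "runs S (Fill ''obj'' ''c'' 0 (NAdd n2 (NNum 1)) cell_obj) \<sigma>3 (2 + (?C - 0) * (cdepth cell_obj + 2)) (lp_built l)"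
        proof (rule runs_Fill[where H = ?C and V = lp_c, OF _ _ _ _ order_refl])
          fix \<sigma>4 assume ag4: "agree {''c''} {''obj''} \<sigma>3 \<sigma>4"
          then have i4: "inp \<sigma>4" by (intro inp1[OF i3 ag4]) auto
          show "nval (NAdd n2 (NNum 1)) \<sigma>4 = ?C" by (rule hi[OF i4])
          show "cval cell_obj \<sigma>4 = lp_c c" if "nats \<sigma>4 ''c'' 0 0 = c" for c
            using that by (simp add: cell_obj_def lp_c_def)
          assume "\<And>c. 0 \<le> c \<Longrightarrow> c < ?C \<Longrightarrow> reals \<sigma>4 ''obj'' c 0 = lp_c c"
          then show "lp_built l \<sigma>4"
            using ag3 ag4 A2 b3 unfolding lp_built_def by (simp add: agree_reals)
        qed simp_all
      qed simp_all
    qed simp_all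
  next
    have n: "N \<le> N ^ 3" "N * N \<le> N ^ 3" "1 \<le> N ^ 3"
      using N_pos by (simp_all add: power3_eq_cube mult_le_mono)
    have "?R * (2 + ?C * (cdepth cell_A + 2) + 2) \<le> ?R * (2 + ?C * (12 + 2) + 2)"
      using dep(2) by (intro mult_left_mono add_mono) auto
    also have "\<dots> = 140 * (N * N) + 230 * N + 90" by (simp add: algebra_simps)
    finally have A: "?R * (2 + ?C * (cdepth cell_A + 2) + 2) \<le> 140 * (N * N) + 230 * N + 90" .
    have "?R * (cdepth cell_b + 2) \<le> ?R * (8 + 2)"
      using dep(3) by (intro mult_left_mono add_mono) auto
    then have B: "?R * (cdepth cell_b + 2) \<le> 50 * N + 50" by simp
    show "2 + (Suc N - 1) * (cdepth cell_t + 2) + ((2 + ?R * (2 + ?C * (cdepth cell_A + 2) + 2)) + ((2 + (?R - 0) * (cdepth cell_b + 2)) + (2 + (?C - 0) * (cdepth cell_obj + 2)))) \<le> 600 * N ^ 3"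
      using A B n unfolding dep(1,4) by simp
  qed simp_all
qed

text \<open>
  The last of the first \<open>n - 1\<close> roads whose free-flow latency is at most \<open>l\<close>; for \<open>n = N + 1\<close> the
  index of the interval that contains \<open>l\<close>.
\<close>

definition road_index :: "nat \<Rightarrow> real \<Rightarrow> nat \<Rightarrow> bool" where
  "road_index n l m \<longleftrightarrow> m \<in> {1..<n} \<and> a m \<le> l \<and> (\<forall>k\<in>{1..<n}. m < k \<longrightarrow> l < a k)"

lemma road_index_interval:
  "road_index (Suc N) l m \<Longrightarrow> m \<in> {1..N} \<and> ereal l \<in> {ff_latency_ext net m ..< ff_latency_ext net (Suc m)}"
  by (auto simp: road_index_def ff_latency_ext_def)

lemma runs_mark:
  assumes inp: "inp \<sigma>" and l: "reals \<sigma> ''l'' 0 0 = l" "a 1 \<le> l"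
  shows "runs S mark_prog \<sigma> (2 + N * 6) (\<lambda>\<sigma>'. (\<forall>k\<in>{1..N}. nats \<sigma>' ''s'' k 0 = state_at l k)
      \<and> road_index (Suc N) l (nats \<sigma>' ''m'' 0 0))"
  unfolding mark_prog_def
proof (rule runs_For[where H = "Suc N" and T = 4
      and I = "\<lambda>n \<sigma>'. (\<forall>k\<in>{1..<n}. nats \<sigma>' ''s'' k 0 = state_at l k)
        \<and> (n = 1 \<or> road_index n l (nats \<sigma>' ''m'' 0 0))"])
  let ?body = "Seq (Cond (RLess (aE (NV ''k'')) (RV ''l'')) (NAssign ''s'' (NV ''k'') (NNum 0) (NNum 1))
            (NAssign ''s'' (NV ''k'') (NNum 0) (NNum 0)))
       (Cond (RLess (RV ''l'') (aE (NV ''k''))) Skip (nset ''m'' (NV ''k'')))"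
  fix k \<sigma>1
  assume k: "1 \<le> k" "k < Suc N" "nats \<sigma>1 ''k'' 0 0 = k"
    and prev: "(\<forall>k\<in>{1..<k}. nats \<sigma>1 ''s'' k 0 = state_at l k) \<and> (k = 1 \<or> road_index k l (nats \<sigma>1 ''m'' 0 0))"
    and ag: "agree (insert ''k'' (nat_writes ?body)) (real_writes ?body) \<sigma> \<sigma>1"
  have inp1: "inp \<sigma>1" by (rule input_agree[OF inp ag]) auto
  have l1: "reals \<sigma>1 ''l'' 0 0 = l" using agree_reals[OF ag, of "''l''"] l by simp
  have "nval (NV ''k'') \<sigma>1 \<in> {1..N}" using k by simp
  from input_exprs(1)[OF inp1 this] have ek: "rval (aE (NV ''k'')) \<sigma>1 = a k" using k by simp
  let ?\<sigma> = "\<sigma>1\<lparr>nats := upd (nats \<sigma>1) ''s'' k 0 (state_at l k)\<rparr>"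
  have inp2: "inp ?\<sigma>" using inp1 by (simp add: input_upd)
  have "nval (NV ''k'') ?\<sigma> \<in> {1..N}" using k by (simp add: upd_array)
  from input_exprs(1)[OF inp2 this] have ek2: "rval (aE (NV ''k'')) ?\<sigma> = a k" using k by (simp add: upd_array)
  have next_index: "road_index (Suc k) l (if l < a k then nats \<sigma>1 ''m'' 0 0 else k)"
    using prev k l(2) by (auto simp: road_index_def less_Suc_eq)
  let ?Q = "\<lambda>\<sigma>''. (\<forall>i\<in>{1..<Suc k}. nats (\<sigma>''\<lparr>nats := upd (nats \<sigma>'') ''k'' 0 0 (Suc k)\<rparr>) ''s'' i 0 = state_at l i) \<and>
       (Suc k = 1 \<or> road_index (Suc k) l (nats (\<sigma>''\<lparr>nats := upd (nats \<sigma>'') ''k'' 0 0 (Suc k)\<rparr>) ''m'' 0 0))"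
  have s2: "nats ?\<sigma> ''s'' i 0 = state_at l i" if "i \<in> {1..<Suc k}" for i
    using that prev by (auto simp: upd_other)
  have second: "runs S (Cond (RLess (RV ''l'') (aE (NV ''k''))) Skip (nset ''m'' (NV ''k''))) ?\<sigma> 2 ?Q"
  proof (rule runs_Cond[where ?T1.0 = 1])
    assume "bval (RLess (RV ''l'') (aE (NV ''k''))) ?\<sigma>"
    then have "l < a k" using ek2 l1 by simp
    then show "runs S Skip ?\<sigma> 1 ?Q"
      using next_index s2 by (intro runs_Skip) (auto simp: upd_array)
  next
    assume "\<not> bval (RLess (RV ''l'') (aE (NV ''k''))) ?\<sigma>"
    then have "\<not> l < a k" using ek2 l1 by simp
    then show "runs S (nset ''m'' (NV ''k'')) ?\<sigma> 1 ?Q"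
      using next_index s2 k by (intro runs_NAssign) (auto simp: upd_array)
  qed simp
  show "runs S ?body \<sigma>1 4 ?Q"
  proof (rule runs_Seq[where ?T1.0 = 2 and ?T2.0 = 2], rule runs_Cond[where ?T1.0 = 1])
    assume "bval (RLess (aE (NV ''k'')) (RV ''l'')) \<sigma>1"
    then have "state_at l k = 1" using ek l1 k by (simp add: state_at_def)
    then show "runs S (NAssign ''s'' (NV ''k'') (NNum 0) (NNum 1)) \<sigma>1 1
        (\<lambda>\<sigma>'. runs S (Cond (RLess (RV ''l'') (aE (NV ''k''))) Skip (nset ''m'' (NV ''k''))) \<sigma>' 2 ?Q)"
      using second k by (intro runs_NAssign) simp_all
  next
    assume "\<not> bval (RLess (aE (NV ''k'')) (RV ''l'')) \<sigma>1"
    then have "state_at l k = 0" using ek l1 k by (simp add: state_at_def)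
    then show "runs S (NAssign ''s'' (NV ''k'') (NNum 0) (NNum 0)) \<sigma>1 1
        (\<lambda>\<sigma>'. runs S (Cond (RLess (RV ''l'') (aE (NV ''k''))) Skip (nset ''m'' (NV ''k''))) \<sigma>' 2 ?Q)"
      using second k by (intro runs_NAssign) simp_all
  qed simp_all
next
  let ?body = "Seq (Cond (RLess (aE (NV ''k'')) (RV ''l'')) (NAssign ''s'' (NV ''k'') (NNum 0) (NNum 1))
            (NAssign ''s'' (NV ''k'') (NNum 0) (NNum 0)))
       (Cond (RLess (RV ''l'') (aE (NV ''k''))) Skip (nset ''m'' (NV ''k'')))"
  fix \<sigma>' assume ag: "agree (insert ''k'' (nat_writes ?body)) (real_writes ?body) \<sigma> \<sigma>'"
  have "inp \<sigma>'" by (rule input_agree[OF inp ag]) auto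
  then show "nval (NAdd nN (NNum 1)) \<sigma>' = Suc N" by (simp add: input_sizes)
qed (use N_pos in auto)

text \<open>
  Here \<open>best\<close> is variable 0 of the linear program, a bound on the cost. An inequality suffices for
  optimality, since \<open>best\<close> does not exceed the cost of any competitor.
\<close>

definition recorded :: "state \<Rightarrow> bool" where
  "recorded \<sigma> \<longleftrightarrow> (let l = reals \<sigma> ''l0'' 0 0; x = (\<lambda>k. reals \<sigma> ''x'' k 0); y = (\<lambda>k. reals \<sigma> ''y'' k 0) in
     a 1 \<le> l \<and> saturated l x y \<and> cost l x y \<le> reals \<sigma> ''best'' 0 0 \<and>
     (\<forall>k\<in>{1..N}. nats \<sigma> ''s'' k 0 = state_at l k) \<and> road_index (Suc N) l (nats \<sigma> ''m'' 0 0))"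

lemma runs_record:
  assumes inp: "inp \<sigma>" and l: "reals \<sigma> ''l'' 0 0 = l" "a 1 \<le> l"
    and z: "candidate_lp l (\<lambda>k. reals \<sigma> ''z'' k 0)"
  shows "runs S record_prog \<sigma> (30 * N) (\<lambda>\<sigma>'. recorded \<sigma>' \<and> nats \<sigma>' ''found'' 0 0 = 1
      \<and> reals \<sigma>' ''best'' 0 0 = reals \<sigma> ''z'' 0 0)"
proof -
  let ?z = "\<lambda>k. reals \<sigma> ''z'' k 0"
  note zo = candidate_lp_optimal[OF z]
  let ?\<sigma>1 = "\<sigma>\<lparr>nats := upd (nats \<sigma>) ''found'' 0 0 1\<rparr>"
  let ?\<sigma>2 = "?\<sigma>1\<lparr>reals := upd (reals \<sigma>) ''best'' 0 0 (?z 0)\<rparr>"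
  let ?\<sigma>3 = "?\<sigma>2\<lparr>reals := upd (reals ?\<sigma>2) ''l0'' 0 0 l\<rparr>"
  have ag3: "agree {''found''} {''best'', ''l0''} \<sigma> ?\<sigma>3" by (simp add: agree_def upd_array)
  have v3: "nats ?\<sigma>3 ''found'' 0 0 = 1" "reals ?\<sigma>3 ''best'' 0 0 = ?z 0" "reals ?\<sigma>3 ''l0'' 0 0 = l"
    by (simp_all add: upd_array)
  let ?Q = "\<lambda>\<sigma>'. recorded \<sigma>' \<and> nats \<sigma>' ''found'' 0 0 = 1 \<and> reals \<sigma>' ''best'' 0 0 = reals \<sigma> ''z'' 0 0"
  have hi: "nval (NAdd nN (NNum 1)) \<sigma>' = Suc N" if "inp \<sigma>'" for \<sigma>'
    using input_sizes[OF that] by simp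
  have rest: "runs S (Seq (Fill ''x'' ''k'' 1 (NAdd nN (NNum 1)) (CVal (R1 ''z'' (NV ''k''))))
     (Seq (Fill ''y'' ''k'' 1 (NAdd nN (NNum 1)) (CVal (R1 ''z'' (NAdd nN (NV ''k'')))))
       mark_prog)) \<sigma>3 (6 + N * 12) ?Q" if ag3: "agree {''found''} {''best'', ''l0''} \<sigma> \<sigma>3" and
     v3: "nats \<sigma>3 ''found'' 0 0 = 1" "reals \<sigma>3 ''best'' 0 0 = ?z 0" "reals \<sigma>3 ''l0'' 0 0 = l" for \<sigma>3
  proof (rule runs_Seq[where ?T1.0 = "2 + N * 3" and ?T2.0 = "4 + N * 9"],
      rule runs_Fill[where H = "Suc N" and V = "\<lambda>k. ?z k"])
    have i3: "inp \<sigma>3" by (rule input_agree[OF inp ag3]) auto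
    fix \<sigma>4 assume ag4: "agree {''k''} {''x''} \<sigma>3 \<sigma>4"
    have i4: "inp \<sigma>4" by (rule input_agree[OF i3 ag4]) auto
    show "nval (NAdd nN (NNum 1)) \<sigma>4 = Suc N" by (rule hi[OF i4])
    show "cval (CVal (R1 ''z'' (NV ''k''))) \<sigma>4 = ?z k" if "nats \<sigma>4 ''k'' 0 0 = k" for k
      using that ag3 ag4 by (simp add: agree_reals)
    assume x4: "\<And>k. 1 \<le> k \<Longrightarrow> k < Suc N \<Longrightarrow> reals \<sigma>4 ''x'' k 0 = ?z k"
    show "runs S (Seq (Fill ''y'' ''k'' 1 (NAdd nN (NNum 1)) (CVal (R1 ''z'' (NAdd nN (NV ''k'')))))
       mark_prog) \<sigma>4 (4 + N * 9) ?Q"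
    proof (rule runs_Seq[where ?T1.0 = "2 + N * 3" and ?T2.0 = "2 + N * 6"],
        rule runs_Fill[where H = "Suc N" and V = "\<lambda>k. ?z (N + k)"])
      fix \<sigma>5 assume ag5: "agree {''k''} {''y''} \<sigma>4 \<sigma>5"
      have i5: "inp \<sigma>5" by (rule input_agree[OF i4 ag5]) auto
      show "nval (NAdd nN (NNum 1)) \<sigma>5 = Suc N" by (rule hi[OF i5])
      show "cval (CVal (R1 ''z'' (NAdd nN (NV ''k'')))) \<sigma>5 = ?z (N + k)" if "nats \<sigma>5 ''k'' 0 0 = k" for k
        using that ag3 ag4 ag5 by (simp add: agree_reals input_sizes[OF i5])
      assume y5: "\<And>k. 1 \<le> k \<Longrightarrow> k < Suc N \<Longrightarrow> reals \<sigma>5 ''y'' k 0 = ?z (N + k)"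
      have l5: "reals \<sigma>5 ''l'' 0 0 = l" using ag3 ag4 ag5 l by (simp add: agree_reals)
      show "runs S mark_prog \<sigma>5 (2 + N * 6) ?Q"
      proof (rule runs_conseq[OF runs_mark[OF i5 l5 l(2)] order_refl])
        fix \<sigma>6 assume m: "(\<forall>k\<in>{1..N}. nats \<sigma>6 ''s'' k 0 = state_at l k) \<and> road_index (Suc N) l (nats \<sigma>6 ''m'' 0 0)"
          and "agree (nat_writes mark_prog) (real_writes mark_prog) \<sigma>5 \<sigma>6"
        then have ag6: "agree {''k'', ''s'', ''m''} {} \<sigma>5 \<sigma>6" by simp
        have v6: "nats \<sigma>6 ''found'' 0 0 = 1" "reals \<sigma>6 ''best'' 0 0 = ?z 0" "reals \<sigma>6 ''l0'' 0 0 = l"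
          using v3 ag4 ag5 ag6 by (simp_all add: agree_nats agree_reals)
        have xy: "reals \<sigma>6 ''x'' k 0 = ?z k \<and> reals \<sigma>6 ''y'' k 0 = ?z (N + k)" if "k \<in> {1..N}" for k
          using that x4[of k] y5[of k] ag5 ag6 by (simp add: agree_reals)
        have "saturated l (\<lambda>k. reals \<sigma>6 ''x'' k 0) (\<lambda>k. reals \<sigma>6 ''y'' k 0)"
          using zo(1) saturated_cong[of net "\<lambda>k. reals \<sigma>6 ''x'' k 0" ?z "\<lambda>k. reals \<sigma>6 ''y'' k 0" "\<lambda>k. ?z (N + k)", OF xy]
          by blast
        moreover have "cost l (\<lambda>k. reals \<sigma>6 ''x'' k 0) (\<lambda>k. reals \<sigma>6 ''y'' k 0) \<le> ?z 0"
          using zo(2) level_cost_cong[of net "\<lambda>k. reals \<sigma>6 ''x'' k 0" ?z "\<lambda>k. reals \<sigma>6 ''y'' k 0" "\<lambda>k. ?z (N + k)" l, OF xy]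
          by simp
        ultimately show "?Q \<sigma>6"
          using m v6 l(2) by (simp add: recorded_def Let_def)
      qed
    qed simp_all
  qed simp_all
  show ?thesis
    unfolding record_prog_def
  proof (rule runs_Seq[where ?T1.0 = 1 and ?T2.0 = "8 + N * 12"], rule runs_NAssign,
      rule runs_Seq[where ?T1.0 = 1 and ?T2.0 = "7 + N * 12"], rule runs_RAssign,
      rule runs_Seq[where ?T1.0 = 1 and ?T2.0 = "6 + N * 12"], rule runs_RAssign, rule rest)
    show "1 + (8 + N * 12) \<le> 30 * N" using N_pos by simp
  qed (use l in \<open>simp_all add: agree_def upd_array\<close>)
qed

text \<open>
  The invariant of the search over the set \<open>P\<close> of candidates that have been visited.
\<close>

definition search_state :: "real set \<Rightarrow> state \<Rightarrow> bool" where
  "search_state P \<sigma> \<longleftrightarrow>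
     (nats \<sigma> ''found'' 0 0 = 0 \<and> (\<forall>l\<in>P. a 1 \<le> l \<longrightarrow> (\<forall>x y. \<not> saturated l x y))) \<or>
     (nats \<sigma> ''found'' 0 0 = 1 \<and> recorded \<sigma> \<and>
        (\<forall>l\<in>P. a 1 \<le> l \<longrightarrow> (\<forall>x y. saturated l x y \<longrightarrow> reals \<sigma> ''best'' 0 0 \<le> cost l x y)))"

lemma search_state_agree:
  assumes "search_state P \<sigma>" "agree ns rs \<sigma> \<sigma>'" "ns \<inter> {''found'', ''s'', ''m''} = {}"
    "rs \<inter> {''best'', ''l0'', ''x'', ''y''} = {}"
  shows "search_state P \<sigma>'"
proof -
  have "nats \<sigma>' v = nats \<sigma> v" if "v \<in> {''found'', ''s'', ''m''}" for v
    using assms(2,3) that by (auto simp: agree_def)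
  moreover have "reals \<sigma>' v = reals \<sigma> v" if "v \<in> {''best'', ''l0'', ''x'', ''y''}" for v
    using assms(2,4) that by (auto simp: agree_def)
  ultimately show ?thesis using assms(1) by (simp add: search_state_def recorded_def)
qed

lemma runs_solve:
  assumes S: "lp_solver_correct S" and inp: "inp \<sigma>"
    and l: "reals \<sigma> ''l'' 0 0 = l" "a 1 \<le> l"
    and T: "\<And>k. k \<in> {1..N} \<Longrightarrow> reals \<sigma> ''T'' k (nats \<sigma> ''j'' 0 0) = \<phi> (max l (a k) / l)"
    and st: "search_state P \<sigma>"
  shows "runs S solve_prog \<sigma> (3000 * N ^ 3) (search_state (insert l P))"
proof -
  let ?R = "N + N + N + N + N + 5" and ?C = "N + N + 1"
  let ?lp = "Solve_LP (NAdd n2 (NNum 1)) (NAdd n5 (NNum 5)) ''A'' ''b'' ''obj'' ''z'' ''ok''"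
  let ?test = "BAnd (NLess (NNum 0) (NV ''ok''))
                (BNot (BAnd (NLess (NNum 0) (NV ''found'')) (BNot (RLess (RV ''z'') (RV ''best'')))))"
  let ?Q = "search_state (insert l P)"
  have n: "N \<le> N ^ 3" "1 \<le> N ^ 3"
    using N_pos by (simp_all add: power3_eq_cube)
  have big: "(?C + ?R) ^ 3 \<le> 2197 * N ^ 3"
  proof -
    \<comment> \<open>\<open>7 * N + 6 \<le> 13 * N\<close>\<close>
    have "(?C + ?R) ^ 3 \<le> (13 * N) ^ 3" using N_pos by (intro power_mono) auto
    then show ?thesis by (simp add: power_mult_distrib)
  qed
  show ?thesis
    unfolding solve_prog_def
  proof (rule runs_Seq[where ?T1.0 = "600 * N ^ 3" and ?T2.0 = "1 + (?C + ?R) ^ 3 + (1 + 30 * N)"],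
      rule runs_conseq[OF runs_build[OF inp l(1) T] order_refl])
    fix \<sigma>1 assume built: "lp_built l \<sigma>1" and "agree (nat_writes build_prog) (real_writes build_prog) \<sigma> \<sigma>1"
    then have ag1: "agree {''k'', ''r'', ''c''} {''t'', ''A'', ''b'', ''obj''} \<sigma> \<sigma>1" by simp
    have i1: "inp \<sigma>1" by (rule input_agree[OF inp ag1]) auto
    have l1: "reals \<sigma>1 ''l'' 0 0 = l" using ag1 l by (simp add: agree_reals)
    have st1: "search_state P \<sigma>1" by (rule search_state_agree[OF st ag1]) auto
    have nv: "nval (NAdd n2 (NNum 1)) \<sigma>1 = ?C" "nval (NAdd n5 (NNum 5)) \<sigma>1 = ?R"
      using input_sizes[OF i1] by simp_all
    define res where "res = S ?C ?R (reals \<sigma>1 ''A'') (\<lambda>i. reals \<sigma>1 ''b'' i 0) (\<lambda>j. reals \<sigma>1 ''obj'' j 0)"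
    define \<sigma>2 where "\<sigma>2 = store_lp_result ''z'' ''ok'' ?C res \<sigma>1"
    have same: "lp_optimal ?C ?R (reals \<sigma>1 ''A'') (\<lambda>i. reals \<sigma>1 ''b'' i 0) (\<lambda>j. reals \<sigma>1 ''obj'' j 0) = candidate_lp l"
      unfolding candidate_lp_def by (rule lp_optimal_cong) (use built in \<open>auto simp: lp_built_def\<close>)
    have res: "case res of Some v \<Rightarrow> candidate_lp l v | None \<Rightarrow> \<not> (\<exists>z. candidate_lp l z)"
      using S[unfolded lp_solver_correct_def, rule_format, of ?C ?R "reals \<sigma>1 ''A''" "\<lambda>i. reals \<sigma>1 ''b'' i 0" "\<lambda>j. reals \<sigma>1 ''obj'' j 0"]
      unfolding same res_def[symmetric] .
    have ag2: "agree {''ok''} {''z''} \<sigma>1 \<sigma>2"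
      by (auto simp: agree_def \<sigma>2_def store_lp_result_def upd_array split: option.splits)
    have i2: "inp \<sigma>2" by (rule input_agree[OF i1 ag2]) auto
    have l2: "reals \<sigma>2 ''l'' 0 0 = l" using ag2 l1 by (simp add: agree_reals)
    have st2: "search_state P \<sigma>2" by (rule search_state_agree[OF st1 ag2]) auto
    have out: "(nats \<sigma>2 ''ok'' 0 0 = 1 \<and> candidate_lp l (\<lambda>k. reals \<sigma>2 ''z'' k 0)) \<or>
        (nats \<sigma>2 ''ok'' 0 0 = 0 \<and> (\<forall>x y. \<not> saturated l x y))"
    proof (cases res)
      case None
      then have "\<not> (\<exists>z. candidate_lp l z)" using res by simp
      then have "\<forall>x y. \<not> saturated l x y" using candidate_lp_solvable by blast
      then show ?thesis using None by (simp add: \<sigma>2_def store_lp_result_def)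
    next
      case (Some v)
      have "candidate_lp l (\<lambda>k. reals \<sigma>2 ''z'' k 0) = candidate_lp l v"
        unfolding candidate_lp_def
        by (rule lp_optimal_point_cong) (simp add: \<sigma>2_def store_lp_result_def Some)
      then show ?thesis using res Some by (simp add: \<sigma>2_def store_lp_result_def)
    qed
    have final: "runs S (Cond ?test record_prog Skip) \<sigma>2 (1 + 30 * N) ?Q"
    proof (rule runs_Cond[where ?T1.0 = "30 * N"])
      assume "bval ?test \<sigma>2"
      then have ok: "nats \<sigma>2 ''ok'' 0 0 \<noteq> 0"
        and new: "nats \<sigma>2 ''found'' 0 0 = 0 \<or> reals \<sigma>2 ''z'' 0 0 < reals \<sigma>2 ''best'' 0 0" by auto
      have lp: "candidate_lp l (\<lambda>k. reals \<sigma>2 ''z'' k 0)" using out ok by simp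
      show "runs S record_prog \<sigma>2 (30 * N) ?Q"
      proof (rule runs_conseq[OF runs_record[OF i2 l2 l(2) lp] order_refl])
        fix \<sigma>3 assume "recorded \<sigma>3 \<and> nats \<sigma>3 ''found'' 0 0 = 1 \<and> reals \<sigma>3 ''best'' 0 0 = reals \<sigma>2 ''z'' 0 0"
        then show "?Q \<sigma>3"
          using st2 new candidate_lp_optimal(3)[OF lp] unfolding search_state_def by fastforce
      qed
    next
      assume "\<not> bval ?test \<sigma>2"
      then have old: "nats \<sigma>2 ''ok'' 0 0 = 0 \<or>
          nats \<sigma>2 ''found'' 0 0 \<noteq> 0 \<and> reals \<sigma>2 ''best'' 0 0 \<le> reals \<sigma>2 ''z'' 0 0" by auto
      have "?Q \<sigma>2"
      proof (cases "nats \<sigma>2 ''ok'' 0 0 = 0")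
        case True
        then show ?thesis using out st2 unfolding search_state_def by auto
      next
        case False
        then have lp: "candidate_lp l (\<lambda>k. reals \<sigma>2 ''z'' k 0)" using out by simp
        show ?thesis
          using False old st2 candidate_lp_optimal(3)[OF lp] unfolding search_state_def by fastforce
      qed
      then show "runs S Skip \<sigma>2 (30 * N) ?Q" using N_pos by (intro runs_Skip) auto
    qed simp
    show "runs S (Seq ?lp (Cond ?test record_prog Skip)) \<sigma>1 (1 + (?C + ?R) ^ 3 + (1 + 30 * N)) ?Q"
    proof (rule runs_Seq[OF _ order_refl], rule runs_Solve_LP)
      show "runs S (Cond ?test record_prog Skip) (store_lp_result ''z'' ''ok'' (nval (NAdd n2 (NNum 1)) \<sigma>1)
         (S (nval (NAdd n2 (NNum 1)) \<sigma>1) (nval (NAdd n5 (NNum 5)) \<sigma>1) (reals \<sigma>1 ''A'') (\<lambda>i. reals \<sigma>1 ''b'' i 0)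
           (\<lambda>j. reals \<sigma>1 ''obj'' j 0)) \<sigma>1) (1 + 30 * N) ?Q"
        unfolding nv res_def[symmetric] \<sigma>2_def[symmetric] by (rule final)
      show "1 + (nval (NAdd n2 (NNum 1)) \<sigma>1 + nval (NAdd n5 (NNum 5)) \<sigma>1) ^ 3 \<le> 1 + (?C + ?R) ^ 3"
        unfolding nv ..
    qed
  next
    show "600 * N ^ 3 + (1 + (?C + ?R) ^ 3 + (1 + 30 * N)) \<le> 3000 * N ^ 3"
      using n big by linarith
  qed
qed

lemma runs_candidate:
  assumes S: "lp_solver_correct S" and inp: "inp \<sigma>" and q: "multipliers_ok \<sigma>" and tab: "table_ok i \<sigma>"
    and i: "nats \<sigma> ''i'' 0 0 = i" "i \<in> {1..N}" and j: "nats \<sigma> ''j'' 0 0 = j" "j \<le> length ks"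
    and st: "search_state P \<sigma>"
  shows "runs S candidate_prog \<sigma> (3002 * N ^ 3) (search_state (insert (a i / multiplier j) P))"
proof -
  let ?l = "a i / multiplier j"
  have n: "1 \<le> N ^ 3" using N_pos by simp
  have "nval (NV ''i'') \<sigma> \<in> {1..N}" using i by simp
  from input_exprs(1)[OF inp this] have "rval (RDiv (aE (NV ''i'')) (R1 ''q'' (NV ''j''))) \<sigma> = ?l"
    using i j q by (simp add: multipliers_ok_def)
  note e = this
  let ?\<sigma> = "\<sigma>\<lparr>reals := upd (reals \<sigma>) ''l'' 0 0 ?l\<rparr>"
  have ag: "agree {} {''l''} \<sigma> ?\<sigma>" by (simp add: agree_def upd_array)
  have i1: "inp ?\<sigma>" by (rule input_agree[OF inp ag]) auto
  have st1: "search_state P ?\<sigma>" by (rule search_state_agree[OF st ag]) auto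
  have l1: "reals ?\<sigma> ''l'' 0 0 = ?l" by simp
  have "nval (NNum 1) ?\<sigma> \<in> {1..N}" using one_road by simp
  from input_exprs(1)[OF i1 this] have a1: "rval (aE (NNum 1)) ?\<sigma> = a 1" by simp
  have main: "runs S (Cond (RLess (RV ''l'') (aE (NNum 1))) Skip solve_prog) ?\<sigma> (3001 * N ^ 3)
      (search_state (insert ?l P))"
  proof (rule runs_Cond[where ?T1.0 = "3000 * N ^ 3"])
    assume "bval (RLess (RV ''l'') (aE (NNum 1))) ?\<sigma>"
    then have "?l < a 1" using a1 by simp
    then have "search_state (insert ?l P) ?\<sigma>" using st1 unfolding search_state_def by auto
    then show "runs S Skip ?\<sigma> (3000 * N ^ 3) (search_state (insert ?l P))"
      using n by (intro runs_Skip) auto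
  next
    assume "\<not> bval (RLess (RV ''l'') (aE (NNum 1))) ?\<sigma>"
    then have l: "a 1 \<le> ?l" using a1 by simp
    then have pos: "0 < ?l" using a_pos[OF one_road] by linarith
    have "reals ?\<sigma> ''T'' k (nats ?\<sigma> ''j'' 0 0) = \<phi> (max ?l (a k) / ?l)" if "k \<in> {1..N}" for k
      using tab that j candidate_ratio[OF i(2) refl pos, of k] by (simp add: table_ok_def upd_array)
    then show "runs S solve_prog ?\<sigma> (3000 * N ^ 3) (search_state (insert ?l P))"
      by (rule runs_solve[OF S i1 l1 l _ st1])
  qed (use n in linarith)
  show ?thesis
    unfolding candidate_prog_def
    by (rule runs_Seq[where ?T1.0 = 1 and ?T2.0 = "3001 * N ^ 3"], rule runs_RAssign)
      (use main e n in \<open>simp_all\<close>)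
qed

definition visited :: "nat \<Rightarrow> real set" where
  "visited n = (\<lambda>(i, j). a i / multiplier j) ` ({1..<n} \<times> {..length ks})"

lemma visited_all: "visited (Suc N) = candidates"
proof -
  have "multiplier ` {..length ks} = insert 1 (set ks)"
  proof -
    have "{..length ks} = insert (length ks) {..<length ks}" by auto
    moreover have "multiplier ` {..<length ks} = (!) ks ` {..<length ks}"
      by (intro image_cong) (auto simp: multiplier_def)
    ultimately show ?thesis by (auto simp: multiplier_def set_conv_nth image_def)
  qed
  then have "candidates = (\<lambda>(i, q). a i / q) ` ({1..N} \<times> multiplier ` {..length ks})"
    by (simp add: candidates_def)
  also have "\<dots> = visited (Suc N)"
    unfolding visited_def atLeastLessThanSuc_atLeastAtMost by force
  finally show ?thesis ..
qed

lemma visited_Suc: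
  assumes "1 \<le> n"
  shows "visited (Suc n) = visited n \<union> (\<lambda>j. a n / multiplier j) ` {..<Suc (length ks)}"
proof -
  have "{1..<Suc n} \<times> {..length ks} = ({1..<n} \<times> {..length ks}) \<union> Pair n ` {..length ks}"
    using assms by auto
  then show ?thesis
    by (simp only: visited_def image_Un image_image prod.case lessThan_Suc_atMost)
qed

text \<open>
  Each of the \<open>N * (|K| + 1)\<close> candidates costs at most a constant times \<open>N\<^sup>3\<close>, and the
  tables add \<open>O(|K| N\<^sup>2)\<close>.
\<close>

lemma runs_search:
  assumes S: "lp_solver_correct S" and inp: "inp \<sigma>"
  shows "runs S search_prog \<sigma> (10000 * length ks * N ^ 5) (search_state candidates)"
proof -
  define K where "K = length ks"
  have K: "1 \<le> K" using K_pos by (simp add: K_def)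
  let ?inner = "For ''j'' 0 (NAdd nK (NNum 1)) candidate_prog"
  let ?body = "Seq tables_prog ?inner"
  let ?TI = "2 + (Suc K - 0) * (3002 * N ^ 3 + 2)"
  let ?TB = "(2 + N * (35 * K + 2)) + ?TI"
  have inner: "runs S ?inner \<sigma>1 ?TI (\<lambda>\<sigma>'. search_state (visited (Suc i)) \<sigma>')"
    if i1: "inp \<sigma>1" and q1: "multipliers_ok \<sigma>1" and t1: "table_ok i \<sigma>1" and i: "nats \<sigma>1 ''i'' 0 0 = i" "i \<in> {1..N}"
      and st: "search_state (visited i) \<sigma>1" for \<sigma>1 i
  proof (rule runs_For[where H = "Suc K" and T = "3002 * N ^ 3"
        and I = "\<lambda>m. search_state (visited i \<union> (\<lambda>j. a i / multiplier j) ` {..<m})", OF _ _ _ _ _ _ order_refl])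
    fix j \<sigma>2
    assume j: "j < Suc K" "nats \<sigma>2 ''j'' 0 0 = j"
      and st2: "search_state (visited i \<union> (\<lambda>j. a i / multiplier j) ` {..<j}) \<sigma>2"
      and ag: "agree (insert ''j'' (nat_writes candidate_prog)) (real_writes candidate_prog) \<sigma>1 \<sigma>2"
    have i2: "inp \<sigma>2" by (rule input_agree[OF i1 ag]) auto
    have q2: "multipliers_ok \<sigma>2" by (rule multipliers_agree[OF q1 ag]) auto
    have t2: "table_ok i \<sigma>2" by (rule table_agree[OF t1 ag]) auto
    have n2: "nats \<sigma>2 ''i'' 0 0 = i" using agree_nats[OF ag, of "''i''"] i by simp
    have j2: "j \<le> length ks" using j by (simp add: K_def)
    show "runs S candidate_prog \<sigma>2 (3002 * N ^ 3) (\<lambda>\<sigma>''.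
        search_state (visited i \<union> (\<lambda>j. a i / multiplier j) ` {..<Suc j}) (\<sigma>''\<lparr>nats := upd (nats \<sigma>'') ''j'' 0 0 (Suc j)\<rparr>))"
    proof (rule runs_conseq[OF runs_candidate[OF S i2 q2 t2 n2 i(2) j(2) j2 st2] order_refl])
      fix \<sigma>3 assume "search_state (insert (a i / multiplier j) (visited i \<union> (\<lambda>j. a i / multiplier j) ` {..<j})) \<sigma>3"
      then have "search_state (visited i \<union> (\<lambda>j. a i / multiplier j) ` {..<Suc j}) \<sigma>3"
        by (simp add: lessThan_Suc)
      then show "search_state (visited i \<union> (\<lambda>j. a i / multiplier j) ` {..<Suc j}) (\<sigma>3\<lparr>nats := upd (nats \<sigma>3) ''j'' 0 0 (Suc j)\<rparr>)"
        by (rule search_state_agree[of _ _ "{''j''}" "{}"]) (simp_all add: agree_def upd_array)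
    qed
  next
    fix \<sigma>' assume ag: "agree (insert ''j'' (nat_writes candidate_prog)) (real_writes candidate_prog) \<sigma>1 \<sigma>'"
    have "inp \<sigma>'" by (rule input_agree[OF i1 ag]) auto
    then show "nval (NAdd nK (NNum 1)) \<sigma>' = Suc K" by (simp add: input_sizes K_def)
  next
    show "search_state (visited i \<union> (\<lambda>j. a i / multiplier j) ` {..<0}) (\<sigma>1\<lparr>nats := upd (nats \<sigma>1) ''j'' 0 0 0\<rparr>)"
      by (rule search_state_agree[of _ \<sigma>1 "{''j''}" "{}"]) (use st in \<open>simp_all add: agree_def upd_array\<close>)
  qed (use i in \<open>auto simp: visited_Suc K_def\<close>)
  have outer: "runs S (For ''i'' 1 (NAdd nN (NNum 1)) ?body) \<sigma>1 (2 + (Suc N - 1) * (?TB + 2)) (search_state candidates)"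
    if i1: "inp \<sigma>1" and q1: "multipliers_ok \<sigma>1" and f1: "nats \<sigma>1 ''found'' 0 0 = 0" for \<sigma>1
  proof (rule runs_For[where H = "Suc N" and T = ?TB and I = "\<lambda>m. search_state (visited m)", OF _ _ _ _ _ _ order_refl])
    fix i \<sigma>2
    assume i: "1 \<le> i" "i < Suc N" "nats \<sigma>2 ''i'' 0 0 = i" and st2: "search_state (visited i) \<sigma>2"
      and ag: "agree (insert ''i'' (nat_writes ?body)) (real_writes ?body) \<sigma>1 \<sigma>2"
    have iN: "i \<in> {1..N}" using i by simp
    have i2: "inp \<sigma>2" by (rule input_agree[OF i1 ag]) auto
    have q2: "multipliers_ok \<sigma>2" by (rule multipliers_agree[OF q1 ag]) auto
    have tabs: "runs S tables_prog \<sigma>2 (2 + N * (35 * K + 2)) (table_ok i)"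
      using runs_tables[OF i2 q2 i(3) iN] by (simp add: K_def)
    show "runs S ?body \<sigma>2 ?TB (\<lambda>\<sigma>''. search_state (visited (Suc i)) (\<sigma>''\<lparr>nats := upd (nats \<sigma>'') ''i'' 0 0 (Suc i)\<rparr>))"
    proof (rule runs_Seq[OF _ order_refl], rule runs_conseq[OF tabs order_refl])
      fix \<sigma>3 assume t3: "table_ok i \<sigma>3" and ag3: "agree (nat_writes tables_prog) (real_writes tables_prog) \<sigma>2 \<sigma>3"
      have i3: "inp \<sigma>3" by (rule input_agree[OF i2 ag3]) auto
      have q3: "multipliers_ok \<sigma>3" by (rule multipliers_agree[OF q2 ag3]) auto
      have n3: "nats \<sigma>3 ''i'' 0 0 = i" using agree_nats[OF ag3, of "''i''"] i by simp
      have st3: "search_state (visited i) \<sigma>3" by (rule search_state_agree[OF st2 ag3]) auto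
      show "runs S ?inner \<sigma>3 ?TI (\<lambda>\<sigma>''. search_state (visited (Suc i)) (\<sigma>''\<lparr>nats := upd (nats \<sigma>'') ''i'' 0 0 (Suc i)\<rparr>))"
      proof (rule runs_conseq[OF inner[OF i3 q3 t3 n3 iN st3] order_refl])
        fix \<sigma>4 assume "search_state (visited (Suc i)) \<sigma>4"
        then show "search_state (visited (Suc i)) (\<sigma>4\<lparr>nats := upd (nats \<sigma>4) ''i'' 0 0 (Suc i)\<rparr>)"
          by (rule search_state_agree[of _ _ "{''i''}" "{}"]) (simp_all add: agree_def upd_array)
      qed
    qed
  next
    fix \<sigma>' assume ag: "agree (insert ''i'' (nat_writes ?body)) (real_writes ?body) \<sigma>1 \<sigma>'"
    have "inp \<sigma>'" by (rule input_agree[OF i1 ag]) auto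
    then show "nval (NAdd nN (NNum 1)) \<sigma>' = Suc N" by (simp add: input_sizes)
  next
    show "search_state (visited 1) (\<sigma>1\<lparr>nats := upd (nats \<sigma>1) ''i'' 0 0 1\<rparr>)"
      using f1 by (simp add: search_state_def visited_def upd_array)
  qed (use visited_all in auto)
  show ?thesis
    unfolding search_prog_def
  proof (rule runs_Seq[where ?T1.0 = "2 + (Suc K - 0) * (cdepth cell_q + 2)" and ?T2.0 = "1 + (2 + (Suc N - 1) * (?TB + 2))"],
      rule runs_Fill[where H = "Suc K" and V = multiplier, OF _ _ _ _ order_refl])
    fix \<sigma>1 assume ag1: "agree {''j''} {''q''} \<sigma> \<sigma>1"
    have i1: "inp \<sigma>1" by (rule input_agree[OF inp ag1]) auto
    show "nval (NAdd nK (NNum 1)) \<sigma>1 = Suc K" using input_sizes[OF i1] by (simp add: K_def)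
    show "cval cell_q \<sigma>1 = multiplier j" if "nats \<sigma>1 ''j'' 0 0 = j" for j
      using that input_sizes[OF i1] input_kappa[OF i1] by (simp add: cell_q_def multiplier_def)
    assume q: "\<And>j. 0 \<le> j \<Longrightarrow> j < Suc K \<Longrightarrow> reals \<sigma>1 ''q'' j 0 = multiplier j"
    then have q1: "multipliers_ok \<sigma>1" by (simp add: multipliers_ok_def K_def)
    show "runs S (Seq (nset ''found'' (NNum 0)) (For ''i'' 1 (NAdd nN (NNum 1)) ?body)) \<sigma>1
        (1 + (2 + (Suc N - 1) * (?TB + 2))) (search_state candidates)"
    proof (rule runs_Seq[OF _ order_refl], rule runs_NAssign, rule outer)
      let ?\<sigma> = "\<sigma>1\<lparr>nats := upd (nats \<sigma>1) ''found'' (nval (NNum 0) \<sigma>1) (nval (NNum 0) \<sigma>1) (nval (NNum 0) \<sigma>1)\<rparr>"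
      have ag: "agree {''found''} {} \<sigma>1 ?\<sigma>" by (simp add: agree_def upd_array)
      show "inp ?\<sigma>" by (rule input_agree[OF i1 ag]) auto
      show "multipliers_ok ?\<sigma>" by (rule multipliers_agree[OF q1 ag]) auto
    qed simp_all
  next
    have "N ^ 1 \<le> N ^ 5" "N ^ 2 \<le> N ^ 5" "N ^ 4 \<le> N ^ 5" "1 \<le> N ^ 5"
      using N_pos by (intro power_increasing one_le_power; simp)+
    then have n: "N \<le> N ^ 5" "N * N \<le> N ^ 5" "N * N ^ 3 \<le> N ^ 5" "1 \<le> N ^ 5"
      by (simp_all add: power2_eq_square power_Suc[symmetric])
    define M where "M = K * N ^ 5"
    have M: "K \<le> M" "K * N \<le> M" "K * (N * N) \<le> M" "K * (N * N ^ 3) \<le> M" "N \<le> M" "N * N \<le> M" "N * N ^ 3 \<le> M" "1 \<le> M"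
      using n K mult_le_mono[OF K, of _ "N ^ 5"] mult_le_mono2[of _ "N ^ 5" K] unfolding M_def
      by (metis mult_1 mult.right_neutral order_trans)+
    have "cdepth cell_q = 2" by (simp add: cell_q_def)
    then have "2 + (Suc K - 0) * (cdepth cell_q + 2) + (1 + (2 + (Suc N - 1) * (?TB + 2)))
        = 9 + 4 * K + 35 * (K * (N * N)) + 2 * (N * N) + 3002 * (K * (N * N ^ 3)) + 3002 * (N * N ^ 3) + 2 * (K * N) + 8 * N"
      by (simp add: algebra_simps)
    also have "\<dots> \<le> 10000 * M" using M by linarith
    finally show "2 + (Suc K - 0) * (cdepth cell_q + 2) + (1 + (2 + (Suc N - 1) * (?TB + 2))) \<le> 10000 * length ks * N ^ 5"
      by (simp add: M_def K_def)
  qed simp_all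
qed

text \<open>
  Every equilibrium is beaten by a saturated routing of some candidate, and saturated routings are
  equilibria; so optimality over the candidates is optimality over all equilibria.
\<close>

lemma search_state_output:
  assumes st: "search_state candidates \<sigma>"
  shows "output_correct net xbar ybar \<phi> \<sigma>"
proof -
  have covered: "\<exists>l x y. l \<in> candidates \<and> a 1 \<le> l \<and> saturated l x y \<and> cost l x y \<le> total_latency net r"
    if r: "r \<in> ANE net xbar ybar l0 \<phi>" for r l0
  proof -
    obtain l where l: "a 1 \<le> l" "r \<in> ANE net xbar ybar l \<phi>" using ANE_lift[OF r] .
    obtain x y s where [simp]: "r = (x, y, s)" by (cases r)
    from l(2) have rel: "relaxed l x y" "cost l x y \<le> total_latency net r"
      using ANE_relaxed[OF _ l(1)] by auto
    then show ?thesis using relaxed_to_saturated[OF rel(1) l(1)] by fastforce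
  qed
  show ?thesis
  proof (cases "nats \<sigma> ''found'' 0 0 = 1")
    case True
    define l where "l = reals \<sigma> ''l0'' 0 0"
    let ?x = "\<lambda>k. reals \<sigma> ''x'' k 0" and ?y = "\<lambda>k. reals \<sigma> ''y'' k 0"
    have rec: "a 1 \<le> l" "saturated l ?x ?y" "cost l ?x ?y \<le> reals \<sigma> ''best'' 0 0"
        "\<And>k. k \<in> {1..N} \<Longrightarrow> nats \<sigma> ''s'' k 0 = state_at l k" "road_index (Suc N) l (nats \<sigma> ''m'' 0 0)"
      and best: "\<And>l' x y. l' \<in> candidates \<Longrightarrow> a 1 \<le> l' \<Longrightarrow> saturated l' x y \<Longrightarrow> reals \<sigma> ''best'' 0 0 \<le> cost l' x y"
      using st True by (auto simp: search_state_def recorded_def Let_def l_def)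
    have s: "(\<lambda>i\<in>{1..N}. nats \<sigma> ''s'' i 0) = state_at l"
    proof -
      have "(\<lambda>i\<in>{1..N}. nats \<sigma> ''s'' i 0) = restrict (state_at l) {1..N}"
        by (rule restrict_ext) (rule rec(4))
      moreover have "restrict (state_at l) {1..N} = state_at l"
        by (rule extensional_restrict) (simp add: state_at_def)
      ultimately show ?thesis by simp
    qed
    have out: "output_of net \<sigma> = (nats \<sigma> ''m'' 0 0, l, restrict ?x {1..N}, restrict ?y {1..N}, state_at l)"
      unfolding output_of_def l_def[symmetric] s ..
    note A = saturated_ANE[OF rec(2,1)]
    have "output_of net \<sigma> \<in> opt_solutions net xbar ybar \<phi>"
      unfolding out opt_solutions_def is_arg_min_def mem_Collect_eq prod.case
    proof (intro conjI notI)
      show "nats \<sigma> ''m'' 0 0 \<in> {1..N}"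
        "ereal l \<in> {ff_latency_ext net (nats \<sigma> ''m'' 0 0)..<ff_latency_ext net (Suc (nats \<sigma> ''m'' 0 0))}"
        using road_index_interval[OF rec(5)] by auto
      show "(restrict ?x {1..N}, restrict ?y {1..N}, state_at l) \<in> ANE net xbar ybar l \<phi>" by (rule A(1))
      assume "\<exists>p. (case p of (m, l0, r) \<Rightarrow> m \<in> {1..N} \<and>
            ereal l0 \<in> {ff_latency_ext net m..<ff_latency_ext net (Suc m)} \<and> r \<in> ANE net xbar ybar l0 \<phi>) \<and>
          (case p of (m, l0, r) \<Rightarrow> total_latency net r)
            < total_latency net (restrict ?x {1..N}, restrict ?y {1..N}, state_at l)"
      then obtain l0 r where r: "r \<in> ANE net xbar ybar l0 \<phi>" "total_latency net r < cost l ?x ?y"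
        unfolding A(2) by auto
      obtain l' x y where "l' \<in> candidates" "a 1 \<le> l'" "saturated l' x y" "cost l' x y \<le> total_latency net r"
        using covered[OF r(1)] by blast
      then show False using best[of l' x y] rec(3) r(2) by linarith
    qed
    then show ?thesis using True by (simp add: output_correct_def)
  next
    case False
    then have none: "\<And>l x y. l \<in> candidates \<Longrightarrow> a 1 \<le> l \<Longrightarrow> \<not> saturated l x y"
      using st by (auto simp: search_state_def)
    have "opt_solutions net xbar ybar \<phi> = {}"
    proof (rule equals0I)
      fix p assume "p \<in> opt_solutions net xbar ybar \<phi>"
      then obtain l0 r where "r \<in> ANE net xbar ybar l0 \<phi>"
        by (cases p) (auto simp: opt_solutions_def is_arg_min_def)
      then show False using covered none by blast
    qed
    then show ?thesis using False by (simp add: output_correct_def)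
  qed
qed

end

theorem theorem4:
  "(\<forall>net xbar ybar \<phi> ks ps.
      valid_network net \<and> 0 \<le> xbar \<and> 0 \<le> ybar \<and> altruism_profile \<phi> ks ps \<longrightarrow>
        (\<lambda>(m, l0, r). r) ` opt_solutions net xbar ybar \<phi> = BANE net xbar ybar \<phi>)
   \<and>
   (\<exists>prog c. \<forall>S net xbar ybar \<phi> ks ps \<sigma>.
      lp_solver_correct S \<and>
      valid_network net \<and> 0 \<le> xbar \<and> 0 \<le> ybar \<and> altruism_profile \<phi> ks ps \<and>
      input_state net xbar ybar ks ps \<sigma> \<longrightarrow>
        (\<exists>t \<sigma>'. exec S prog \<sigma> t \<sigma>' \<and>
           t \<le> c * length ks * roads net ^ 5 \<and>
           output_correct net xbar ybar \<phi> \<sigma>'))"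
proof (rule conjI, intro allI impI)
  fix net :: network and xbar ybar :: real and \<phi> :: "real \<Rightarrow> real" and ks ps :: "real list"
  assume "valid_network net \<and> 0 \<le> xbar \<and> 0 \<le> ybar \<and> altruism_profile \<phi> ks ps"
  then interpret mixed_traffic net xbar ybar \<phi> ks ps by unfold_locales auto
  show "(\<lambda>(m, l0, r). r) ` opt_solutions net xbar ybar \<phi> = BANE net xbar ybar \<phi>"
    by (rule opt_solutions_BANE)
next
  show "\<exists>prog c. \<forall>S net xbar ybar \<phi> ks ps \<sigma>.
      lp_solver_correct S \<and>
      valid_network net \<and> 0 \<le> xbar \<and> 0 \<le> ybar \<and> altruism_profile \<phi> ks ps \<and>
      input_state net xbar ybar ks ps \<sigma> \<longrightarrow>
        (\<exists>t \<sigma>'. exec S prog \<sigma> t \<sigma>' \<and>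
           t \<le> c * length ks * roads net ^ 5 \<and>
           output_correct net xbar ybar \<phi> \<sigma>')"
  proof (rule exI[of _ search_prog], rule exI[of _ 10000], intro allI impI)
    fix S :: lp_solver and net :: network and xbar ybar :: real and \<phi> :: "real \<Rightarrow> real"
      and ks ps :: "real list" and \<sigma> :: state
    assume *: "lp_solver_correct S \<and>
        valid_network net \<and> 0 \<le> xbar \<and> 0 \<le> ybar \<and> altruism_profile \<phi> ks ps \<and>
        input_state net xbar ybar ks ps \<sigma>"
    then interpret mixed_traffic net xbar ybar \<phi> ks ps by unfold_locales auto
    show "\<exists>t \<sigma>'. exec S search_prog \<sigma> t \<sigma>' \<and> t \<le> 10000 * length ks * roads net ^ 5 \<and>
        output_correct net xbar ybar \<phi> \<sigma>'"
      using runs_search[of S \<sigma>] search_state_output * unfolding runs_def by blast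
  qed
qed

end
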